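(* Let $d\ge2$ be an integer and $\alpha\in(0,1)$. Let $(X_v)_{v\in\mathbb{Z}_+^d}$ be a family of i.i.d. random variables with law $\mu_\alpha$. For $n\in\mathbb{N}$ set $T(X)=T_{0,(n,\dots,n)}(X)$. Then the sequence $T(X)/n$ satisfies a large deviations principle on $\mathbb{R}$ with speed $n^\alpha$ and good rate function $L_\alpha$ defined by $$L_\alpha(x)=\begin{cases}(x-g(1,\dots,1))^\alpha&\text{if }x\ge g(1,\dots,1),\\ +\infty&\text{otherwise.}\end{cases}$$
   Context: $\mu_\alpha$ is the probability measure on $\mathbb{R}_+$ with density $Z_\alpha^{-1}e^{-x^\alpha}$ ($Z_\alpha$ the normalizing constant). $\mathbb{Z}_+^d$ is the set of vectors of $\mathbb{Z}^d$ with non-negative coordinates. A directed path is a path in which at each step one coordinate is increased by $1$. $\Pi(v_1,v_2)$ is the set of directed paths from $v_1$ to $v_2$, a path being identified with the set of its vertices. The last-passage time is $$T_{v_1,v_2}(X)=\sup_{\pi\in\Pi(v_1,v_2)}\sum_{v\in\pi}X_v.$$ The function $g:\mathbb{R}_+^d\to\mathbb{R}$ is defined by $g(v)=\lim_{n\to+\infty}\frac1n\mathbb{E}\,T_{0,\lfloor nv\rfloor}(X)$ (floor taken coordinatewise); it is known (Martin) that this limit exists and that $g$ is continuous, for i.i.d. weights whose distribution function $F$ satisfies $\int_0^{+\infty}(1-F(t))^{1/d}dt<+\infty$, in particular for law $\mu_\alpha$. Large deviations principle (LDP) with speed $v(n)\to+\infty$ and rate function $J$ (lower semicontinuous, valued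 in $[0,+\infty]$): for every Borel set $B$, $-\inf_{B^\circ}J\le\liminf\frac1{v(n)}\log\mathbb{P}(Z_n\in B)\le\limsup\frac1{v(n)}\log\mathbb{P}(Z_n\in B)\le-\inf_{\overline B}J$. $J$ is good if all level sets $\{J\le t\}$, $t\in[0,+\infty)$, are compact. *)

theory Defs
  imports "HOL-Probability.Probability"
begin

definition lower_semicontinuous :: "('b::topological_space \<Rightarrow> ereal) \<Rightarrow> bool" where
  "lower_semicontinuous J \<longleftrightarrow> (\<forall>x. \<forall>t. t < J x \<longrightarrow> (\<forall>\<^sub>F y in nhds x. t < J y))"

definition rate_function :: "('b::topological_space \<Rightarrow> ereal) \<Rightarrow> bool" where
  "rate_function J \<longleftrightarrow> (\<forall>x. 0 \<le> J x) \<and> lower_semicontinuous J"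

definition good_rate_function :: "('b::topological_space \<Rightarrow> ereal) \<Rightarrow> bool" where
  "good_rate_function J \<longleftrightarrow> rate_function J \<and> (\<forall>t::real. 0 \<le> t \<longrightarrow> compact {x. J x \<le> ereal t})"

text \<open>Logarithm of a probability, with \<open>log 0 = -\<infinity>\<close> (whereas \<open>ln 0 = 0\<close> in the library).\<close>

definition log_prob :: "real \<Rightarrow> ereal" where
  "log_prob p = (if p = 0 then -\<infinity> else ereal (ln p))"

definition LDP ::
  "'a measure \<Rightarrow> (nat \<Rightarrow> 'a \<Rightarrow> 'b::topological_space) \<Rightarrow> (nat \<Rightarrow> real) \<Rightarrow> ('b \<Rightarrow> ereal) \<Rightarrow> bool" where
  "LDP M Z v J \<longleftrightarrow>
     filterlim v at_top sequentially \<and>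
     rate_function J \<and>
     (\<forall>n. Z n \<in> borel_measurable M) \<and>
     (\<forall>B \<in> sets borel.
        - (INF x\<in>interior B. J x)
          \<le> liminf (\<lambda>n. ereal (1 / v n) * log_prob (measure M {\<omega> \<in> space M. Z n \<omega> \<in> B})) \<and>
        limsup (\<lambda>n. ereal (1 / v n) * log_prob (measure M {\<omega> \<in> space M. Z n \<omega> \<in> B}))
          \<le> - (INF x\<in>closure B. J x))"

definition Z_const :: "real \<Rightarrow> real" where
  "Z_const \<alpha> = (LINT x:{0..}|lborel. exp (- (x powr \<alpha>)))"

definition mu :: "real \<Rightarrow> real measure" where
  "mu \<alpha> = density lborel (\<lambda>x. ennreal (indicator {0..} x * exp (- (x powr \<alpha>)) / Z_const \<alpha>))"

text \<open>\<open>\<int>\<^sub>+\<^sup>d\<close> is the type \<open>nat ^ 'd\<close> with \<open>d = CARD('d)\<close>.\<close>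

definition directed_step :: "nat ^ 'd \<Rightarrow> nat ^ 'd \<Rightarrow> bool" where
  "directed_step v w \<longleftrightarrow> (\<exists>i. w = v + axis i 1)"

definition directed_paths :: "nat ^ 'd \<Rightarrow> nat ^ 'd \<Rightarrow> (nat ^ 'd) set set" where
  "directed_paths v1 v2 =
     {set vs | vs. vs \<noteq> [] \<and> hd vs = v1 \<and> last vs = v2 \<and> successively directed_step vs}"

text \<open>For \<open>v1 \<le> v2\<close> the supremum is over a finite nonempty set; otherwise there is no path and
  the value is unspecified.\<close>

definition last_passage :: "nat ^ 'd \<Rightarrow> nat ^ 'd \<Rightarrow> (nat ^ 'd \<Rightarrow> real) \<Rightarrow> real" where
  "last_passage v1 v2 X = (SUP \<pi>\<in>directed_paths v1 v2. \<Sum>v\<in>\<pi>. X v)"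

text \<open>Only meaningful at vectors with non-negative coordinates.\<close>

definition time_constant ::
  "'a measure \<Rightarrow> (nat ^ 'd \<Rightarrow> 'a \<Rightarrow> real) \<Rightarrow> real ^ 'd \<Rightarrow> real" where
  "time_constant M X v =
     lim (\<lambda>n. 1 / real n *
       (LINT \<omega>|M. last_passage 0 (\<chi> i. nat \<lfloor>real n * v $ i\<rfloor>) (\<lambda>u. X u \<omega>)))"

definition rate_L :: "real \<Rightarrow> real \<Rightarrow> real \<Rightarrow> ereal" where
  "rate_L \<alpha> g1 x = (if x \<ge> g1 then ereal ((x - g1) powr \<alpha>) else \<infinity>)"

end

theory Submission
  imports Defs "HOL-Probability.Hoeffding" "HOL-Real_Asymp.Real_Asymp"
begin

text \<open>
  The passage time is large because of one large weight. Fix a small \<open>\<delta> > 0\<close> and split each weight at the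
  threshold \<open>n powr \<delta>\<close>. Along any path, the passage time \<open>T\<close> exceeds the passage time of the clipped
  weights by at most the sum of all weights in the box that are above the threshold.

  The clipped passage time does not deviate at speed \<open>n powr \<alpha>\<close>. A directed path meets each layer of
  sites with a given coordinate sum exactly once, so changing all weights of one layer changes the clipped
  passage time by at most \<open>n powr \<delta>\<close>. As there are about \<open>n\<close> layers, McDiarmid's inequality
  (\<open>bounded_differences_mgf\<close>, \<open>lpp_clip_deviation\<close>) bounds the probability of a deviation of order \<open>n\<close> by
  \<open>exp (- c * n powr (1 - 2 * \<delta>))\<close>, and \<open>1 - 2 * \<delta> > \<alpha>\<close>. In particular deviations of \<open>T\<close> below its mean are
  negligible (\<open>passage_lower_tail\<close>), and the rate function is infinite to the left of the time constant \<open>g\<close>.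

  The large weights do deviate. If they add up to \<open>y * n\<close>, then their \<open>\<alpha>\<close>-th powers add up to at least
  \<open>(y * n) powr \<alpha>\<close>, since \<open>\<alpha> < 1\<close>. The \<open>\<alpha>\<close>-th power of a weight has exponential moments of every order
  below \<open>1\<close>, and above the threshold these are so close to \<open>1\<close> that their product over the box stays
  bounded. Markov's inequality gives the probability \<open>exp (- l * (y * n) powr \<alpha>)\<close> for every \<open>l < 1\<close>
  (\<open>excess_tail\<close>), whence the upper bound (\<open>passage_upper_tail\<close>).

  For the lower bound (\<open>passage_window\<close>), every path contains the origin. Its weight is independent of the
  remaining passage time and takes a value near \<open>a * n\<close> with probability about \<open>exp (- (a * n) powr \<alpha>)\<close>,
  while the remaining passage time is close to \<open>g * n\<close> with probability at least \<open>1/2\<close>.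

  It remains to see that the limit defining \<open>g\<close> exists and is finite (\<open>time_constant_limit\<close>). Concatenation of
  paths makes the mean of \<open>T\<close> superadditive up to the mean of one weight, so Fekete's lemma reduces this
  to a linear bound. For the mean \<open>a k\<close> of the best path with \<open>k\<close> vertices and free end point,
  concentration gives \<open>a (2 * k) \<le> 2 * a k + K * k powr (3/4)\<close>: the second half of the path is optimized over
  polynomially many starting sites, and the maximum of as many concentrated variables is close to
  their common mean. Iterated along powers of two, this yields \<open>a k \<le> C * k\<close> (\<open>line_mean_linear\<close>).
\<close>

section \<open>Last-passage values of families of site sets\<close>

text \<open>The family of site sets is arbitrary: besides the directed paths between two corners, the proof uses
  paths with a free end point and paths from which the origin has been removed.\<close>

definition lpp :: "'v set set \<Rightarrow> ('v \<Rightarrow> real) \<Rightarrow> real" where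
  "lpp P x = (SUP \<pi>\<in>P. \<Sum>v\<in>\<pi>. x v)"

lemma last_passage_eq_lpp: "last_passage u w x = lpp (directed_paths u w) x"
  by (simp add: last_passage_def lpp_def)

lemma lpp_upper:
  assumes "finite P" "\<pi> \<in> P"
  shows "(\<Sum>v\<in>\<pi>. x v) \<le> lpp P x"
  unfolding lpp_def using assms by (intro cSUP_upper bdd_above_finite) auto

lemma lpp_least:
  assumes "P \<noteq> {}" "\<And>\<pi>. \<pi> \<in> P \<Longrightarrow> (\<Sum>v\<in>\<pi>. x v) \<le> c"
  shows "lpp P x \<le> c"
  unfolding lpp_def using assms by (intro cSUP_least) auto

lemma lpp_attained:
  assumes "finite P" "P \<noteq> {}"
  obtains \<pi> where "\<pi> \<in> P" "lpp P x = (\<Sum>v\<in>\<pi>. x v)"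
proof -
  have "lpp P x = Max ((\<lambda>\<pi>. \<Sum>v\<in>\<pi>. x v) ` P)"
    unfolding lpp_def using assms by (intro cSup_eq_Max) auto
  moreover have "Max ((\<lambda>\<pi>. \<Sum>v\<in>\<pi>. x v) ` P) \<in> (\<lambda>\<pi>. \<Sum>v\<in>\<pi>. x v) ` P"
    using assms by (intro Max_in) auto
  ultimately show ?thesis using that by auto
qed

lemma lpp_cong:
  assumes "\<And>v. v \<in> \<Union>P \<Longrightarrow> x v = y v"
  shows "lpp P x = lpp P y"
  unfolding lpp_def using assms by (intro arg_cong[where f = Sup] image_cong sum.cong) auto

lemma lpp_mono:
  assumes "finite P" "P \<noteq> {}" "\<And>v. v \<in> \<Union>P \<Longrightarrow> x v \<le> y v"
  shows "lpp P x \<le> lpp P y"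
proof (rule lpp_least[OF assms(2)])
  fix \<pi> assume \<pi>: "\<pi> \<in> P"
  have "(\<Sum>v\<in>\<pi>. x v) \<le> (\<Sum>v\<in>\<pi>. y v)" using assms(3) \<pi> by (intro sum_mono) auto
  also have "\<dots> \<le> lpp P y" by (rule lpp_upper) fact+
  finally show "(\<Sum>v\<in>\<pi>. x v) \<le> lpp P y" .
qed

lemma lpp_nonneg:
  assumes "finite P" "P \<noteq> {}" "\<And>v. v \<in> \<Union>P \<Longrightarrow> 0 \<le> x v"
  shows "0 \<le> lpp P x"
proof -
  obtain \<pi> where "\<pi> \<in> P" using assms(2) by auto
  hence "0 \<le> (\<Sum>v\<in>\<pi>. x v)" using assms(3) by (intro sum_nonneg) auto
  also have "\<dots> \<le> lpp P x" by (rule lpp_upper) fact+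
  finally show ?thesis .
qed

text \<open>What a path collects from a nonnegative part \<open>z\<close> of the weights is at most the total of \<open>z\<close> over the
  whole box. This crude bound is applied to the part of the weights above a threshold, which is rarely
  nonzero.\<close>

lemma lpp_le_sum_parts:
  assumes "finite B" "P \<noteq> {}" "finite P" "P \<subseteq> Pow B"
    and "\<And>v. v \<in> B \<Longrightarrow> x v \<le> y v + z v" "\<And>v. v \<in> B \<Longrightarrow> 0 \<le> z v"
  shows "lpp P x \<le> lpp P y + (\<Sum>v\<in>B. z v)"
proof (rule lpp_least[OF assms(2)])
  fix \<pi> assume \<pi>: "\<pi> \<in> P"
  have "(\<Sum>v\<in>\<pi>. x v) \<le> (\<Sum>v\<in>\<pi>. y v) + (\<Sum>v\<in>\<pi>. z v)"
    using assms \<pi> by (subst sum.distrib[symmetric], intro sum_mono) auto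
  moreover have "(\<Sum>v\<in>\<pi>. z v) \<le> (\<Sum>v\<in>B. z v)" using assms \<pi> by (intro sum_mono2) auto
  moreover have "(\<Sum>v\<in>\<pi>. y v) \<le> lpp P y" by (rule lpp_upper) fact+
  ultimately show "(\<Sum>v\<in>\<pi>. x v) \<le> lpp P y + (\<Sum>v\<in>B. z v)" by linarith
qed

lemma abs_lpp_le:
  assumes "finite B" "P \<noteq> {}" "finite P" "P \<subseteq> Pow B"
  shows "\<bar>lpp P x\<bar> \<le> (\<Sum>v\<in>B. \<bar>x v\<bar>)"
proof -
  obtain \<pi> where \<pi>: "\<pi> \<in> P" "lpp P x = (\<Sum>v\<in>\<pi>. x v)" using lpp_attained assms by metis
  have "\<bar>lpp P x\<bar> \<le> (\<Sum>v\<in>\<pi>. \<bar>x v\<bar>)" unfolding \<pi>(2) by (rule sum_abs)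
  also have "\<dots> \<le> (\<Sum>v\<in>B. \<bar>x v\<bar>)" using assms \<pi> by (intro sum_mono2) auto
  finally show ?thesis .
qed

text \<open>A path meets \<open>A\<close> at most once, so it notices a change of the weights in \<open>A\<close> at one site only. For
  \<open>A\<close> a layer of constant level, this is why a last-passage value over \<open>k\<close> layers behaves like a function
  of \<open>k\<close> independent variables with bounded differences, however many sites the layers have.\<close>

lemma lpp_bounded_difference:
  assumes "finite P" "P \<noteq> {}" "\<And>\<pi>. \<pi> \<in> P \<Longrightarrow> finite \<pi> \<and> (\<forall>v\<in>\<pi>. \<forall>w\<in>\<pi>. v \<in> A \<longrightarrow> w \<in> A \<longrightarrow> v = w)"
    and "\<And>v. v \<in> \<Union>P - A \<Longrightarrow> x v = y v" "\<And>v. x v \<le> y v + c" "0 \<le> c"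
  shows "lpp P x \<le> lpp P y + c"
proof (rule lpp_least[OF assms(2)])
  fix \<pi> assume \<pi>: "\<pi> \<in> P"
  have fin: "finite \<pi>" using assms(3) \<pi> by auto
  have "(\<Sum>v\<in>\<pi>. x v) \<le> (\<Sum>v\<in>\<pi>. y v + (if v \<in> A then c else 0))"
  proof (rule sum_mono)
    fix v assume "v \<in> \<pi>"
    hence "v \<in> \<Union>P" using \<pi> by auto
    thus "x v \<le> y v + (if v \<in> A then c else 0)"
      using assms(4)[of v] assms(5)[of v] by (cases "v \<in> A") auto
  qed
  also have "\<dots> = (\<Sum>v\<in>\<pi>. y v) + c * card (\<pi> \<inter> A)"
    using fin by (simp add: sum.distrib sum.If_cases)
  also have "card (\<pi> \<inter> A) \<le> 1" using fin assms(3)[OF \<pi>] by (intro card_le_Suc0_iff_eq[THEN iffD2, simplified One_nat_def[symmetric]]) auto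
  hence "c * card (\<pi> \<inter> A) \<le> c * 1" using assms(6) by (intro mult_left_mono) auto
  also have "(\<Sum>v\<in>\<pi>. y v) \<le> lpp P y" by (rule lpp_upper) fact+
  finally show "(\<Sum>v\<in>\<pi>. x v) \<le> lpp P y + c" by simp
qed

section \<open>Directed paths in the lattice\<close>

definition level :: "nat ^ 'd \<Rightarrow> nat" where
  "level v = (\<Sum>i\<in>UNIV. v $ i)"

definition lattice_box :: "nat \<Rightarrow> (nat ^ 'd) set" where
  "lattice_box n = {v. \<forall>i. v $ i \<le> n}"

text \<open>Paths with \<open>k\<close> vertices and a free end point. Unlike paths with a prescribed end point, they can be cut
  after any number of vertices into two paths of the same kind.\<close>

definition paths_from :: "nat ^ 'd \<Rightarrow> nat \<Rightarrow> (nat ^ 'd) set set" where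
  "paths_from u k = {set vs | vs. vs \<noteq> [] \<and> hd vs = u \<and> length vs = k \<and> successively directed_step vs}"

lemma finite_lattice_box [simp]: "finite (lattice_box n :: (nat ^ 'd::finite) set)"
  and card_lattice_box_le: "card (lattice_box n :: (nat ^ 'd::finite) set) \<le> (n + 1) ^ CARD('d)"
proof -
  have *: "(lattice_box n :: (nat ^ 'd) set) \<subseteq> vec_lambda ` (UNIV \<rightarrow>\<^sub>E {..n})"
  proof
    fix v :: "nat ^ 'd" assume "v \<in> lattice_box n"
    hence "v = vec_lambda (\<lambda>i. v $ i)" "(\<lambda>i. v $ i) \<in> UNIV \<rightarrow>\<^sub>E {..n}" by (auto simp: lattice_box_def)
    thus "v \<in> vec_lambda ` (UNIV \<rightarrow>\<^sub>E {..n})" by blast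
  qed
  have fin: "finite (UNIV \<rightarrow>\<^sub>E {..n} :: ('d \<Rightarrow> nat) set)" by (intro finite_PiE) auto
  show "finite (lattice_box n :: (nat ^ 'd) set)" using * fin finite_surj by blast
  have "card (lattice_box n :: (nat ^ 'd) set) \<le> card (UNIV \<rightarrow>\<^sub>E {..n} :: ('d \<Rightarrow> nat) set)"
    using * fin by (rule surj_card_le[rotated])
  also have "\<dots> = (n + 1) ^ CARD('d)" by (simp add: card_PiE)
  finally show "card (lattice_box n :: (nat ^ 'd::finite) set) \<le> (n + 1) ^ CARD('d)" .
qed

lemma level_zero [simp]: "level 0 = 0" by (simp add: level_def)

lemma zero_in_lattice_box [simp]: "0 \<in> lattice_box n" by (simp add: lattice_box_def)

lemma level_diag [simp]: "level ((\<chi> i. n) :: nat ^ 'd::finite) = CARD('d) * n"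
  by (simp add: level_def)

lemma level_step: "directed_step v w \<Longrightarrow> level w = Suc (level v)"
proof -
  assume "directed_step v w"
  then obtain i where w: "w = v + axis i 1" by (auto simp: directed_step_def)
  have "level w = (\<Sum>j\<in>UNIV. v $ j) + (\<Sum>j\<in>UNIV. if j = i then 1 else 0)"
    unfolding level_def w by (simp add: axis_def sum.distrib)
  also have "\<dots> = Suc (level v)" by (simp add: level_def)
  finally show ?thesis .
qed

lemma le_step: "directed_step v w \<Longrightarrow> v \<le> w"
  by (auto simp: directed_step_def less_eq_vec_def)

lemma level_mono: "v \<le> w \<Longrightarrow> level v \<le> level w"
  unfolding level_def less_eq_vec_def by (intro sum_mono) auto

text \<open>A step raises the level by exactly one, so the levels along a path are consecutive integers.\<close>

lemma path_props:
  assumes "successively directed_step vs" "vs \<noteq> []"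
  shows "inj_on level (set vs) \<and> level ` set vs = {level (hd vs)..<level (hd vs) + length vs} \<and>
    distinct vs \<and> level (last vs) + 1 = level (hd vs) + length vs \<and> (\<forall>v\<in>set vs. hd vs \<le> v \<and> v \<le> last vs)"
  using assms
proof (induction vs)
  case (Cons v vs)
  show ?case
  proof (cases vs)
    case Nil
    thus ?thesis by simp
  next
    case (Cons w ws)
    hence ne: "vs \<noteq> []" by simp
    have st: "directed_step v (hd vs)" "successively directed_step vs"
      using Cons.prems ne by (auto simp: successively_Cons)
    note IH = Cons.IH[OF st(2) ne]
    have l: "level (hd vs) = Suc (level v)" using level_step[OF st(1)] .
    have IH1: "inj_on level (set vs)"
      and IH2: "level ` set vs = {Suc (level v)..<Suc (level v) + length vs}"
      and IH3: "distinct vs" and IH4: "level (last vs) + 1 = Suc (level v) + length vs"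
      and IH5: "\<forall>u\<in>set vs. hd vs \<le> u \<and> u \<le> last vs"
      using IH l by simp_all
    have nin: "level v \<notin> level ` set vs" unfolding IH2 by simp
    have "inj_on level (set (v # vs))"
      using IH1 nin by (simp add: inj_on_insert image_iff)
    moreover have "level ` set (v # vs) = {level v..<level v + length (v # vs)}"
      by (simp add: IH2) auto
    moreover have "distinct (v # vs)" using IH3 nin by auto
    moreover have "\<forall>u\<in>set (v # vs). v \<le> u \<and> u \<le> last (v # vs)"
    proof
      fix u assume "u \<in> set (v # vs)"
      moreover have "v \<le> hd vs" by (rule le_step) fact
      moreover have "hd vs \<le> last vs" using IH5 ne by simp
      ultimately show "v \<le> u \<and> u \<le> last (v # vs)"
        using IH5 ne by (cases "u = v") (auto intro: order_trans)
    qed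
    moreover have "level (last (v # vs)) + 1 = level (hd (v # vs)) + length (v # vs)"
      using IH4 ne by simp
    ultimately show ?thesis by simp
  qed
qed simp

lemma ex_directed_path:
  assumes "u \<le> w"
  shows "directed_paths u w \<noteq> {}"
  using assms
proof (induction "level w - level u" arbitrary: u rule: less_induct)
  case less
  show ?case
  proof (cases "u = w")
    case True
    hence "set [u] \<in> directed_paths u w" unfolding directed_paths_def by fastforce
    thus ?thesis by blast
  next
    case False
    then obtain i where i: "u $ i < w $ i" using less.prems
      by (auto simp: vec_eq_iff less_eq_vec_def) (metis order_le_neq_trans)
    have step: "directed_step u (u + axis i 1)" by (auto simp: directed_step_def)
    have le: "u + axis i 1 \<le> w" using less.prems i by (auto simp: less_eq_vec_def axis_def)
    have "level w - level (u + axis i 1) < level w - level u"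
      using level_step[OF step] level_mono[OF le] by simp
    then obtain vs where vs: "vs \<noteq> []" "hd vs = u + axis i 1" "last vs = w" "successively directed_step vs"
      using less.hyps[OF _ le] by (auto simp: directed_paths_def)
    have "set (u # vs) \<in> directed_paths u w" unfolding directed_paths_def
      using vs step by (intro CollectI exI[of _ "u # vs"]) (auto simp: successively_Cons)
    thus ?thesis by blast
  qed
qed

lemma directed_path_in_box:
  fixes \<pi> :: "(nat ^ 'd::finite) set"
  assumes "\<pi> \<in> directed_paths 0 (\<chi> i. n)"
  shows "\<pi> \<subseteq> lattice_box n" "inj_on level \<pi>" "\<pi> \<in> paths_from 0 (CARD('d) * n + 1)" "0 \<in> \<pi>"
proof -
  obtain vs where vs: "\<pi> = set vs" "vs \<noteq> []" "hd vs = 0" "last vs = (\<chi> i. n)" "successively directed_step vs"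
    using assms by (auto simp: directed_paths_def)
  note p = path_props[OF vs(5,2)]
  show "\<pi> \<subseteq> lattice_box n" using p vs by (auto simp: lattice_box_def less_eq_vec_def)
  show "inj_on level \<pi>" using p vs by auto
  show "\<pi> \<in> paths_from 0 (CARD('d) * n + 1)" unfolding paths_from_def using p vs by fastforce
  show "0 \<in> \<pi>" using vs hd_in_set by metis
qed

text \<open>The upper bound on a coordinate holds because the other coordinates cannot decrease, so that the
  coordinate grows by at most the growth of the level.\<close>

lemma paths_from_props:
  fixes u :: "nat ^ 'd::finite"
  assumes "\<pi> \<in> paths_from u k"
  shows "\<forall>v\<in>\<pi>. \<forall>i. u $ i \<le> v $ i \<and> v $ i \<le> u $ i + k" "inj_on level \<pi>"
    "level ` \<pi> = {level u..<level u + k}"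
proof -
  obtain vs where vs: "\<pi> = set vs" "vs \<noteq> []" "hd vs = u" "length vs = k" "successively directed_step vs"
    using assms by (auto simp: paths_from_def)
  note p = path_props[OF vs(5,2)]
  show lv: "level ` \<pi> = {level u..<level u + k}" using p vs by auto
  show "inj_on level \<pi>" using p vs by auto
  show "\<forall>v\<in>\<pi>. \<forall>i. u $ i \<le> v $ i \<and> v $ i \<le> u $ i + k"
  proof (intro ballI allI conjI)
    fix v i assume v: "v \<in> \<pi>"
    have le: "\<And>j. u $ j \<le> v $ j" using p v vs by (auto simp: less_eq_vec_def)
    thus "u $ i \<le> v $ i" .
    have "level v < level u + k" using lv v by auto
    hence "(\<Sum>j\<in>UNIV - {i}. v $ j) + v $ i < (\<Sum>j\<in>UNIV - {i}. u $ j) + u $ i + k"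
      unfolding level_def by (simp add: sum.remove[of UNIV i] add.commute)
    moreover have "(\<Sum>j\<in>UNIV - {i}. u $ j) \<le> (\<Sum>j\<in>UNIV - {i}. v $ j)" using le by (intro sum_mono)
    ultimately show "v $ i \<le> u $ i + k" by linarith
  qed
qed

lemma finite_directed_paths [simp]: "finite (directed_paths 0 (\<chi> i. n) :: (nat ^ 'd::finite) set set)"
  by (rule finite_subset[of _ "Pow (lattice_box n)"]) (use directed_path_in_box(1) in auto)

lemma directed_paths_nonempty [simp]: "directed_paths 0 (\<chi> i. n) \<noteq> ({} :: (nat ^ 'd::finite) set set)"
  by (rule ex_directed_path) (auto simp: less_eq_vec_def)

lemma paths_from_in_box:
  assumes "u \<in> lattice_box m" "\<pi> \<in> paths_from u k"
  shows "\<pi> \<subseteq> lattice_box (m + k)"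
  using paths_from_props(1)[OF assms(2)] assms(1)
  by (auto simp: lattice_box_def) (meson add_le_mono1 order_trans)

lemma finite_paths_from [simp]: "finite (paths_from u k :: (nat ^ 'd::finite) set set)"
proof -
  have "u \<in> lattice_box (level u)"
    by (auto simp: lattice_box_def level_def intro: member_le_sum)
  hence "paths_from u k \<subseteq> Pow (lattice_box (level u + k))" using paths_from_in_box by blast
  thus ?thesis by (rule finite_subset) simp
qed

lemma paths_from_nonempty:
  assumes "k \<ge> 1"
  shows "paths_from u k \<noteq> ({} :: (nat ^ 'd::finite) set set)"
  using assms
proof (induction k arbitrary: u rule: nat_induct_at_least)
  case base
  have "set [u] \<in> paths_from u 1" unfolding paths_from_def by fastforce
  thus ?case by blast
next
  case (Suc k)
  fix i :: 'd
  obtain vs where vs: "vs \<noteq> []" "hd vs = u + axis i 1" "length vs = k" "successively directed_step vs"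
    using Suc.IH[of "u + axis i 1"] by (auto simp: paths_from_def)
  have "set (u # vs) \<in> paths_from u (Suc k)" unfolding paths_from_def
    using vs by (intro CollectI exI[of _ "u # vs"]) (auto simp: successively_Cons directed_step_def)
  thus ?case by blast
qed

lemma paths_from_split:
  assumes "\<pi> \<in> paths_from (0 :: nat ^ 'd::finite) (j + k)" "j \<ge> 1" "k \<ge> 1"
  obtains \<pi>1 \<pi>2 w where "\<pi>1 \<in> paths_from 0 j" "w \<in> lattice_box (j + k)" "\<pi>2 \<in> paths_from w k"
    "\<pi> = \<pi>1 \<union> \<pi>2" "\<pi>1 \<inter> \<pi>2 = {}"
proof -
  obtain vs where vs: "\<pi> = set vs" "vs \<noteq> []" "hd vs = 0" "length vs = j + k" "successively directed_step vs"
    using assms(1) by (auto simp: paths_from_def)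
  note p = path_props[OF vs(5,2)]
  have ne: "take j vs \<noteq> []" "drop j vs \<noteq> []" using vs assms by auto
  have suc: "successively directed_step (take j vs)" "successively directed_step (drop j vs)"
    using vs(5) ne by (metis append_take_drop_id successively_append_iff)+
  have h: "hd (take j vs) = 0" using vs assms by (simp add: hd_take)
  have "set (take j vs) \<in> paths_from 0 j"
    unfolding paths_from_def using ne suc h vs assms by (intro CollectI exI[of _ "take j vs"]) auto
  moreover have "hd (drop j vs) \<in> \<pi>" using ne vs by (metis hd_in_set in_set_dropD)
  hence "hd (drop j vs) \<in> lattice_box (j + k)"
    using paths_from_in_box[OF _ assms(1), of 0] by auto
  moreover have "set (drop j vs) \<in> paths_from (hd (drop j vs)) k"
    unfolding paths_from_def using ne suc vs assms by (intro CollectI exI[of _ "drop j vs"]) auto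
  moreover have "\<pi> = set (take j vs) \<union> set (drop j vs)"
    unfolding vs(1) by (metis append_take_drop_id set_append)
  moreover have "set (take j vs) \<inter> set (drop j vs) = {}"
    using p by (simp add: set_take_disj_set_drop_if_distinct)
  ultimately show ?thesis using that by blast
qed

lemma successively_translate:
  "successively directed_step vs \<Longrightarrow> successively directed_step (map ((+) c) vs)"
  unfolding successively_map
  by (rule successively_mono, assumption) (auto simp: directed_step_def add.assoc)

text \<open>Subtraction of natural numbers truncates; translating a path from \<open>c\<close> back by \<open>c\<close> is nevertheless
  faithful, as all its vertices dominate \<open>c\<close>.\<close>

lemma paths_from_translate: "paths_from c k = (`) ((+) c) ` paths_from (0 :: nat ^ 'd::finite) k"
proof (intro equalityI subsetI)
  fix \<pi> assume "\<pi> \<in> (`) ((+) c) ` paths_from (0 :: nat ^ 'd) k"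
  then obtain vs where vs: "\<pi> = (+) c ` set vs" "vs \<noteq> []" "hd vs = 0" "length vs = k" "successively directed_step vs"
    by (auto simp: paths_from_def)
  thus "\<pi> \<in> paths_from c k" unfolding paths_from_def using successively_translate
    by (intro CollectI exI[of _ "map ((+) c) vs"]) (auto simp: hd_map)
next
  fix \<pi> assume "\<pi> \<in> paths_from c k"
  then obtain vs where vs: "\<pi> = set vs" "vs \<noteq> []" "hd vs = c" "length vs = k" "successively directed_step vs"
    by (auto simp: paths_from_def)
  note p = path_props[OF vs(5,2)]
  let ?m = "\<lambda>v. (\<chi> i. v $ i - c $ i) :: nat ^ 'd"
  have inv: "c + ?m v = v" if "v \<in> set vs" for v
    using p that vs by (auto simp: vec_eq_iff less_eq_vec_def)
  have "successively directed_step (map ?m vs)"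
    unfolding successively_map
  proof (rule successively_mono[OF vs(5)])
    fix v w assume vw: "v \<in> set vs" "w \<in> set vs" "directed_step v w"
    then obtain i where "w = v + axis i 1" by (auto simp: directed_step_def)
    moreover have "\<And>j. c $ j \<le> v $ j" using p vw vs by (auto simp: less_eq_vec_def)
    ultimately have "?m w = ?m v + axis i 1" by (auto simp: vec_eq_iff)
    thus "directed_step (?m v) (?m w)" by (auto simp: directed_step_def)
  qed
  hence "set (map ?m vs) \<in> paths_from 0 k" unfolding paths_from_def
    using vs by (intro CollectI exI[of _ "map ?m vs"]) (auto simp: hd_map vec_eq_iff)
  moreover have "\<pi> = (+) c ` set (map ?m vs)" using inv vs(1) by (auto simp: image_image)
  ultimately show "\<pi> \<in> (`) ((+) c) ` paths_from (0 :: nat ^ 'd) k" by blast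
qed

lemma lpp_translate:
  fixes P :: "(nat ^ 'd::finite) set set"
  shows "lpp ((`) ((+) c) ` P) x = lpp P (\<lambda>v. x (c + v))"
  unfolding lpp_def image_image
  by (intro arg_cong[where f = Sup] image_cong refl) (subst sum.reindex, auto simp: inj_on_def vec_eq_iff)

text \<open>The second half of a path starts at a site that depends on the weights. The maximum over all
  possible sites makes the bound a deterministic one, and it is over polynomially many terms.\<close>

lemma lpp_paths_from_split:
  assumes "j \<ge> 1" "k \<ge> 1"
  shows "lpp (paths_from (0 :: nat ^ 'd::finite) (j + k)) x \<le>
    lpp (paths_from 0 j) x + Max ((\<lambda>w. lpp (paths_from w k) x) ` lattice_box (j + k))"
proof (rule lpp_least)
  show "paths_from (0 :: nat ^ 'd::finite) (j + k) \<noteq> {}" using assms by (intro paths_from_nonempty) auto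
  fix \<pi> :: "(nat ^ 'd::finite) set" assume "\<pi> \<in> paths_from 0 (j + k)"
  then obtain \<pi>1 \<pi>2 w where s: "\<pi>1 \<in> paths_from 0 j" "w \<in> lattice_box (j + k)" "\<pi>2 \<in> paths_from w k"
    "\<pi> = \<pi>1 \<union> \<pi>2" "\<pi>1 \<inter> \<pi>2 = {}" using paths_from_split[OF _ assms] by metis
  have fin: "finite \<pi>1" "finite \<pi>2" using s(1,3) by (auto simp: paths_from_def)
  have "(\<Sum>v\<in>\<pi>. x v) = (\<Sum>v\<in>\<pi>1. x v) + (\<Sum>v\<in>\<pi>2. x v)"
    unfolding s(4) using s(5) fin by (intro sum.union_disjoint)
  also have "(\<Sum>v\<in>\<pi>1. x v) \<le> lpp (paths_from 0 j) x" by (intro lpp_upper s) simp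
  also have "(\<Sum>v\<in>\<pi>2. x v) \<le> lpp (paths_from w k) x" by (intro lpp_upper s) simp
  also have "\<dots> \<le> Max ((\<lambda>w. lpp (paths_from w k) x) ` lattice_box (j + k))"
    using s(2) by (intro Max_ge) auto
  finally show "(\<Sum>v\<in>\<pi>. x v) \<le> lpp (paths_from 0 j) x + Max ((\<lambda>w. lpp (paths_from w k) x) ` lattice_box (j + k))"
    by simp
qed

lemma lpp_paths_from_mono:
  assumes "1 \<le> j" "j \<le> k" "\<And>v. 0 \<le> x v"
  shows "lpp (paths_from (0 :: nat ^ 'd::finite) j) x \<le> lpp (paths_from 0 k) x"
proof (cases "j = k")
  case False
  hence jk: "j < k" using assms by simp
  show ?thesis
  proof (rule lpp_least[OF paths_from_nonempty[OF assms(1)]])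
    fix \<pi> :: "(nat ^ 'd) set" assume "\<pi> \<in> paths_from 0 j"
    then obtain vs where vs: "\<pi> = set vs" "vs \<noteq> []" "hd vs = 0" "length vs = j" "successively directed_step vs"
      by (auto simp: paths_from_def)
    have "paths_from (last vs + axis undefined 1) (k - j) \<noteq> {}"
      using jk by (intro paths_from_nonempty) simp
    then obtain ws where ws: "ws \<noteq> []" "hd ws = last vs + axis undefined 1" "length ws = k - j" "successively directed_step ws"
      unfolding paths_from_def by blast
    have "set (vs @ ws) \<in> paths_from 0 k" unfolding paths_from_def
      using vs ws jk by (intro CollectI exI[of _ "vs @ ws"]) (auto simp: successively_append_iff directed_step_def)
    hence "(\<Sum>v\<in>set (vs @ ws). x v) \<le> lpp (paths_from 0 k) x" by (intro lpp_upper) simp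
    moreover have "(\<Sum>v\<in>\<pi>. x v) \<le> (\<Sum>v\<in>set (vs @ ws). x v)"
      unfolding vs(1) using assms(3) by (intro sum_mono2) auto
    ultimately show "(\<Sum>v\<in>\<pi>. x v) \<le> lpp (paths_from 0 k) x" by linarith
  qed
qed simp

lemma last_passage_le_paths_from:
  "lpp (directed_paths (0 :: nat ^ 'd::finite) (\<chi> i. n)) x \<le> lpp (paths_from 0 (CARD('d) * n + 1)) x"
  by (rule lpp_least, simp) (rule lpp_upper[OF finite_paths_from directed_path_in_box(3)])

text \<open>An optimal path to the corner \<open>c m\<close> is continued by an optimal path from that corner. The corner is
  counted twice on the left, which the additional weight on the right makes up for.\<close>

lemma last_passage_superadditive:
  fixes x :: "nat ^ 'd::finite \<Rightarrow> real"
  defines "D \<equiv> (\<lambda>n. directed_paths (0 :: nat ^ 'd) (\<chi> i. n))"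
  defines "c \<equiv> (\<lambda>n. (\<chi> i. n) :: nat ^ 'd)"
  shows "lpp (D m) x + lpp (D n) (\<lambda>v. x (c m + v)) \<le> lpp (D (m + n)) x + x (c m)"
proof -
  obtain \<pi>1 where \<pi>1: "\<pi>1 \<in> D m" "lpp (D m) x = (\<Sum>v\<in>\<pi>1. x v)"
    unfolding D_def by (rule lpp_attained[of "directed_paths (0 :: nat ^ 'd) (\<chi> i. m)" x]) auto
  obtain \<pi>2 where \<pi>2: "\<pi>2 \<in> D n" "lpp (D n) (\<lambda>v. x (c m + v)) = (\<Sum>v\<in>\<pi>2. x (c m + v))"
    unfolding D_def by (rule lpp_attained[of "directed_paths (0 :: nat ^ 'd) (\<chi> i. n)" "\<lambda>v. x (c m + v)"]) auto
  obtain vs where vs: "\<pi>1 = set vs" "vs \<noteq> []" "hd vs = 0" "last vs = c m" "successively directed_step vs"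
    using \<pi>1 by (auto simp: directed_paths_def D_def c_def)
  obtain ws where ws: "\<pi>2 = set ws" "ws \<noteq> []" "hd ws = 0" "last ws = c n" "successively directed_step ws"
    using \<pi>2 by (auto simp: directed_paths_def D_def c_def)
  define us where "us = map ((+) (c m)) ws"
  have us: "us \<noteq> []" "hd us = c m" "last us = c (m + n)" "successively directed_step us"
    using ws successively_translate by (auto simp: us_def hd_map last_map c_def vec_eq_iff)
  have "set (vs @ tl us) \<in> D (m + n)"
  proof (cases "tl us = []")
    case True
    hence "last us = hd us" using us(1) by (cases us) auto
    thus ?thesis unfolding D_def directed_paths_def using vs us True
      by (intro CollectI exI[of _ "vs @ tl us"]) (auto simp: c_def)
  next
    case False
    then obtain a t where t: "us = c m # a # t" using us(1,2) by (metis hd_Cons_tl)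
    have "successively directed_step (vs @ tl us)"
      using us(4) vs by (simp add: t successively_append_iff)
    thus ?thesis unfolding D_def directed_paths_def using vs us t
      by (intro CollectI exI[of _ "vs @ tl us"]) (auto simp: c_def split: if_splits)
  qed
  hence le: "(\<Sum>v\<in>set (vs @ tl us). x v) \<le> lpp (D (m + n)) x"
    by (intro lpp_upper) (auto simp: D_def)
  have pu: "distinct us" "\<And>v. v \<in> set us \<Longrightarrow> level (c m) \<le> level v" "inj_on level (set us)"
    using path_props[OF us(4,1)] us(2) by (auto intro: level_mono)
  have pv: "\<And>v. v \<in> set vs \<Longrightarrow> level v \<le> level (c m)"
    using path_props[OF vs(5,2)] vs(4) by (auto intro: level_mono)
  have ust: "set us = insert (c m) (set (tl us))" "c m \<notin> set (tl us)"
    using us(1,2) pu(1) by (cases us; auto)+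
  have disj: "set vs \<inter> set (tl us) = {}"
  proof (rule ccontr)
    assume "set vs \<inter> set (tl us) \<noteq> {}"
    then obtain v where v: "v \<in> set vs" "v \<in> set (tl us)" by auto
    hence "level v = level (c m)" using pv[of v] pu(2)[of v] ust by auto
    hence "v = c m" using pu(3) v ust(1) by (auto simp: inj_on_def)
    thus False using v ust by auto
  qed
  have "(\<Sum>v\<in>\<pi>2. x (c m + v)) = (\<Sum>v\<in>set us. x v)"
    unfolding us_def ws(1) set_map by (subst sum.reindex) (auto simp: inj_on_def vec_eq_iff)
  also have "\<dots> = x (c m) + (\<Sum>v\<in>set (tl us). x v)" using ust by simp
  finally have "(\<Sum>v\<in>\<pi>1. x v) + (\<Sum>v\<in>\<pi>2. x (c m + v)) = x (c m) + (\<Sum>v\<in>set (vs @ tl us). x v)"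
    unfolding vs(1) using disj by (simp add: sum.union_disjoint)
  thus ?thesis using le \<pi>1 \<pi>2 by simp
qed

section \<open>Concentration for functions of independent blocks\<close>

text \<open>Hoeffding's lemma, with the range of \<open>f\<close> located by its infimum and its oscillation.\<close>

lemma (in prob_space) oscillation_mgf:
  fixes f :: "'a \<Rightarrow> real"
  assumes [measurable]: "f \<in> borel_measurable M"
    and C: "\<And>x. x \<in> space M \<Longrightarrow> \<bar>f x\<bar> \<le> C"
    and osc: "\<And>x y. x \<in> space M \<Longrightarrow> y \<in> space M \<Longrightarrow> f x \<le> f y + c"
    and "l > 0"
  shows "(\<integral>x. exp (l * f x) \<partial>M) \<le> exp (l * (\<integral>x. f x \<partial>M) + l\<^sup>2 * c\<^sup>2 / 8)"
proof -
  define a where "a = (INF x\<in>space M. f x)"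
  have bdd: "bdd_below (f ` space M)"
    using C by (intro bdd_belowI[of _ "- C"]) (auto simp: abs_le_iff minus_le_iff)
  have in_int: "f x \<in> {a..a + c}" if x: "x \<in> space M" for x
  proof -
    have "a \<le> f x" unfolding a_def using bdd x by (rule cINF_lower)
    moreover have "f x - c \<le> a" unfolding a_def
      using not_empty osc[OF x] by (intro cINF_greatest) (auto simp: algebra_simps)
    ultimately show ?thesis by auto
  qed
  interpret interval_bounded_random_variable M f a "a + c"
    by unfold_locales (use in_int in auto)
  define \<mu> where "\<mu> = expectation f"
  have "nn_integral M (\<lambda>x. exp (l * (f x - \<mu>))) \<le> ennreal (exp (l\<^sup>2 * (a + c - a)\<^sup>2 / 8))"
    unfolding \<mu>_def using \<open>l > 0\<close> by (rule Hoeffdings_lemma_nn_integral)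
  moreover have int: "integrable M (\<lambda>x. exp (l * (f x - \<mu>)))"
  proof (rule integrable_const_bound[of _ "exp (l * (C - \<mu>))"])
    show "AE x in M. norm (exp (l * (f x - \<mu>))) \<le> exp (l * (C - \<mu>))"
      using C \<open>l > 0\<close> by (intro AE_I2) (auto intro: abs_le_D1)
  qed simp
  ultimately have le: "(\<integral>x. exp (l * (f x - \<mu>)) \<partial>M) \<le> exp (l\<^sup>2 * c\<^sup>2 / 8)"
    by (simp add: nn_integral_eq_integral)
  have "(\<integral>x. exp (l * f x) \<partial>M) = (\<integral>x. exp (l * \<mu>) * exp (l * (f x - \<mu>)) \<partial>M)"
    by (intro Bochner_Integration.integral_cong refl) (simp add: exp_add[symmetric] algebra_simps)
  also have "\<dots> = exp (l * \<mu>) * (\<integral>x. exp (l * (f x - \<mu>)) \<partial>M)"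
    by simp
  also have "\<dots> \<le> exp (l * \<mu>) * exp (l\<^sup>2 * c\<^sup>2 / 8)" using le by simp
  finally show ?thesis by (simp add: exp_add \<mu>_def)
qed

text \<open>McDiarmid's inequality in exponential form, for functions that depend on finitely many independent
  blocks of coordinates and change by at most \<open>c\<close> when one block changes. For a fixed value of one block
  the induction hypothesis bounds the integral over the others in terms of their mean \<open>F\<close>. As a function
  of the remaining block, \<open>F\<close> inherits the oscillation bound \<open>c\<close>, so Hoeffding's lemma applies to it.\<close>

lemma bounded_differences_mgf:
  fixes M :: "'i \<Rightarrow> 'a measure" and B :: "'k \<Rightarrow> 'i set" and f :: "('i \<Rightarrow> 'a) \<Rightarrow> real"
  assumes prob: "\<And>i. prob_space (M i)"
    and "finite K" "\<And>k. k \<in> K \<Longrightarrow> finite (B k)" "disjoint_family_on B K"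
    and "f \<in> borel_measurable (PiM (\<Union>k\<in>K. B k) M)"
    and "\<And>x. x \<in> space (PiM (\<Union>k\<in>K. B k) M) \<Longrightarrow> \<bar>f x\<bar> \<le> C"
    and "\<And>k x y. k \<in> K \<Longrightarrow> x \<in> space (PiM (\<Union>k\<in>K. B k) M) \<Longrightarrow> y \<in> space (PiM (\<Union>k\<in>K. B k) M) \<Longrightarrow>
           (\<And>i. i \<in> (\<Union>k\<in>K. B k) - B k \<Longrightarrow> x i = y i) \<Longrightarrow> f x \<le> f y + c"
    and l: "l > 0"
  shows "(\<integral>x. exp (l * f x) \<partial>PiM (\<Union>k\<in>K. B k) M)
     \<le> exp (l * (\<integral>x. f x \<partial>PiM (\<Union>k\<in>K. B k) M) + l\<^sup>2 * c\<^sup>2 * card K / 8)"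
  using assms(2-7)
proof (induction K arbitrary: f rule: finite_induct)
  case empty
  interpret P: prob_space "PiM {} M" by (rule prob_space_PiM) (rule prob)
  have "(\<integral>x. exp (l * f x) \<partial>PiM {} M) = (\<integral>x. exp (l * f (\<lambda>_. undefined)) \<partial>PiM {} M)"
    by (intro Bochner_Integration.integral_cong) (auto simp: space_PiM)
  moreover have "(\<integral>x. f x \<partial>PiM {} M) = (\<integral>x. f (\<lambda>_. undefined) \<partial>PiM {} M)"
    by (intro Bochner_Integration.integral_cong) (auto simp: space_PiM)
  ultimately show ?case by (simp add: P.prob_space)
next
  case (insert k K)
  interpret product_prob_space M UNIV
    using prob by (intro product_prob_space.intro product_prob_space_axioms.intro product_sigma_finite.intro)
      (auto simp: prob_space_imp_sigma_finite)
  define I where "I = B k"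
  define J where "J = (\<Union>k\<in>K. B k)"
  have U: "(\<Union>k\<in>insert k K. B k) = I \<union> J" by (auto simp: I_def J_def)
  have IJ: "I \<inter> J = {}" using insert.prems(2) insert.hyps
    by (auto simp: disjoint_family_on_def I_def J_def)
  have fin: "finite I" "finite J" using insert.prems(1) insert.hyps by (auto simp: I_def J_def)
  interpret I: prob_space "PiM I M" by (rule prob_space_PiM) (rule prob)
  interpret J: prob_space "PiM J M" by (rule prob_space_PiM) (rule prob)
  interpret IJ: prob_space "PiM (I \<union> J) M" by (rule prob_space_PiM) (rule prob)
  have f[measurable]: "f \<in> borel_measurable (PiM (I \<union> J) M)" using insert.prems(3) unfolding U .
  have fC: "\<bar>f x\<bar> \<le> C" if "x \<in> space (PiM (I \<union> J) M)" for x
    using insert.prems(4)[unfolded U] that by auto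
  have mg: "merge I J (x, y) \<in> space (PiM (I \<union> J) M)" if "x \<in> space (PiM I M)" "y \<in> space (PiM J M)" for x y
    using that measurable_merge[of I J M, THEN measurable_space, of "(x, y)"] by (simp add: space_pair_measure)
  have "C \<ge> 0" using IJ.not_empty fC by (meson abs_ge_zero ex_in_conv order_trans)
  define F where "F x = (\<integral>y. f (merge I J (x, y)) \<partial>PiM J M)" for x
  have [measurable]: "(\<lambda>(x, y). f (merge I J (x, y))) \<in> borel_measurable (PiM I M \<Otimes>\<^sub>M PiM J M)"
    using measurable_compose[OF measurable_merge f] by (simp add: split_beta)
  have fx[measurable]: "(\<lambda>y. f (merge I J (x, y))) \<in> borel_measurable (PiM J M)"
    if [measurable]: "x \<in> space (PiM I M)" for x
    by measurable
  have intJ: "integrable (PiM J M) (\<lambda>y. f (merge I J (x, y)))" if "x \<in> space (PiM I M)" for x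
    using fC mg that by (intro J.integrable_const_bound[of _ C] fx AE_I2) auto
  have [measurable]: "F \<in> borel_measurable (PiM I M)"
    unfolding F_def by measurable
  have inner: "(\<integral>y. exp (l * f (merge I J (x, y))) \<partial>PiM J M)
      \<le> exp (l * F x + l\<^sup>2 * c\<^sup>2 * card K / 8)" if x: "x \<in> space (PiM I M)" for x
    unfolding F_def
  proof (rule insert.IH[of "\<lambda>y. f (merge I J (x, y))", folded J_def])
    show "disjoint_family_on B K" using insert.prems(2) by (auto simp: disjoint_family_on_def)
    show "\<bar>f (merge I J (x, y))\<bar> \<le> C" if "y \<in> space (PiM J M)" for y
      using fC mg x that by auto
    show "f (merge I J (x, y)) \<le> f (merge I J (x, z)) + c"
      if k': "k' \<in> K" and yz: "y \<in> space (PiM J M)" "z \<in> space (PiM J M)"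
        and eq: "\<And>i. i \<in> J - B k' \<Longrightarrow> y i = z i" for k' y z
    proof (rule insert.prems(5)[of k', unfolded U])
      show "k' \<in> insert k K" using k' by simp
      show "merge I J (x, y) i = merge I J (x, z) i" if "i \<in> I \<union> J - B k'" for i
        using that eq by (auto simp: merge_def)
    qed (use mg x yz in auto)
  qed (use insert.prems(1) fx x in auto)
  have FC: "\<bar>F x\<bar> \<le> C" if x: "x \<in> space (PiM I M)" for x
  proof -
    have "\<bar>F x\<bar> \<le> (\<integral>y. \<bar>f (merge I J (x, y))\<bar> \<partial>PiM J M)" unfolding F_def by (rule integral_abs_bound)
    also have "\<dots> \<le> (\<integral>y. C \<partial>PiM J M)"
      using intJ[OF x] fC mg x by (intro integral_mono) auto
    finally show ?thesis by (simp add: J.prob_space)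
  qed
  have Fosc: "F x \<le> F y + c" if xy: "x \<in> space (PiM I M)" "y \<in> space (PiM I M)" for x y
  proof -
    have "F x \<le> (\<integral>z. f (merge I J (y, z)) + c \<partial>PiM J M)" unfolding F_def
    proof (rule integral_mono)
      fix z assume z: "z \<in> space (PiM J M)"
      show "f (merge I J (x, z)) \<le> f (merge I J (y, z)) + c"
      proof (rule insert.prems(5)[of k, unfolded U])
        show "merge I J (x, z) i = merge I J (y, z) i" if "i \<in> I \<union> J - B k" for i
          using that IJ by (auto simp: merge_def I_def)
      qed (use mg xy z in auto)
    qed (use intJ xy in auto)
    also have "\<dots> = F y + c" unfolding F_def using intJ[OF xy(2)] by (simp add: J.prob_space)
    finally show ?thesis .
  qed
  have intF: "integrable (PiM I M) (\<lambda>x. exp (l * F x + d))" for d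
    using FC l by (intro I.integrable_const_bound[of _ "exp (l * C + d)"] AE_I2) (auto intro: abs_le_D1)
  have int_exp: "integrable (PiM (I \<union> J) M) (\<lambda>x. exp (l * f x))"
    using fC l by (intro IJ.integrable_const_bound[of _ "exp (l * C)"] AE_I2) (auto intro: abs_le_D1)
  have int_f: "integrable (PiM (I \<union> J) M) f"
    using fC by (intro IJ.integrable_const_bound[of _ C] AE_I2) auto
  have "(\<integral>x. exp (l * f x) \<partial>PiM (I \<union> J) M)
      = (\<integral>x. (\<integral>y. exp (l * f (merge I J (x, y))) \<partial>PiM J M) \<partial>PiM I M)"
    using IJ fin int_exp by (rule product_integral_fold)
  also have "\<dots> \<le> (\<integral>x. exp (l * F x + l\<^sup>2 * c\<^sup>2 * card K / 8) \<partial>PiM I M)"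
  proof (rule integral_mono[OF _ intF inner])
    show "integrable (PiM I M) (\<lambda>x. \<integral>y. exp (l * f (merge I J (x, y))) \<partial>PiM J M)"
    proof (rule I.integrable_const_bound[of _ "exp (l * C + l\<^sup>2 * c\<^sup>2 * card K / 8)"])
      show "AE x in PiM I M. norm (\<integral>y. exp (l * f (merge I J (x, y))) \<partial>PiM J M)
          \<le> exp (l * C + l\<^sup>2 * c\<^sup>2 * card K / 8)"
      proof (rule AE_I2)
        fix x assume x: "x \<in> space (PiM I M)"
        have "0 \<le> (\<integral>y. exp (l * f (merge I J (x, y))) \<partial>PiM J M)" by (rule Bochner_Integration.integral_nonneg) simp
        moreover have le: "exp (l * F x + l\<^sup>2 * c\<^sup>2 * card K / 8) \<le> exp (l * C + l\<^sup>2 * c\<^sup>2 * card K / 8)"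
          using FC[OF x] l by (auto intro: abs_le_D1)
        ultimately show "norm (\<integral>y. exp (l * f (merge I J (x, y))) \<partial>PiM J M)
          \<le> exp (l * C + l\<^sup>2 * c\<^sup>2 * card K / 8)" using order_trans[OF inner[OF x] le] by (simp only: real_norm_def abs_of_nonneg)
      qed
    qed measurable
  qed auto
  also have "\<dots> = exp (l\<^sup>2 * c\<^sup>2 * card K / 8) * (\<integral>x. exp (l * F x) \<partial>PiM I M)"
    by (simp add: exp_add mult.commute)
  also have "(\<integral>x. exp (l * F x) \<partial>PiM I M) \<le> exp (l * (\<integral>x. F x \<partial>PiM I M) + l\<^sup>2 * c\<^sup>2 / 8)"
    using l FC Fosc by (intro I.oscillation_mgf) auto
  also have "(\<integral>x. F x \<partial>PiM I M) = (\<integral>x. f x \<partial>PiM (I \<union> J) M)"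
    unfolding F_def using IJ fin int_f by (rule product_integral_fold[symmetric])
  also have "exp (l\<^sup>2 * c\<^sup>2 * card K / 8) * exp (l * (\<integral>x. f x \<partial>PiM (I \<union> J) M) + l\<^sup>2 * c\<^sup>2 / 8)
      = exp (l * (\<integral>x. f x \<partial>PiM (I \<union> J) M) + l\<^sup>2 * c\<^sup>2 * card (insert k K) / 8)"
    using insert.hyps by (simp add: exp_add[symmetric] algebra_simps add_divide_distrib)
  finally show ?case unfolding U by simp
qed

section \<open>Last-passage values of i.i.d. weights\<close>

text \<open>Concentration and translation invariance hold for every law \<open>N\<close> of the weights.\<close>

locale iid_field = prob_space M for M :: "'a measure" +
  fixes X :: "'v \<Rightarrow> 'a \<Rightarrow> real" and N :: "real measure"
  assumes indep: "indep_vars (\<lambda>_. borel) X UNIV"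
    and distr_X: "\<And>v. distr M borel (X v) = N"
begin

lemma measurable_X [measurable]: "X v \<in> borel_measurable M"
  using indep by (auto simp: indep_vars_def2)

lemma prob_space_N: "prob_space N"
  unfolding distr_X[of undefined, symmetric] by (rule prob_space_distr) simp

lemma sets_N [measurable_cong]: "sets N = sets borel"
  unfolding distr_X[of undefined, symmetric] by simp

text \<open>The injection \<open>h\<close> selects which weights are read; with \<open>h\<close> a translation this is the translation
  invariance of the field.\<close>

lemma distr_field:
  fixes h :: "'w \<Rightarrow> 'v"
  assumes "B \<noteq> {}" "inj_on h B"
  shows "distr M (PiM B (\<lambda>_. borel)) (\<lambda>\<omega>. \<lambda>v\<in>B. X (h v) \<omega>) = PiM B (\<lambda>_. N)"
proof -
  have "indep_vars (\<lambda>_. borel) X (h ` B)" by (rule indep_vars_subset[OF indep]) simp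
  hence *: "distr M (PiM (h ` B) (\<lambda>_. borel)) (\<lambda>\<omega>. \<lambda>v\<in>h ` B. X v \<omega>) = PiM (h ` B) (\<lambda>_. N)"
    using assms by (subst (asm) indep_vars_iff_distr_eq_PiM') (auto simp: distr_X)
  have [measurable]: "(\<lambda>x. \<lambda>v\<in>B. x (h v)) \<in> PiM (h ` B) (\<lambda>_. borel) \<rightarrow>\<^sub>M PiM B (\<lambda>_. borel :: real measure)"
    by (intro measurable_restrict measurable_component_singleton) auto
  have "distr M (PiM B (\<lambda>_. borel)) (\<lambda>\<omega>. \<lambda>v\<in>B. X (h v) \<omega>)
      = distr (distr M (PiM (h ` B) (\<lambda>_. borel)) (\<lambda>\<omega>. \<lambda>v\<in>h ` B. X v \<omega>)) (PiM B (\<lambda>_. borel)) (\<lambda>x. \<lambda>v\<in>B. x (h v))"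
    by (subst distr_distr) (auto intro!: distr_cong)
  also have "\<dots> = distr (PiM (h ` B) (\<lambda>_. N)) (PiM B (\<lambda>_. N)) (\<lambda>x. \<lambda>v\<in>B. x (h v))"
    unfolding * by (intro distr_cong refl sets_PiM_cong) (simp_all add: sets_N)
  also have "\<dots> = PiM B (\<lambda>_. N)"
    by (rule distr_PiM_reindex) (use assms prob_space_N in auto)
  finally show ?thesis .
qed

lemma expectation_field:
  fixes h :: "'w \<Rightarrow> 'v" and f :: "('w \<Rightarrow> real) \<Rightarrow> real"
  assumes "B \<noteq> {}" "inj_on h B" and f: "f \<in> borel_measurable (PiM B (\<lambda>_. borel))"
  shows "expectation (\<lambda>\<omega>. f (\<lambda>v\<in>B. X (h v) \<omega>)) = (\<integral>x. f x \<partial>PiM B (\<lambda>_. N))"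
  unfolding distr_field[OF assms(1,2), symmetric]
  by (rule integral_distr[symmetric]) (intro measurable_restrict measurable_X, rule f)

end

lemma measurable_lpp:
  assumes "finite P" "\<And>v. v \<in> \<Union>P \<Longrightarrow> (\<lambda>\<omega>. x v \<omega>) \<in> borel_measurable M"
  shows "(\<lambda>\<omega>. lpp P (\<lambda>v. x v \<omega>)) \<in> borel_measurable M"
proof (cases "P = {}")
  case False
  have "(\<lambda>\<omega>. lpp P (\<lambda>v. x v \<omega>)) = (\<lambda>\<omega>. Max ((\<lambda>\<pi>. \<Sum>v\<in>\<pi>. x v \<omega>) ` P))"
    unfolding lpp_def using assms False by (intro ext cSup_eq_Max) auto
  also have "\<dots> \<in> borel_measurable M"
    using assms by (intro borel_measurable_Max borel_measurable_sum) auto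
  finally show ?thesis .
qed (simp add: lpp_def)

text \<open>The weights are almost surely nonnegative; cutting at \<open>0\<close> as well makes the bounded-difference property
  hold for all configurations and not only for almost all of them.\<close>

definition clip :: "real \<Rightarrow> real \<Rightarrow> real" where
  "clip \<tau> t = max 0 (min t \<tau>)"

lemma clip_bounds: "0 \<le> \<tau> \<Longrightarrow> 0 \<le> clip \<tau> t" "0 \<le> \<tau> \<Longrightarrow> clip \<tau> t \<le> \<tau>" "0 \<le> t \<Longrightarrow> clip \<tau> t \<le> t"
  by (auto simp: clip_def)

lemma measurable_clip [measurable]: "clip \<tau> \<in> borel_measurable borel"
  unfolding clip_def by measurable

text \<open>Injectivity of \<open>lev\<close> on a path means that the path crosses each layer \<open>{v. lev v = k}\<close> at most once. The
  layers serve as the independent blocks of the bounded-difference inequality.\<close>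

locale layered_family =
  fixes P :: "'v set set" and lev :: "'v \<Rightarrow> 'k"
  assumes fin_P: "finite P" and P_ne: "P \<noteq> {}" and fin_paths: "finite (\<Union>P)" and ne_paths: "\<Union>P \<noteq> {}"
    and inj_lev: "\<And>\<pi>. \<pi> \<in> P \<Longrightarrow> inj_on lev \<pi>"

locale layered_iid_field = iid_field M X N + layered_family P lev
  for M :: "'a measure" and X :: "'v \<Rightarrow> 'a \<Rightarrow> real" and N and P and lev :: "'v \<Rightarrow> 'k"
begin

lemma abs_lpp_clip_le:
  assumes "0 \<le> (\<tau> :: real)"
  shows "\<bar>lpp P (\<lambda>v. clip \<tau> (x v))\<bar> \<le> real (card (\<Union>P)) * \<tau>"
proof -
  have "\<bar>lpp P (\<lambda>v. clip \<tau> (x v))\<bar> \<le> (\<Sum>v\<in>\<Union>P. \<bar>clip \<tau> (x v)\<bar>)"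
    by (rule abs_lpp_le) (use fin_P P_ne fin_paths in auto)
  also have "\<dots> \<le> of_nat (card (\<Union>P)) * \<tau>"
    using clip_bounds(1,2)[OF assms] by (intro sum_bounded_above) auto
  finally show ?thesis by simp
qed

lemma clipped_measurable [measurable]:
  "(\<lambda>\<omega>. lpp P (\<lambda>v. clip \<tau> (X v \<omega>))) \<in> borel_measurable M"
  by (rule measurable_lpp[OF fin_P]) measurable

lemma integrable_clipped:
  assumes "0 \<le> \<tau>"
  shows "integrable M (\<lambda>\<omega>. lpp P (\<lambda>v. clip \<tau> (X v \<omega>)))"
  using abs_lpp_clip_le[OF assms] by (intro integrable_const_bound[of _ "real (card (\<Union>P)) * \<tau>"]) auto

lemma integrable_exp_clipped:
  assumes "0 \<le> \<tau>"
  shows "integrable M (\<lambda>\<omega>. exp (l * lpp P (\<lambda>v. clip \<tau> (X v \<omega>))))"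
proof (rule integrable_const_bound[of _ "exp (\<bar>l\<bar> * (real (card (\<Union>P)) * \<tau>))"])
  have "l * lpp P x \<le> \<bar>l\<bar> * \<bar>lpp P x\<bar>" for x by (simp add: abs_mult[symmetric])
  moreover have "\<bar>l\<bar> * \<bar>lpp P (\<lambda>v. clip \<tau> (x v))\<bar> \<le> \<bar>l\<bar> * (real (card (\<Union>P)) * \<tau>)" for x
    using abs_lpp_clip_le[OF assms] by (intro mult_left_mono) auto
  ultimately have "l * lpp P (\<lambda>v. clip \<tau> (x v)) \<le> \<bar>l\<bar> * (real (card (\<Union>P)) * \<tau>)" for x
    using order_trans by blast
  thus "AE \<omega> in M. norm (exp (l * lpp P (\<lambda>v. clip \<tau> (X v \<omega>)))) \<le> exp (\<bar>l\<bar> * (real (card (\<Union>P)) * \<tau>))"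
    by (intro AE_I2) auto
qed measurable

text \<open>By clipping, a layer changes the passage time by at most \<open>\<tau>\<close>. The sign \<open>s\<close> is there to obtain both
  tails from one proof.\<close>

lemma lpp_clip_mgf:
  assumes "l > 0" "\<tau> \<ge> 0" "s = 1 \<or> s = - 1"
  shows "expectation (\<lambda>\<omega>. exp (l * (s * lpp P (\<lambda>v. clip \<tau> (X v \<omega>)))))
    \<le> exp (l * (s * expectation (\<lambda>\<omega>. lpp P (\<lambda>v. clip \<tau> (X v \<omega>)))) + l\<^sup>2 * \<tau>\<^sup>2 * card (lev ` \<Union>P) / 8)"
proof -
  define B where "B k = {v \<in> \<Union>P. lev v = k}" for k
  define K where "K = lev ` \<Union>P"
  have U: "(\<Union>k\<in>K. B k) = \<Union>P" by (auto simp: B_def K_def)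
  define f where "f x = s * lpp P (\<lambda>v. clip \<tau> (x v))" for x
  have f[measurable]: "f \<in> borel_measurable (PiM (\<Union>P) (\<lambda>_. borel))"
    unfolding f_def
    by (intro borel_measurable_times borel_measurable_const measurable_lpp[OF fin_P]
        measurable_compose[OF _ measurable_clip] measurable_component_singleton)
  have fN: "f \<in> borel_measurable (PiM (\<Union>P) (\<lambda>_. N))"
    using f by (subst measurable_cong_sets[OF sets_PiM_cong refl]) (auto simp: sets_N)
  have res: "f (\<lambda>v\<in>\<Union>P. x v) = s * lpp P (\<lambda>v. clip \<tau> (x v))" for x
    unfolding f_def by (intro arg_cong2[where f = times] lpp_cong refl) auto
  have lip: "lpp P (\<lambda>v. clip \<tau> (x v)) \<le> lpp P (\<lambda>v. clip \<tau> (y v)) + \<tau>"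
    if eq: "\<And>i. i \<in> \<Union>P - B k \<Longrightarrow> x i = y i" for x y k
  proof (rule lpp_bounded_difference[where A = "B k"])
    show "finite \<pi> \<and> (\<forall>v\<in>\<pi>. \<forall>w\<in>\<pi>. v \<in> B k \<longrightarrow> w \<in> B k \<longrightarrow> v = w)" if "\<pi> \<in> P" for \<pi>
    proof
      show "finite \<pi>" by (rule finite_subset[OF _ fin_paths]) (use that in auto)
    qed (use inj_lev[OF that] in \<open>auto simp: B_def inj_on_def\<close>)
    show "clip \<tau> (x v) \<le> clip \<tau> (y v) + \<tau>" for v
      using clip_bounds(1)[OF assms(2), of "y v"] clip_bounds(2)[OF assms(2), of "x v"] by simp
  qed (use fin_P P_ne eq assms in auto)
  have "(\<integral>x. exp (l * f x) \<partial>PiM (\<Union>k\<in>K. B k) (\<lambda>_. N))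
      \<le> exp (l * (\<integral>x. f x \<partial>PiM (\<Union>k\<in>K. B k) (\<lambda>_. N)) + l\<^sup>2 * \<tau>\<^sup>2 * card K / 8)"
  proof (rule bounded_differences_mgf)
    show "finite K" "disjoint_family_on B K"
      using fin_paths by (auto simp: K_def B_def disjoint_family_on_def)
    show "finite (B k)" for k
      by (rule finite_subset[OF _ fin_paths]) (auto simp: B_def)
    show "\<bar>f x\<bar> \<le> real (card (\<Union>P)) * \<tau>" for x
      using abs_lpp_clip_le[OF assms(2), of x] assms(3) by (auto simp: f_def abs_mult)
    show "f x \<le> f y + \<tau>" if eq: "\<And>i. i \<in> (\<Union>k\<in>K. B k) - B k \<Longrightarrow> x i = y i" for x y k
      using assms(3) lip[of k x y] lip[of k y x] eq unfolding U f_def by force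
  qed (use prob_space_N fN assms in \<open>auto simp: U\<close>)
  also have "(\<integral>x. exp (l * f x) \<partial>PiM (\<Union>k\<in>K. B k) (\<lambda>_. N))
      = expectation (\<lambda>\<omega>. exp (l * f (\<lambda>v\<in>\<Union>P. X v \<omega>)))"
    unfolding U using expectation_field[of "\<Union>P" "\<lambda>v. v" "\<lambda>x. exp (l * f x)"] ne_paths by simp
  also have "(\<integral>x. f x \<partial>PiM (\<Union>k\<in>K. B k) (\<lambda>_. N)) = expectation (\<lambda>\<omega>. f (\<lambda>v\<in>\<Union>P. X v \<omega>))"
    unfolding U using expectation_field[of "\<Union>P" "\<lambda>v. v" f] ne_paths by simp
  finally show ?thesis unfolding res K_def by simp
qed

lemma lpp_clip_deviation:
  assumes "t > 0" "\<tau> > 0" "s = 1 \<or> s = - 1" "card (lev ` \<Union>P) \<le> L"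
  shows "prob {\<omega> \<in> space M. s * (lpp P (\<lambda>v. clip \<tau> (X v \<omega>))
      - expectation (\<lambda>\<omega>. lpp P (\<lambda>v. clip \<tau> (X v \<omega>)))) \<ge> t} \<le> exp (- (2 * t\<^sup>2) / (\<tau>\<^sup>2 * L))"
proof -
  define T where "T \<omega> = lpp P (\<lambda>v. clip \<tau> (X v \<omega>))" for \<omega>
  define V where "V = \<tau>\<^sup>2 * L"
  have "card (lev ` \<Union>P) > 0" using fin_paths ne_paths by (simp add: card_gt_0_iff)
  hence V: "V > 0" using assms by (auto simp: V_def)
  \<comment> \<open>The minimizer of \<open>l\<^sup>2 * V / 8 - l * t\<close>.\<close>
  define l where "l = 4 * t / V"
  have l: "l > 0" using assms V by (simp add: l_def)
  have [measurable]: "T \<in> borel_measurable M" unfolding T_def by measurable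
  have int: "integrable M (\<lambda>\<omega>. exp (l * (s * T \<omega>)))"
    using integrable_exp_clipped[of \<tau> "l * s"] assms unfolding T_def by (simp add: mult.assoc)
  have "prob {\<omega> \<in> space M. s * (T \<omega> - expectation T) \<ge> t}
      = prob {\<omega> \<in> space M. exp (l * (s * T \<omega>)) \<ge> exp (l * (s * expectation T + t))}"
    unfolding exp_le_cancel_iff mult_le_cancel_left_pos[OF l]
    by (intro arg_cong[where f = prob]) (auto simp: algebra_simps)
  also have "\<dots> \<le> expectation (\<lambda>\<omega>. exp (l * (s * T \<omega>))) / exp (l * (s * expectation T + t))"
    by (rule integral_Markov_inequality_measure[where A = "{}"]) (use int in auto)
  also have "\<dots> \<le> exp (l * (s * expectation T) + l\<^sup>2 * \<tau>\<^sup>2 * card (lev ` \<Union>P) / 8) / exp (l * (s * expectation T + t))"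
    using lpp_clip_mgf[OF l _ assms(3), of \<tau>] assms(2) unfolding T_def by (intro divide_right_mono) auto
  also have "\<dots> = exp (l\<^sup>2 * \<tau>\<^sup>2 * card (lev ` \<Union>P) / 8 - l * t)"
    by (simp add: exp_diff[symmetric] algebra_simps)
  also have "\<dots> \<le> exp (l\<^sup>2 * V / 8 - l * t)"
    using assms unfolding V_def by (auto intro!: mult_left_mono simp: mult.assoc)
  also have "l\<^sup>2 * V / 8 - l * t = - (2 * t\<^sup>2) / V"
    using V by (simp add: l_def power2_eq_square field_simps)
  finally show ?thesis unfolding T_def V_def .
qed

end

section \<open>Weights with stretched exponential tails\<close>

locale weibull_field = iid_field M X "mu \<alpha>"
  for M :: "'a measure" and X :: "'v \<Rightarrow> 'a \<Rightarrow> real" and \<alpha> :: real +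
  assumes \<alpha>_pos: "0 < \<alpha>" and \<alpha>_less_1: "\<alpha> < 1"
begin

text \<open>A divergent integral has the value \<open>0\<close> by convention, and division by \<open>0\<close> gives \<open>0\<close>. So if the
  constant vanished for either reason, \<open>mu \<alpha>\<close> would be the null measure; but it is the law of a weight.\<close>

lemma Z_const_pos: "Z_const \<alpha> > 0"
proof -
  have "Z_const \<alpha> \<ge> 0" unfolding Z_const_def set_lebesgue_integral_def
    by (intro Bochner_Integration.integral_nonneg) auto
  moreover have "Z_const \<alpha> \<noteq> 0"
  proof
    assume "Z_const \<alpha> = 0"
    hence "mu \<alpha> = density lborel (\<lambda>_. 0)" unfolding mu_def by simp
    hence "emeasure (mu \<alpha>) (space (mu \<alpha>)) = 0" by (simp add: emeasure_density)
    thus False using prob_space.emeasure_space_1[OF prob_space_N] by simp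
  qed
  ultimately show ?thesis by simp
qed

text \<open>For \<open>s = 1\<close> this is contained in \<open>Z_const \<alpha> \<noteq> 0\<close>, because a divergent integral would have been given
  the value \<open>0\<close>. The general case follows by scaling.\<close>

lemma integrable_stretched_exp:
  assumes "s > 0"
  shows "integrable lborel (\<lambda>x. indicator {0..} x * exp (- s * x powr \<alpha>) :: real)"
proof -
  \<comment> \<open>The substitution \<open>x \<mapsto> c * x\<close> turns \<open>x powr \<alpha>\<close> into \<open>s * x powr \<alpha>\<close>.\<close>
  define c where "c = s powr (1 / \<alpha>)"
  have c: "c > 0" using assms by (simp add: c_def)
  have "integrable lborel (\<lambda>x. indicator {0..} x * exp (- (x powr \<alpha>)) :: real)"
    using Z_const_pos not_integrable_integral_eq unfolding Z_const_def set_lebesgue_integral_def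
    by (fastforce simp: scaleR_conv_of_real)
  hence "integrable lborel (\<lambda>x. indicator {0..} (0 + c * x) * exp (- ((0 + c * x) powr \<alpha>)) :: real)"
    by (rule lborel_integrable_real_affine) (use c in auto)
  moreover have "indicator {0..} (0 + c * x) * exp (- ((0 + c * x) powr \<alpha>))
      = (indicator {0..} x * exp (- s * x powr \<alpha>) :: real)" for x
    using c \<alpha>_pos assms
    by (auto simp: indicator_def zero_le_mult_iff powr_mult c_def powr_powr)
  ultimately show ?thesis by (simp only:)
qed

text \<open>Multiplying the density by \<open>exp (l * x powr \<alpha>)\<close> leaves a stretched exponential with the positive
  factor \<open>1 - l\<close> in the exponent.\<close>

lemma integrable_exp_powr:
  assumes "l < 1"
  shows "integrable M (\<lambda>\<omega>. exp (l * X v \<omega> powr \<alpha>))"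
proof -
  have "integrable lborel (\<lambda>x. (indicator {0..} x * exp (- (1 - l) * x powr \<alpha>)) / Z_const \<alpha>)"
    using integrable_stretched_exp[of "1 - l"] assms by simp
  also have "(\<lambda>x. (indicator {0..} x * exp (- (1 - l) * x powr \<alpha>)) / Z_const \<alpha>)
      = (\<lambda>x. (indicator {0..} x * exp (- (x powr \<alpha>)) / Z_const \<alpha>) *\<^sub>R exp (l * x powr \<alpha>))"
    by (auto simp: fun_eq_iff indicator_def exp_add[symmetric] algebra_simps)
  finally have "integrable (mu \<alpha>) (\<lambda>x. exp (l * x powr \<alpha>))"
    unfolding mu_def using Z_const_pos by (subst integrable_density) auto
  thus ?thesis unfolding distr_X[of v, symmetric] by (subst (asm) integrable_distr_eq) auto
qed

lemma AE_nonneg: "AE \<omega> in M. 0 \<le> X v \<omega>"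
proof -
  have "AE x in mu \<alpha>. 0 \<le> x"
    unfolding mu_def by (subst AE_density) (auto simp: indicator_def)
  thus ?thesis unfolding distr_X[of v, symmetric] by (subst (asm) AE_distr_iff) auto
qed

text \<open>The density decreases, so on the window it is at least its value at the right end.\<close>

lemma prob_window:
  assumes "0 \<le> a" "a \<le> b"
  shows "prob {\<omega> \<in> space M. X v \<omega> \<in> {a..b}} \<ge> (b - a) * exp (- (b powr \<alpha>)) / Z_const \<alpha>"
proof -
  interpret N: prob_space "mu \<alpha>" by (rule prob_space_N)
  have "ennreal ((b - a) * exp (- (b powr \<alpha>)) / Z_const \<alpha>)
      = (\<integral>\<^sup>+x. ennreal (exp (- (b powr \<alpha>)) / Z_const \<alpha>) * indicator {a..b} x \<partial>lborel)"
    using assms Z_const_pos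
    by (subst nn_integral_cmult_indicator) (auto simp: ennreal_mult[symmetric] mult.commute)
  also have "\<dots> \<le> (\<integral>\<^sup>+x. ennreal (indicator {0..} x * exp (- (x powr \<alpha>)) / Z_const \<alpha>) * indicator {a..b} x \<partial>lborel)"
    using assms Z_const_pos \<alpha>_pos
    by (intro nn_integral_mono)
      (auto simp: indicator_def intro!: ennreal_leI divide_right_mono powr_mono2)
  also have "\<dots> = emeasure (mu \<alpha>) {a..b}" unfolding mu_def by (subst emeasure_density) auto
  also have "\<dots> = ennreal (measure (mu \<alpha>) {a..b})" by (rule N.emeasure_eq_measure)
  finally have "(b - a) * exp (- (b powr \<alpha>)) / Z_const \<alpha> \<le> measure (mu \<alpha>) {a..b}"
    by (subst (asm) ennreal_le_iff) auto
  also have "\<dots> = prob (X v -` {a..b} \<inter> space M)"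
    unfolding distr_X[of v, symmetric] by (rule measure_distr) auto
  also have "X v -` {a..b} \<inter> space M = {\<omega> \<in> space M. X v \<omega> \<in> {a..b}}" by auto
  finally show ?thesis .
qed

text \<open>This is \<open>ln u \<le> u\<close> for \<open>u = \<alpha> / 4 * x powr \<alpha>\<close>, exponentiated.\<close>

lemma le_exp_powr:
  obtains C where "C > 0" "\<And>x. 0 \<le> x \<Longrightarrow> x \<le> C * exp (x powr \<alpha> / 4)"
proof
  define C where "C = exp (- ln (\<alpha> / 4) / \<alpha>)"
  show "C > 0" by (simp add: C_def)
  fix x :: real assume "0 \<le> x"
  show "x \<le> C * exp (x powr \<alpha> / 4)"
  proof (cases "x = 0")
    case False
    hence x: "x > 0" using \<open>0 \<le> x\<close> by simp
    have "ln (\<alpha> / 4 * x powr \<alpha>) \<le> \<alpha> / 4 * x powr \<alpha>"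
      using ln_le_minus_one[of "\<alpha> / 4 * x powr \<alpha>"] x \<alpha>_pos by simp
    hence "\<alpha> * ln x \<le> \<alpha> / 4 * x powr \<alpha> - ln (\<alpha> / 4)"
      using x \<alpha>_pos by (subst (asm) ln_mult) (auto simp: ln_powr)
    hence "ln x \<le> (\<alpha> / 4 * x powr \<alpha> - ln (\<alpha> / 4)) / \<alpha>"
      using \<alpha>_pos by (simp add: field_simps)
    also have "\<dots> = - ln (\<alpha> / 4) / \<alpha> + x powr \<alpha> / 4" using \<alpha>_pos by (simp add: field_simps)
    finally have "exp (ln x) \<le> exp (- ln (\<alpha> / 4) / \<alpha> + x powr \<alpha> / 4)" by simp
    thus ?thesis using x by (simp add: C_def exp_add[symmetric] algebra_simps)
  qed (simp add: C_def)
qed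

lemma exp_moment_same_for_all_sites: "expectation (\<lambda>\<omega>. exp (l * X v \<omega> powr \<alpha>)) = expectation (\<lambda>\<omega>. exp (l * X w \<omega> powr \<alpha>))"
proof -
  have "expectation (\<lambda>\<omega>. exp (l * X v \<omega> powr \<alpha>)) = (\<integral>x. exp (l * x powr \<alpha>) \<partial>mu \<alpha>)" for v
    unfolding distr_X[of v, symmetric] by (rule integral_distr[symmetric]) auto
  thus ?thesis by simp
qed

text \<open>On \<open>{\<tau>..}\<close> the weight is bounded by \<open>C * exp (x powr \<alpha> / 4)\<close>, and multiplying this by
  \<open>exp ((x powr \<alpha> - \<tau> powr \<alpha>) / 4)\<close>, which is at least \<open>1\<close> there, leaves an exponential moment of
  order \<open>1/2\<close>.\<close>

lemma truncated_mean:
  obtains C where "C > 0" "\<And>v \<tau>. 0 \<le> \<tau> \<Longrightarrow> integrable M (\<lambda>\<omega>. X v \<omega> * indicator {\<tau>..} (X v \<omega>))"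
    "\<And>v \<tau>. 0 \<le> \<tau> \<Longrightarrow> expectation (\<lambda>\<omega>. X v \<omega> * indicator {\<tau>..} (X v \<omega>)) \<le> C * exp (- (\<tau> powr \<alpha> / 4))"
proof -
  obtain C where C: "C > 0" "\<And>x. 0 \<le> x \<Longrightarrow> x \<le> C * exp (x powr \<alpha> / 4)" using le_exp_powr by blast
  define E where "E = expectation (\<lambda>\<omega>. exp (1/2 * X undefined \<omega> powr \<alpha>))"
  have bd: "x * indicator {\<tau>..} x \<le> C * exp (- (\<tau> powr \<alpha> / 4)) * exp (1/2 * x powr \<alpha>)"
    if "0 \<le> \<tau>" "0 \<le> x" for x \<tau>
  proof (cases "x \<ge> \<tau>")
    case True
    hence "\<tau> powr \<alpha> \<le> x powr \<alpha>" using that \<alpha>_pos by (intro powr_mono2) auto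
    hence "C * exp (x powr \<alpha> / 4) \<le> C * exp (- (\<tau> powr \<alpha> / 4) + 1/2 * x powr \<alpha>)"
      using C(1) by simp
    thus ?thesis using C(2)[OF that(2)] True by (simp add: exp_add[symmetric] algebra_simps)
  qed (use C(1) in auto)
  have int: "integrable M (\<lambda>\<omega>. C * exp (- (\<tau> powr \<alpha> / 4)) * exp (1/2 * X v \<omega> powr \<alpha>))" for v \<tau>
    using integrable_exp_powr[of "1/2" v] by (intro integrable_mult_right) auto
  have int2: "integrable M (\<lambda>\<omega>. X v \<omega> * indicator {\<tau>..} (X v \<omega>))" if "0 \<le> \<tau>" for v \<tau>
  proof (rule Bochner_Integration.integrable_bound[OF int[of \<tau> v]])
    show "AE \<omega> in M. norm (X v \<omega> * indicator {\<tau>..} (X v \<omega>))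
        \<le> norm (C * exp (- (\<tau> powr \<alpha> / 4)) * exp (1/2 * X v \<omega> powr \<alpha>))"
      using AE_nonneg[of v]
    proof eventually_elim
      case (elim \<omega>)
      thus ?case using bd[OF that elim] C(1) by simp
    qed
  qed measurable
  show ?thesis
  proof (rule that[of "C * (E + 1)"])
    have "E \<ge> 0" unfolding E_def by (intro Bochner_Integration.integral_nonneg) auto
    thus "C * (E + 1) > 0" using C by simp
    fix v and \<tau> :: real assume \<tau>: "0 \<le> \<tau>"
    show "integrable M (\<lambda>\<omega>. X v \<omega> * indicator {\<tau>..} (X v \<omega>))" by (rule int2) fact
    have "expectation (\<lambda>\<omega>. X v \<omega> * indicator {\<tau>..} (X v \<omega>))
        \<le> expectation (\<lambda>\<omega>. C * exp (- (\<tau> powr \<alpha> / 4)) * exp (1/2 * X v \<omega> powr \<alpha>))"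
      using int2[OF \<tau>] int AE_nonneg[of v] bd[OF \<tau>] by (intro integral_mono_AE) auto
    also have "\<dots> = C * exp (- (\<tau> powr \<alpha> / 4)) * E"
      unfolding E_def by (simp add: exp_moment_same_for_all_sites[of "1/2" v undefined, simplified])
    also have "\<dots> \<le> C * (E + 1) * exp (- (\<tau> powr \<alpha> / 4))" using C(1) by (simp add: algebra_simps)
    finally show "expectation (\<lambda>\<omega>. X v \<omega> * indicator {\<tau>..} (X v \<omega>)) \<le> C * (E + 1) * exp (- (\<tau> powr \<alpha> / 4))" .
  qed
qed

lemma integrable_X: "integrable M (X v)"
proof -
  have "integrable M (\<lambda>\<omega>. X v \<omega> * indicator {0..} (X v \<omega>))" using truncated_mean by (metis order_refl)
  moreover have "AE \<omega> in M. X v \<omega> * indicator {0..} (X v \<omega>) = X v \<omega>"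
    using AE_nonneg[of v] by eventually_elim simp
  ultimately show ?thesis by (subst (asm) integrable_cong_AE) auto
qed

text \<open>Above \<open>\<tau>\<close>, an exponential moment of order \<open>l\<close> costs at most \<open>exp (- (m - l) * \<tau> powr \<alpha>)\<close> times one of
  order \<open>m\<close>, for \<open>m\<close> half way between \<open>l\<close> and \<open>1\<close>.\<close>

lemma large_part_mgf:
  assumes "0 < l" "l < 1"
  obtains D where "D > 0" "\<And>v \<tau>. 0 \<le> \<tau> \<Longrightarrow>
     integrable M (\<lambda>\<omega>. exp (l * (X v \<omega> powr \<alpha> * indicator {\<tau>..} (X v \<omega>)))) \<and>
     expectation (\<lambda>\<omega>. exp (l * (X v \<omega> powr \<alpha> * indicator {\<tau>..} (X v \<omega>)))) \<le> 1 + D * exp (- ((1 - l) / 2 * \<tau> powr \<alpha>))"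
proof -
  define m where "m = (1 + l) / 2"
  have m: "l < m" "m < 1" "m - l = (1 - l) / 2" using assms by (auto simp: m_def field_simps)
  define E where "E = expectation (\<lambda>\<omega>. exp (m * X undefined \<omega> powr \<alpha>))"
  have bd: "exp (l * (x powr \<alpha> * indicator {\<tau>..} x)) \<le> 1 + exp (- ((m - l) * \<tau> powr \<alpha>)) * exp (m * x powr \<alpha>)"
    if "0 \<le> \<tau>" "0 \<le> x" for x \<tau> :: real
  proof (cases "x \<ge> \<tau>")
    case True
    hence "\<tau> powr \<alpha> \<le> x powr \<alpha>" using that \<alpha>_pos by (intro powr_mono2) auto
    hence "(m - l) * \<tau> powr \<alpha> \<le> (m - l) * x powr \<alpha>" using m by (intro mult_left_mono) auto
    hence "l * x powr \<alpha> \<le> - ((m - l) * \<tau> powr \<alpha>) + m * x powr \<alpha>" by (simp add: algebra_simps)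
    hence "exp (l * x powr \<alpha>) \<le> exp (- ((m - l) * \<tau> powr \<alpha>)) * exp (m * x powr \<alpha>)"
      by (simp add: exp_add[symmetric])
    thus ?thesis using True by simp
  qed auto
  have int: "integrable M (\<lambda>\<omega>. 1 + exp (- ((m - l) * \<tau> powr \<alpha>)) * exp (m * X v \<omega> powr \<alpha>))" for v \<tau>
    using integrable_exp_powr[of m v] m by (intro Bochner_Integration.integrable_add integrable_mult_right) auto
  have int2: "integrable M (\<lambda>\<omega>. exp (l * (X v \<omega> powr \<alpha> * indicator {\<tau>..} (X v \<omega>))))" if "0 \<le> \<tau>" for v \<tau>
  proof (rule Bochner_Integration.integrable_bound[OF int[of \<tau> v]])
    show "AE \<omega> in M. norm (exp (l * (X v \<omega> powr \<alpha> * indicator {\<tau>..} (X v \<omega>))))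
        \<le> norm (1 + exp (- ((m - l) * \<tau> powr \<alpha>)) * exp (m * X v \<omega> powr \<alpha>))"
      using AE_nonneg[of v]
    proof eventually_elim
      case (elim \<omega>)
      show ?case using bd[OF that elim] by (simp add: abs_of_pos add_pos_pos)
    qed
  qed measurable
  show ?thesis
  proof (rule that[of "E + 1"])
    have "E \<ge> 0" unfolding E_def by (intro Bochner_Integration.integral_nonneg) auto
    thus "E + 1 > 0" by simp
    fix v and \<tau> :: real assume \<tau>: "0 \<le> \<tau>"
    have "expectation (\<lambda>\<omega>. exp (l * (X v \<omega> powr \<alpha> * indicator {\<tau>..} (X v \<omega>))))
        \<le> expectation (\<lambda>\<omega>. 1 + exp (- ((m - l) * \<tau> powr \<alpha>)) * exp (m * X v \<omega> powr \<alpha>))"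
      using int2[OF \<tau>] int AE_nonneg[of v] bd[OF \<tau>] by (intro integral_mono_AE) auto
    also have "\<dots> = 1 + exp (- ((m - l) * \<tau> powr \<alpha>)) * E"
      unfolding E_def using integrable_exp_powr[of m v] m
      by (simp add: exp_moment_same_for_all_sites[of m v undefined] prob_space)
    also have "\<dots> \<le> 1 + (E + 1) * exp (- ((1 - l) / 2 * \<tau> powr \<alpha>))" unfolding m(3) by (simp add: algebra_simps)
    finally show "integrable M (\<lambda>\<omega>. exp (l * (X v \<omega> powr \<alpha> * indicator {\<tau>..} (X v \<omega>)))) \<and>
     expectation (\<lambda>\<omega>. exp (l * (X v \<omega> powr \<alpha> * indicator {\<tau>..} (X v \<omega>)))) \<le> 1 + (E + 1) * exp (- ((1 - l) / 2 * \<tau> powr \<alpha>))"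
      using int2[OF \<tau>] by simp
  qed
qed

end

section \<open>Growth of sequences and expected maxima\<close>

text \<open>Fekete's lemma. The limit is the supremum of \<open>b n / n\<close>, which also yields the bound without error term:
  writing \<open>n = q * m + r\<close> with \<open>r < m\<close> shows that \<open>b n / n\<close> is at least \<open>b m / m\<close> up to an error of order
  \<open>1 / n\<close>.\<close>

lemma superadditive_limit:
  fixes b :: "nat \<Rightarrow> real" and C :: real
  assumes super: "\<And>m n. b m + b n \<le> b (m + n)" and bound: "\<And>n. n \<ge> 1 \<Longrightarrow> b n \<le> C * n"
  obtains g :: real where "(\<lambda>n. b n / n) \<longlonglongrightarrow> g" "\<And>n. b n \<le> g * n"
proof -
  define g where "g = (SUP n\<in>{1..}. b n / real n)"
  have bdd: "bdd_above ((\<lambda>n. b n / real n) ` {1..})"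
  proof (rule bdd_aboveI2)
    fix n :: nat assume "n \<in> {1..}"
    thus "b n / real n \<le> C" using bound[of n] by (simp add: pos_divide_le_eq)
  qed
  have upper: "b n / n \<le> g" if "n \<ge> 1" for n
    unfolding g_def by (rule cSUP_upper[OF _ bdd]) (use that in auto)
  have "(\<lambda>n. b n / n) \<longlonglongrightarrow> g"
  proof (rule order_tendstoI)
    fix a assume a: "g < a"
    show "\<forall>\<^sub>F n in sequentially. b n / n < a"
      using eventually_ge_at_top[of 1] by eventually_elim (use upper a in \<open>meson le_less_trans\<close>)
  next
    fix a assume "a < g"
    then obtain m where m: "m \<ge> 1" "a < b m / m"
      unfolding g_def by (subst (asm) less_cSUP_iff[OF _ bdd]) auto
    have mult: "real q * b m + b r \<le> b (q * m + r)" for q r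
    proof (induction q)
      case (Suc q)
      thus ?case using super[of m "q * m + r"] by (simp add: algebra_simps)
    qed simp
    define B where "B = (\<Sum>r<m. \<bar>b r\<bar>)"
    have lower: "b n / n \<ge> b m / m - (\<bar>b m\<bar> + B) / n" if n: "n \<ge> 1" for n
    proof -
      define q r where "q = n div m" and "r = n mod m"
      have nq: "n = q * m + r" and r: "r < m" using m by (auto simp: q_def r_def)
      have "\<bar>b r\<bar> \<le> B" unfolding B_def by (rule member_le_sum) (use r in auto)
      hence B: "- B \<le> b r" by linarith
      have "real q = (real n - real r) / m" using m by (simp add: nq)
      hence "real q * b m = n * (b m / m) - (r / m) * b m"
        by (simp only: left_diff_distrib diff_divide_distrib times_divide_eq_left times_divide_eq_right)
      moreover have "(r / m) * b m \<le> \<bar>b m\<bar>"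
      proof -
        have "(r / m) * b m \<le> (r / m) * \<bar>b m\<bar>" by (intro mult_left_mono) auto
        also have "\<dots> \<le> 1 * \<bar>b m\<bar>" using r by (intro mult_right_mono) auto
        finally show ?thesis by simp
      qed
      ultimately have "n * (b m / m) - (\<bar>b m\<bar> + B) \<le> b n" using mult[of q r, folded nq] B by linarith
      hence "(n * (b m / m) - (\<bar>b m\<bar> + B)) / n \<le> b n / n" by (rule divide_right_mono) simp
      thus ?thesis using n by (simp add: diff_divide_distrib)
    qed
    have "(\<lambda>n. b m / m - (\<bar>b m\<bar> + B) / real n) \<longlonglongrightarrow> b m / m - 0"
      by (intro tendsto_diff tendsto_const lim_const_over_n)
    hence "\<forall>\<^sub>F n in sequentially. a < b m / m - (\<bar>b m\<bar> + B) / real n"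
      using m by (intro order_tendstoD(1)) auto
    thus "\<forall>\<^sub>F n in sequentially. a < b n / n"
      using eventually_ge_at_top[of 1] by eventually_elim (use lower in \<open>meson less_le_trans\<close>)
  qed
  moreover have "b n \<le> g * n" for n
  proof (cases "n \<ge> 1")
    case True
    thus ?thesis using upper[OF True] by (simp add: divide_le_eq)
  next
    case False
    hence "n = 0" by simp
    thus ?thesis using super[of 0 0] by simp
  qed
  ultimately show ?thesis using that by blast
qed

text \<open>Along powers of two, \<open>a k / k\<close> increases at each doubling by at most a multiple of \<open>k powr (-1/4)\<close>, and
  these increments form a convergent geometric series. Monotonicity fills the gaps between the powers.\<close>

lemma dyadic_almost_subadditive_bound:
  fixes a :: "nat \<Rightarrow> real" and K :: real
  assumes nonneg: "\<And>k. k \<ge> 1 \<Longrightarrow> 0 \<le> a k" and mono: "\<And>j k. 1 \<le> j \<Longrightarrow> j \<le> k \<Longrightarrow> a j \<le> a k"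
    and step: "\<And>k. k \<ge> 1 \<Longrightarrow> a (2 * k) \<le> 2 * a k + K * real k powr (3/4)" and "K \<ge> 0"
  obtains C :: real where "C \<ge> 0" "\<And>n. n \<ge> 1 \<Longrightarrow> a n \<le> C * n"
proof -
  \<comment> \<open>The ratio of consecutive bounds on the increments of \<open>a (2 ^ j) / 2 ^ j\<close>.\<close>
  define r :: real where "r = 2 powr (- (1/4))"
  have r: "0 < r" "r < 1" by (auto simp: r_def powr_less_one)
  define A where "A = a 1 + K / 2 / (1 - r)"
  have rj: "(2 ^ j) powr (3/4) / 2 ^ j = r ^ j" for j :: nat
  proof -
    have "(2 ^ j) powr (3/4 :: real) / 2 ^ j = (2 ^ j :: real) powr (3/4 - 1)"
      by (subst powr_diff) simp
    also have "\<dots> = r ^ j" unfolding r_def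
      by (simp add: powr_powr powr_realpow[symmetric] mult.commute)
    finally show ?thesis .
  qed
  have dy: "a (2 ^ j) / 2 ^ j \<le> a 1 + K / 2 * (\<Sum>i<j. r ^ i)" for j
  proof (induction j)
    case (Suc j)
    have "a (2 ^ Suc j) / 2 ^ Suc j \<le> (2 * a (2 ^ j) + K * real (2 ^ j) powr (3/4)) / 2 ^ Suc j"
      using step[of "2 ^ j"] by (intro divide_right_mono) auto
    also have "\<dots> = a (2 ^ j) / 2 ^ j + K / 2 * ((2 ^ j) powr (3/4) / 2 ^ j)"
      by (simp add: add_divide_distrib)
    also have "\<dots> = a (2 ^ j) / 2 ^ j + K / 2 * r ^ j" unfolding rj ..
    also have "\<dots> \<le> a 1 + K / 2 * (\<Sum>i<Suc j. r ^ i)" using Suc.IH by (simp add: algebra_simps)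
    finally show ?case .
  qed simp
  have dy2: "a (2 ^ j) \<le> A * 2 ^ j" for j
  proof -
    have "(\<Sum>i<j. r ^ i) \<le> (\<Sum>i. r ^ i)" using r by (intro sum_le_suminf summable_geometric) auto
    also have "\<dots> = 1 / (1 - r)" using r by (intro suminf_geometric) auto
    finally have "K / 2 * (\<Sum>i<j. r ^ i) \<le> K / 2 * (1 / (1 - r))" using \<open>K \<ge> 0\<close> by (intro mult_left_mono) auto
    also have "\<dots> = K / 2 / (1 - r)" by simp
    finally have "a (2 ^ j) / 2 ^ j \<le> A" using dy[of j] unfolding A_def by linarith
    thus ?thesis by (simp add: divide_le_eq)
  qed
  have A: "A \<ge> 0" using nonneg[of 1] \<open>K \<ge> 0\<close> r by (auto simp: A_def)
  show ?thesis
  proof (rule that[of "2 * A"])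
    fix n :: nat assume n: "n \<ge> 1"
    define j where "j = (LEAST j. n \<le> 2 ^ j)"
    have ex: "\<exists>j. n \<le> 2 ^ j" by (rule exI[of _ n]) simp
    have nj: "n \<le> 2 ^ j" unfolding j_def using LeastI_ex[OF ex] .
    have jn: "2 ^ j \<le> 2 * n"
    proof (cases j)
      case (Suc i)
      hence "\<not> n \<le> 2 ^ i" unfolding j_def using not_less_Least by (metis lessI)
      thus ?thesis using Suc by simp
    qed (use n in auto)
    have "a n \<le> a (2 ^ j)" by (rule mono[OF n nj])
    also have "\<dots> \<le> A * 2 ^ j" by (rule dy2)
    also have "\<dots> \<le> A * (2 * n)" using A jn by (intro mult_left_mono) (metis of_nat_le_iff of_nat_mult of_nat_numeral of_nat_power, auto)
    finally show "a n \<le> 2 * A * n" by simp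
  qed (use A in simp)
qed

text \<open>Exponential moments control a maximum by their sum. The inequality \<open>y \<le> A + (exp (l * (y - A)) - 1) / l\<close> is
  used at the level \<open>A\<close> for which the bounds on \<open>expectation (\<lambda>\<omega>. exp (l * (Y w \<omega> - A)))\<close> add up to \<open>1\<close>.\<close>

lemma (in prob_space) expectation_Max_le:
  fixes Y :: "'w \<Rightarrow> 'a \<Rightarrow> real"
  assumes "finite U" "U \<noteq> {}" "l > 0"
    and Y: "\<And>w. w \<in> U \<Longrightarrow> integrable M (Y w)"
    and int: "\<And>w. w \<in> U \<Longrightarrow> integrable M (\<lambda>\<omega>. exp (l * Y w \<omega>))"
    and mgf: "\<And>w. w \<in> U \<Longrightarrow> expectation (\<lambda>\<omega>. exp (l * Y w \<omega>)) \<le> exp (l * m + s)"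
  shows "integrable M (\<lambda>\<omega>. Max ((\<lambda>w. Y w \<omega>) ` U))"
    "expectation (\<lambda>\<omega>. Max ((\<lambda>w. Y w \<omega>) ` U)) \<le> m + (s + ln (card U)) / l"
proof -
  define A where "A = m + (s + ln (card U)) / l"
  have cU: "real (card U) > 0" using assms by (simp add: card_gt_0_iff)
  have lA: "l * A = l * m + s + ln (card U)" using assms(3) by (simp add: A_def field_simps)
  have [measurable]: "\<And>w. w \<in> U \<Longrightarrow> Y w \<in> borel_measurable M" using Y by auto
  have att: "\<exists>w\<in>U. Max ((\<lambda>w. Y w \<omega>) ` U) = Y w \<omega>" for \<omega>
  proof -
    have "Max ((\<lambda>w. Y w \<omega>) ` U) \<in> (\<lambda>w. Y w \<omega>) ` U" using assms by (intro Max_in) auto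
    thus ?thesis by (simp only: image_iff)
  qed
  show int_Max: "integrable M (\<lambda>\<omega>. Max ((\<lambda>w. Y w \<omega>) ` U))"
  proof (rule Bochner_Integration.integrable_bound)
    show "integrable M (\<lambda>\<omega>. \<Sum>w\<in>U. \<bar>Y w \<omega>\<bar>)" using Y by auto
    have "\<bar>Max ((\<lambda>w. Y w \<omega>) ` U)\<bar> \<le> (\<Sum>w\<in>U. \<bar>Y w \<omega>\<bar>)" for \<omega>
    proof -
      obtain w where w: "w \<in> U" "Max ((\<lambda>w. Y w \<omega>) ` U) = Y w \<omega>" using att by blast
      show ?thesis unfolding w(2) using w(1) assms(1) by (intro member_le_sum) auto
    qed
    thus "AE \<omega> in M. norm (Max ((\<lambda>w. Y w \<omega>) ` U)) \<le> norm (\<Sum>w\<in>U. \<bar>Y w \<omega>\<bar>)"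
      by (intro AE_I2) (simp add: order_trans[OF _ abs_ge_self])
  qed (use assms(1) in measurable)
  have pt: "Max ((\<lambda>w. Y w \<omega>) ` U) \<le> A + ((\<Sum>w\<in>U. exp (- (l * A)) * exp (l * Y w \<omega>)) - 1) / l" for \<omega>
  proof -
    obtain w where w: "w \<in> U" "Max ((\<lambda>w. Y w \<omega>) ` U) = Y w \<omega>" using att by blast
    have "1 + (l * Y w \<omega> - l * A) \<le> exp (l * Y w \<omega> - l * A)" by (rule exp_ge_add_one_self)
    also have "\<dots> = exp (- (l * A)) * exp (l * Y w \<omega>)" by (simp add: exp_add[symmetric])
    also have "\<dots> \<le> (\<Sum>w\<in>U. exp (- (l * A)) * exp (l * Y w \<omega>))"
      using w(1) assms(1) by (intro member_le_sum) auto
    finally show ?thesis unfolding w(2) using assms(3) by (simp add: field_simps)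
  qed
  have "expectation (\<lambda>\<omega>. Max ((\<lambda>w. Y w \<omega>) ` U))
      \<le> expectation (\<lambda>\<omega>. A + ((\<Sum>w\<in>U. exp (- (l * A)) * exp (l * Y w \<omega>)) - 1) / l)"
    using int_Max int pt by (intro integral_mono) auto
  also have "\<dots> = A + ((\<Sum>w\<in>U. exp (- (l * A)) * expectation (\<lambda>\<omega>. exp (l * Y w \<omega>))) - 1) / l"
    using int by (simp add: prob_space)
  also have "\<dots> \<le> A + ((\<Sum>w\<in>U. exp (- (l * A)) * exp (l * m + s)) - 1) / l"
    using mgf assms(3) by (intro add_left_mono divide_right_mono diff_right_mono sum_mono mult_left_mono) auto
  also have "(\<Sum>w\<in>U. exp (- (l * A)) * exp (l * m + s)) = 1"
  proof -
    have "exp (- (l * A)) * exp (l * m + s) = exp (- ln (card U))"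
      unfolding exp_add[symmetric] lA by simp
    thus ?thesis using cU by (simp add: exp_minus)
  qed
  finally show "expectation (\<lambda>\<omega>. Max ((\<lambda>w. Y w \<omega>) ` U)) \<le> m + (s + ln (card U)) / l"
    by (simp add: A_def)
qed

text \<open>The error terms in the doubling inequality for clipping level \<open>k powr (1/8)\<close> and exponential parameter
  \<open>k powr (-1/2)\<close>: the variance term has order \<open>k powr (3/4)\<close>, the entropy of the maximum has order
  \<open>k powr (1/2) * ln k\<close>, and the mean of the clipped-off weights tends to \<open>0\<close>.\<close>

lemma dyadic_error_bound:
  fixes \<alpha> C :: real and d :: nat
  assumes "\<alpha> > 0"
  obtains K :: real where "K \<ge> 0" "\<And>k. k \<ge> 1 \<Longrightarrow>
      (real k powr (-(1/2)) * (real k powr (1/8))\<^sup>2 * k / 8 + ln ((2 * real k + 1) ^ d) / (real k powr (-(1/2)))) +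
      (3 * real k + 1) ^ d * (C * exp (- ((real k powr (1/8)) powr \<alpha> / 4))) \<le> K * real k powr (3/4)"
proof -
  let ?e = "\<lambda>k::nat. (real k powr (-(1/2)) * (real k powr (1/8))\<^sup>2 * k / 8 + ln ((2 * real k + 1) ^ d) / (real k powr (-(1/2)))) +
      (3 * real k + 1) ^ d * (C * exp (- ((real k powr (1/8)) powr \<alpha> / 4)))"
  have 1: "(\<lambda>k::nat. (real k powr (-(1/2)) * (real k powr (1/8))\<^sup>2 * k / 8) / real k powr (3/4)) \<longlonglongrightarrow> 1/8"
    by real_asymp
  have 2: "(\<lambda>k::nat. real d * (ln (2 * real k + 1) / (real k powr (-(1/2))) / real k powr (3/4))) \<longlonglongrightarrow> real d * 0"
    by (intro tendsto_mult tendsto_const) real_asymp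
  have 3: "(\<lambda>k::nat. C * ((3 * real k + 1) powr d * exp (- ((real k powr (1/8)) powr \<alpha> / 4)) / real k powr (3/4))) \<longlonglongrightarrow> C * 0"
    using assms by (intro tendsto_mult tendsto_const) real_asymp
  have "(\<lambda>k. ?e k / real k powr (3/4)) \<longlonglongrightarrow> 1/8 + real d * 0 + C * 0"
    by (rule Lim_transform_eventually[OF tendsto_add[OF tendsto_add[OF 1 2] 3]])
      (auto intro!: always_eventually simp: ln_realpow powr_realpow add_divide_distrib algebra_simps)
  hence "Bseq (\<lambda>k. ?e k / real k powr (3/4))" by (intro convergent_imp_Bseq) (auto simp: convergent_def)
  then obtain K where K: "K > 0" "\<And>k. norm (?e k / real k powr (3/4)) \<le> K" by (auto elim: BseqE)
  show ?thesis
  proof (rule that[of K])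
    fix k :: nat assume "k \<ge> 1"
    hence p: "real k powr (3/4) > 0" by simp
    have "?e k / real k powr (3/4) \<le> K" using K(2)[of k] unfolding real_norm_def by (rule order_trans[OF abs_ge_self])
    thus "?e k \<le> K * real k powr (3/4)" using p by (simp only: pos_divide_le_eq)
  qed (use K in simp)
qed

section \<open>Linear growth and the time constant\<close>

abbreviation (input) diag :: "nat \<Rightarrow> nat ^ 'd::finite" where
  "diag n \<equiv> (\<chi> i. n)"

lemma le_clip_plus_excess:
  "0 \<le> t \<Longrightarrow> t \<le> clip \<tau> t + t * indicator {\<tau>..} t" for t \<tau> :: real
  by (auto simp: clip_def indicator_def)

lemma layered_family_paths_from:
  assumes "k \<ge> 1"
  shows "layered_family (paths_from (w :: nat ^ 'd::finite) k) level"
proof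
  show "finite (paths_from w k)" by simp
  show ne: "paths_from w k \<noteq> {}" using assms by (rule paths_from_nonempty)
  show "inj_on level \<pi>" if "\<pi> \<in> paths_from w k" for \<pi> using paths_from_props(2)[OF that] .
  show "finite (\<Union>(paths_from w k))" by (rule finite_Union, simp) (auto simp: paths_from_def)
  obtain \<pi> where \<pi>: "\<pi> \<in> paths_from w k" using ne by blast
  hence "\<pi> \<noteq> {}" by (auto simp: paths_from_def)
  thus "\<Union>(paths_from w k) \<noteq> {}" using \<pi> by blast
qed

lemma card_level_paths_from: "card (level ` \<Union>(paths_from (w :: nat ^ 'd::finite) k)) \<le> k"
proof -
  have "level ` \<Union>(paths_from w k) \<subseteq> {level w..<level w + k}" using paths_from_props(3) by blast
  hence "card (level ` \<Union>(paths_from w k)) \<le> card {level w..<level w + k}" by (intro card_mono) auto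
  thus ?thesis by simp
qed

lemma layered_family_directed: "layered_family (directed_paths 0 (diag n) :: (nat ^ 'd::finite) set set) level"
proof
  let ?D = "directed_paths 0 (diag n) :: (nat ^ 'd) set set"
  show "finite ?D" "?D \<noteq> {}" by simp_all
  show "inj_on level \<pi>" if "\<pi> \<in> ?D" for \<pi> by (rule directed_path_in_box(2)[OF that])
  have "\<Union>?D \<subseteq> lattice_box n" using directed_path_in_box(1) by blast
  thus "finite (\<Union>?D)" by (rule finite_subset) simp
  obtain \<pi> where "\<pi> \<in> ?D" using directed_paths_nonempty by blast
  thus "\<Union>?D \<noteq> {}" using directed_path_in_box(4) by blast
qed

lemma card_level_directed:
  "card (level ` \<Union>(directed_paths 0 (diag n) :: (nat ^ 'd::finite) set set)) \<le> CARD('d) * n + 1"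
proof -
  have "level ` \<Union>(directed_paths 0 (diag n) :: (nat ^ 'd) set set)
      \<subseteq> level ` \<Union>(paths_from (0 :: nat ^ 'd) (CARD('d) * n + 1))"
    using directed_path_in_box(3) by blast
  moreover have "finite (level ` \<Union>(paths_from (0 :: nat ^ 'd) (CARD('d) * n + 1)))"
    by (rule finite_imageI, rule layered_family.fin_paths, rule layered_family_paths_from) simp
  ultimately have "card (level ` \<Union>(directed_paths 0 (diag n) :: (nat ^ 'd) set set))
      \<le> card (level ` \<Union>(paths_from (0 :: nat ^ 'd) (CARD('d) * n + 1)))"
    by (rule card_mono[rotated])
  also note card_level_paths_from
  finally show ?thesis .
qed

locale lpp_field = weibull_field M X \<alpha>
  for M :: "'a measure" and X :: "nat ^ 'd::finite \<Rightarrow> 'a \<Rightarrow> real" and \<alpha> :: real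
begin

lemma AE_all_nonneg: "AE \<omega> in M. \<forall>v. 0 \<le> X v \<omega>"
  using AE_nonneg by (simp add: AE_all_countable)

lemma layered_iid:
  assumes "layered_family P level"
  shows "layered_iid_field M X (mu \<alpha>) P level"
  using assms iid_field_axioms by (simp add: layered_iid_field_def)

lemma integrable_lpp:
  assumes "layered_family P (level :: nat ^ 'd \<Rightarrow> nat)"
  shows "integrable M (\<lambda>\<omega>. lpp P (\<lambda>v. X v \<omega>))"
proof -
  interpret layered_family P "level :: nat ^ 'd \<Rightarrow> nat" by fact
  show ?thesis
  proof (rule Bochner_Integration.integrable_bound)
    show "integrable M (\<lambda>\<omega>. \<Sum>v\<in>\<Union>P. \<bar>X v \<omega>\<bar>)" using integrable_X by auto
    show "(\<lambda>\<omega>. lpp P (\<lambda>v. X v \<omega>)) \<in> borel_measurable M"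
      by (rule measurable_lpp[OF fin_P]) simp
    have "\<bar>lpp P (\<lambda>v. X v \<omega>)\<bar> \<le> (\<Sum>v\<in>\<Union>P. \<bar>X v \<omega>\<bar>)" for \<omega>
      by (rule abs_lpp_le[OF fin_paths P_ne fin_P]) auto
    thus "AE \<omega> in M. norm (lpp P (\<lambda>v. X v \<omega>)) \<le> norm (\<Sum>v\<in>\<Union>P. \<bar>X v \<omega>\<bar>)"
      by (intro AE_I2) (simp add: order_trans[OF _ abs_ge_self])
  qed
qed

text \<open>The weights above the threshold are summed over the whole set \<open>B\<close>, not along a path: they are so rare
  that nothing is lost at the exponential scale.\<close>

definition excess :: "(nat ^ 'd) set \<Rightarrow> real \<Rightarrow> 'a \<Rightarrow> real" where
  "excess B \<tau> \<omega> = (\<Sum>v\<in>B. X v \<omega> * indicator {\<tau>..} (X v \<omega>))"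

lemma expectation_excess:
  obtains C where "C > 0" "\<And>B \<tau>. 0 \<le> \<tau> \<Longrightarrow> integrable M (excess B \<tau>)"
    "\<And>B \<tau>. 0 \<le> \<tau> \<Longrightarrow> expectation (excess B \<tau>) \<le> card B * (C * exp (- (\<tau> powr \<alpha> / 4)))"
proof -
  obtain C where C: "C > 0" "\<And>v \<tau>. 0 \<le> \<tau> \<Longrightarrow> integrable M (\<lambda>\<omega>. X v \<omega> * indicator {\<tau>..} (X v \<omega>))"
    "\<And>v \<tau>. 0 \<le> \<tau> \<Longrightarrow> expectation (\<lambda>\<omega>. X v \<omega> * indicator {\<tau>..} (X v \<omega>)) \<le> C * exp (- (\<tau> powr \<alpha> / 4))"
    using truncated_mean by blast
  show ?thesis
  proof (rule that[OF C(1)])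
    fix B :: "(nat ^ 'd) set" and \<tau> :: real assume \<tau>: "0 \<le> \<tau>"
    show "integrable M (excess B \<tau>)" unfolding excess_def using C(2)[OF \<tau>] by simp
    have "expectation (excess B \<tau>) = (\<Sum>v\<in>B. expectation (\<lambda>\<omega>. X v \<omega> * indicator {\<tau>..} (X v \<omega>)))"
      unfolding excess_def using C(2)[OF \<tau>] by (rule Bochner_Integration.integral_sum)
    also have "\<dots> \<le> of_nat (card B) * (C * exp (- (\<tau> powr \<alpha> / 4)))"
      using C(3)[OF \<tau>] by (rule sum_bounded_above)
    finally show "expectation (excess B \<tau>) \<le> card B * (C * exp (- (\<tau> powr \<alpha> / 4)))" by simp
  qed
qed

lemma lpp_sandwich:
  assumes "layered_family P (level :: nat ^ 'd \<Rightarrow> nat)" "\<Union>P \<subseteq> B" "finite B" "\<tau> \<ge> 0" "\<forall>v. 0 \<le> X v \<omega>"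
  shows "lpp P (\<lambda>v. clip \<tau> (X v \<omega>)) \<le> lpp P (\<lambda>v. X v \<omega>)"
    "lpp P (\<lambda>v. X v \<omega>) \<le> lpp P (\<lambda>v. clip \<tau> (X v \<omega>)) + excess B \<tau> \<omega>"
proof -
  interpret layered_family P "level :: nat ^ 'd \<Rightarrow> nat" by fact
  show "lpp P (\<lambda>v. clip \<tau> (X v \<omega>)) \<le> lpp P (\<lambda>v. X v \<omega>)"
    using assms by (intro lpp_mono[OF fin_P P_ne] clip_bounds(3)) auto
  show "lpp P (\<lambda>v. X v \<omega>) \<le> lpp P (\<lambda>v. clip \<tau> (X v \<omega>)) + excess B \<tau> \<omega>"
    unfolding excess_def using assms
    by (intro lpp_le_sum_parts[OF _ P_ne fin_P] le_clip_plus_excess mult_nonneg_nonneg) auto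
qed

lemma expectation_clip_le:
  assumes "layered_family P (level :: nat ^ 'd \<Rightarrow> nat)" "\<tau> \<ge> 0"
  shows "expectation (\<lambda>\<omega>. lpp P (\<lambda>v. clip \<tau> (X v \<omega>))) \<le> expectation (\<lambda>\<omega>. lpp P (\<lambda>v. X v \<omega>))"
proof (rule integral_mono_AE)
  interpret L: layered_iid_field M X "mu \<alpha>" P level by (rule layered_iid) fact
  show "integrable M (\<lambda>\<omega>. lpp P (\<lambda>v. clip \<tau> (X v \<omega>)))" by (rule L.integrable_clipped) fact
  show "AE \<omega> in M. lpp P (\<lambda>v. clip \<tau> (X v \<omega>)) \<le> lpp P (\<lambda>v. X v \<omega>)"
    using AE_all_nonneg by eventually_elim (rule lpp_sandwich(1)[OF assms(1) order_refl L.fin_paths assms(2)])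
qed (rule integrable_lpp, fact)

lemma expectation_clip_translate:
  assumes "k \<ge> 1"
  shows "expectation (\<lambda>\<omega>. lpp (paths_from w k) (\<lambda>v. clip \<tau> (X v \<omega>)))
      = expectation (\<lambda>\<omega>. lpp (paths_from 0 k) (\<lambda>v. clip \<tau> (X v \<omega>)))"
proof -
  let ?P = "paths_from (0 :: nat ^ 'd) k"
  interpret layered_family ?P level by (rule layered_family_paths_from) fact
  let ?f = "\<lambda>x. lpp ?P (\<lambda>v. clip \<tau> (x v))"
  have f: "?f \<in> borel_measurable (PiM (\<Union>?P) (\<lambda>_. borel))"
    by (intro measurable_lpp[OF fin_P] measurable_compose[OF _ measurable_clip] measurable_component_singleton)
  have 1: "expectation (\<lambda>\<omega>. lpp ?P (\<lambda>v. clip \<tau> (X (c + v) \<omega>))) = (\<integral>x. ?f x \<partial>PiM (\<Union>?P) (\<lambda>_. mu \<alpha>))" for c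
  proof -
    have "expectation (\<lambda>\<omega>. ?f (\<lambda>v\<in>\<Union>?P. X (c + v) \<omega>)) = (\<integral>x. ?f x \<partial>PiM (\<Union>?P) (\<lambda>_. mu \<alpha>))"
      by (rule expectation_field[OF ne_paths _ f]) (auto simp: inj_on_def vec_eq_iff)
    moreover have "?f (\<lambda>v\<in>\<Union>?P. X (c + v) \<omega>) = lpp ?P (\<lambda>v. clip \<tau> (X (c + v) \<omega>))" for \<omega>
      by (rule lpp_cong) simp
    ultimately show ?thesis by simp
  qed
  show ?thesis using 1[of w] 1[of 0] unfolding paths_from_translate[of w] lpp_translate by simp
qed

lemma expectation_translate_directed:
  "expectation (\<lambda>\<omega>. lpp (directed_paths 0 (diag n)) (\<lambda>v. X (c + v) \<omega>))
      = expectation (\<lambda>\<omega>. lpp (directed_paths 0 (diag n)) (\<lambda>v. X v \<omega>))"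
proof -
  let ?P = "directed_paths (0 :: nat ^ 'd) (diag n)"
  interpret layered_family ?P level by (rule layered_family_directed)
  have f: "lpp ?P \<in> borel_measurable (PiM (\<Union>?P) (\<lambda>_. borel))"
    by (intro measurable_lpp[OF fin_P, where x = "\<lambda>v \<omega>. \<omega> v"] measurable_component_singleton)
  have 1: "expectation (\<lambda>\<omega>. lpp ?P (\<lambda>v. X (c + v) \<omega>)) = (\<integral>x. lpp ?P x \<partial>PiM (\<Union>?P) (\<lambda>_. mu \<alpha>))" for c
  proof -
    have "expectation (\<lambda>\<omega>. lpp ?P (\<lambda>v\<in>\<Union>?P. X (c + v) \<omega>)) = (\<integral>x. lpp ?P x \<partial>PiM (\<Union>?P) (\<lambda>_. mu \<alpha>))"
      by (rule expectation_field[OF ne_paths _ f]) (auto simp: inj_on_def vec_eq_iff)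
    moreover have "lpp ?P (\<lambda>v\<in>\<Union>?P. X (c + v) \<omega>) = lpp ?P (\<lambda>v. X (c + v) \<omega>)" for \<omega>
      by (rule lpp_cong) simp
    ultimately show ?thesis by simp
  qed
  show ?thesis using 1[of c] 1[of 0] by simp
qed

lemma integrable_translate_directed:
  "integrable M (\<lambda>\<omega>. lpp (directed_paths 0 (diag n)) (\<lambda>v. X (c + v) \<omega>))"
proof -
  let ?P = "directed_paths (0 :: nat ^ 'd) (diag n)"
  interpret layered_family ?P level by (rule layered_family_directed)
  have "layered_family ((`) ((+) c) ` ?P) level"
  proof
    show "inj_on level \<pi>" if \<pi>: "\<pi> \<in> (`) ((+) c) ` ?P" for \<pi>
    proof -
      obtain \<rho> where \<rho>: "\<rho> \<in> ?P" "\<pi> = (+) c ` \<rho>" using \<pi> by auto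
      have "level (c + v) = level c + level v" for v by (simp add: level_def sum.distrib)
      thus ?thesis using inj_lev[OF \<rho>(1)] unfolding \<rho>(2) by (auto simp: inj_on_def)
    qed
    have "\<Union>((`) ((+) c) ` ?P) = (+) c ` \<Union>?P" by auto
    thus "finite (\<Union>((`) ((+) c) ` ?P))" "\<Union>((`) ((+) c) ` ?P) \<noteq> {}" using fin_paths ne_paths by auto
  qed auto
  from integrable_lpp[OF this] show ?thesis by (simp add: lpp_translate)
qed

definition line_mean :: "nat \<Rightarrow> real" where
  "line_mean k = expectation (\<lambda>\<omega>. lpp (paths_from 0 k) (\<lambda>v. X v \<omega>))"

text \<open>All the starting sites give the same mean, by translation invariance, and fluctuations on a scale
  smaller than \<open>k\<close>; so the maximum over polynomially many of them is close to the common mean.\<close>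

lemma expectation_Max_point_to_line:
  fixes m :: nat
  assumes "k \<ge> 1" "l > 0" "\<tau> \<ge> 0"
  defines "S \<equiv> (\<lambda>\<omega>. Max ((\<lambda>w. lpp (paths_from w k) (\<lambda>v. clip \<tau> (X v \<omega>))) ` lattice_box m))"
  shows "integrable M S"
    and "expectation S \<le> line_mean k + (l\<^sup>2 * \<tau>\<^sup>2 * k / 8 + ln (real (m + 1) ^ CARD('d))) / l"
proof -
  let ?U = "lattice_box m :: (nat ^ 'd) set"
  define Y where "Y w \<omega> = lpp (paths_from w k) (\<lambda>v. clip \<tau> (X v \<omega>))" for w \<omega>
  have U: "finite ?U" "?U \<noteq> {}" using zero_in_lattice_box by (auto simp del: zero_in_lattice_box)
  have lay: "layered_iid_field M X (mu \<alpha>) (paths_from w k) level" for w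
    by (intro layered_iid layered_family_paths_from assms)
  have int: "integrable M (Y w)" "integrable M (\<lambda>\<omega>. exp (l * Y w \<omega>))" for w
    unfolding Y_def using layered_iid_field.integrable_clipped[OF lay] layered_iid_field.integrable_exp_clipped[OF lay] assms by auto
  have mgf: "expectation (\<lambda>\<omega>. exp (l * Y w \<omega>)) \<le> exp (l * line_mean k + l\<^sup>2 * \<tau>\<^sup>2 * k / 8)" for w
  proof -
    have "expectation (\<lambda>\<omega>. exp (l * Y w \<omega>))
        \<le> exp (l * expectation (Y w) + l\<^sup>2 * \<tau>\<^sup>2 * card (level ` \<Union>(paths_from w k)) / 8)"
      using layered_iid_field.lpp_clip_mgf[OF lay, of l \<tau> 1 w] assms unfolding Y_def by simp
    also have "\<dots> \<le> exp (l * line_mean k + l\<^sup>2 * \<tau>\<^sup>2 * k / 8)"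
    proof -
      have "expectation (Y w) \<le> line_mean k"
        unfolding Y_def line_mean_def using expectation_clip_translate[OF assms(1), of w \<tau>]
          expectation_clip_le[OF layered_family_paths_from[OF assms(1)] assms(3), of 0] by simp
      hence "l * expectation (Y w) \<le> l * line_mean k" using assms by simp
      moreover have "l\<^sup>2 * \<tau>\<^sup>2 * card (level ` \<Union>(paths_from w k)) \<le> l\<^sup>2 * \<tau>\<^sup>2 * k"
        using card_level_paths_from[of w k] by (intro mult_left_mono) auto
      ultimately show ?thesis by simp
    qed
    finally show ?thesis .
  qed
  show "integrable M S" unfolding S_def
    using expectation_Max_le(1)[OF U assms(2) int mgf] by (simp add: Y_def)
  have "expectation S \<le> line_mean k + (l\<^sup>2 * \<tau>\<^sup>2 * k / 8 + ln (card ?U)) / l"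
    unfolding S_def using expectation_Max_le(2)[OF U assms(2) int mgf] by (simp add: Y_def)
  also have "ln (card ?U) \<le> ln (real (m + 1) ^ CARD('d))"
  proof (subst ln_le_cancel_iff)
    show "real (card ?U) \<le> real (m + 1) ^ CARD('d)"
      using card_lattice_box_le[where n = m and 'd = 'd] by (metis of_nat_le_iff of_nat_power)
  qed (use U in \<open>auto simp: card_gt_0_iff\<close>)
  finally show "expectation S \<le> line_mean k + (l\<^sup>2 * \<tau>\<^sup>2 * k / 8 + ln (real (m + 1) ^ CARD('d))) / l"
    using assms(2) by (simp add: divide_right_mono)
qed

text \<open>Means of point-to-line passage times are almost subadditive: the second half of a path is optimized
  over its starting site as well, which costs little by concentration.\<close>

lemma line_mean_double:
  obtains C where "C > 0" "\<And>k l \<tau>. k \<ge> 1 \<Longrightarrow> l > 0 \<Longrightarrow> \<tau> \<ge> 0 \<Longrightarrow>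
    line_mean (2 * k) \<le> 2 * line_mean k + (l * \<tau>\<^sup>2 * k / 8 + ln ((2 * real k + 1) ^ CARD('d)) / l)
      + (3 * real k + 1) ^ CARD('d) * (C * exp (- (\<tau> powr \<alpha> / 4)))"
proof -
  obtain C where C: "C > 0" "\<And>B \<tau>. 0 \<le> \<tau> \<Longrightarrow> integrable M (excess B \<tau>)"
    "\<And>B \<tau>. 0 \<le> \<tau> \<Longrightarrow> expectation (excess B \<tau>) \<le> card B * (C * exp (- (\<tau> powr \<alpha> / 4)))"
    using expectation_excess by blast
  show ?thesis
  proof (rule that[OF C(1)])
    fix k :: nat and l \<tau> :: real assume k: "k \<ge> 1" and l: "l > 0" and \<tau>: "\<tau> \<ge> 0"
    let ?U = "lattice_box (2 * k) :: (nat ^ 'd) set"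
    let ?B = "lattice_box (3 * k) :: (nat ^ 'd) set"
    define S where "S \<omega> = Max ((\<lambda>w. lpp (paths_from w k) (\<lambda>v. clip \<tau> (X v \<omega>))) ` ?U)" for \<omega>
    have S: "integrable M S"
      "expectation S \<le> line_mean k + (l\<^sup>2 * \<tau>\<^sup>2 * k / 8 + ln (real (2 * k + 1) ^ CARD('d))) / l"
      using expectation_Max_point_to_line[OF k l \<tau>, of "2 * k"] unfolding S_def[abs_def] by blast+
    have le: "AE \<omega> in M. lpp (paths_from 0 (2 * k)) (\<lambda>v. X v \<omega>)
        \<le> lpp (paths_from 0 k) (\<lambda>v. X v \<omega>) + (S \<omega> + excess ?B \<tau> \<omega>)"
      using AE_all_nonneg
    proof eventually_elim
      case (elim \<omega>)
      have "lpp (paths_from 0 (k + k)) (\<lambda>v. X v \<omega>) \<le> lpp (paths_from 0 k) (\<lambda>v. X v \<omega>)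
          + Max ((\<lambda>w. lpp (paths_from w k) (\<lambda>v. X v \<omega>)) ` lattice_box (k + k))"
        by (rule lpp_paths_from_split[OF k k])
      also have "Max ((\<lambda>w. lpp (paths_from w k) (\<lambda>v. X v \<omega>)) ` lattice_box (k + k)) \<le> S \<omega> + excess ?B \<tau> \<omega>"
      proof (rule Max.boundedI)
        fix y assume "y \<in> (\<lambda>w. lpp (paths_from w k) (\<lambda>v. X v \<omega>)) ` (lattice_box (k + k) :: (nat ^ 'd) set)"
        then obtain w :: "nat ^ 'd" where w: "w \<in> ?U" "y = lpp (paths_from w k) (\<lambda>v. X v \<omega>)"
          by (auto simp: mult_2)
        have "\<Union>(paths_from w k) \<subseteq> ?B" using paths_from_in_box[OF w(1), of _ k] by (simp add: Sup_le_iff)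
        hence "y \<le> lpp (paths_from w k) (\<lambda>v. clip \<tau> (X v \<omega>)) + excess ?B \<tau> \<omega>"
          unfolding w(2) by (intro lpp_sandwich(2) layered_family_paths_from k \<tau> elim) auto
        also have "lpp (paths_from w k) (\<lambda>v. clip \<tau> (X v \<omega>)) \<le> S \<omega>"
          unfolding S_def using w(1) by (intro Max_ge) auto
        finally show "y \<le> S \<omega> + excess ?B \<tau> \<omega>" by simp
      qed (use zero_in_lattice_box in \<open>auto simp del: zero_in_lattice_box\<close>)
      finally show ?case by (simp add: mult_2)
    qed
    have "line_mean (2 * k) \<le> expectation (\<lambda>\<omega>. lpp (paths_from 0 k) (\<lambda>v. X v \<omega>) + (S \<omega> + excess ?B \<tau> \<omega>))"
      unfolding line_mean_def
    proof (rule integral_mono_AE[OF _ _ le])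
      show "integrable M (\<lambda>\<omega>. lpp (paths_from 0 (2 * k)) (\<lambda>v. X v \<omega>))"
        using k by (intro integrable_lpp layered_family_paths_from) simp
      show "integrable M (\<lambda>\<omega>. lpp (paths_from 0 k) (\<lambda>v. X v \<omega>) + (S \<omega> + excess ?B \<tau> \<omega>))"
        using k \<tau> S(1) by (intro Bochner_Integration.integrable_add integrable_lpp layered_family_paths_from C(2))
    qed
    also have "\<dots> = line_mean k + (expectation S + expectation (excess ?B \<tau>))"
      using S(1) C(2)[OF \<tau>] integrable_lpp[OF layered_family_paths_from[OF k, of 0]]
      by (simp add: line_mean_def)
    also have "expectation (excess ?B \<tau>) \<le> card ?B * (C * exp (- (\<tau> powr \<alpha> / 4)))" by (rule C(3)[OF \<tau>])
    also have "\<dots> \<le> (3 * real k + 1) ^ CARD('d) * (C * exp (- (\<tau> powr \<alpha> / 4)))"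
    proof (rule mult_right_mono)
      have "real (card ?B) \<le> real ((3 * k + 1) ^ CARD('d))"
        using card_lattice_box_le[where n = "3 * k" and 'd = 'd] by (simp only: of_nat_le_iff)
      thus "real (card ?B) \<le> (3 * real k + 1) ^ CARD('d)" by (simp add: add.commute)
    qed (use C(1) in simp)
    finally have "line_mean (2 * k) \<le> line_mean k + (expectation S + (3 * real k + 1) ^ CARD('d) * (C * exp (- (\<tau> powr \<alpha> / 4))))"
      by simp
    moreover have "(l\<^sup>2 * \<tau>\<^sup>2 * k / 8 + ln (real (2 * k + 1) ^ CARD('d))) / l
        = l * \<tau>\<^sup>2 * k / 8 + ln ((2 * real k + 1) ^ CARD('d)) / l"
      using l by (simp add: add_divide_distrib power2_eq_square mult.assoc add.commute)
    ultimately show "line_mean (2 * k) \<le> 2 * line_mean k + (l * \<tau>\<^sup>2 * k / 8 + ln ((2 * real k + 1) ^ CARD('d)) / l)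
      + (3 * real k + 1) ^ CARD('d) * (C * exp (- (\<tau> powr \<alpha> / 4)))" using S(2) by linarith
  qed
qed

text \<open>Counting paths would not give this bound: there are exponentially many of them, and the tails of
  sums of \<open>n\<close> weights decay more slowly than exponentially in \<open>n\<close>.\<close>

lemma line_mean_linear:
  obtains C :: real where "C \<ge> 0" "\<And>n. n \<ge> 1 \<Longrightarrow> line_mean n \<le> C * n"
proof -
  obtain C where "C > 0" and C: "\<And>k l \<tau>. k \<ge> 1 \<Longrightarrow> l > 0 \<Longrightarrow> \<tau> \<ge> 0 \<Longrightarrow>
    line_mean (2 * k) \<le> 2 * line_mean k + (l * \<tau>\<^sup>2 * k / 8 + ln ((2 * real k + 1) ^ CARD('d)) / l)
      + (3 * real k + 1) ^ CARD('d) * (C * exp (- (\<tau> powr \<alpha> / 4)))"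
    by (rule line_mean_double) (rule that)
  obtain K where K: "K \<ge> 0" "\<And>k. k \<ge> 1 \<Longrightarrow>
      (real k powr (-(1/2)) * (real k powr (1/8))\<^sup>2 * k / 8 + ln ((2 * real k + 1) ^ CARD('d)) / (real k powr (-(1/2)))) +
      (3 * real k + 1) ^ CARD('d) * (C * exp (- ((real k powr (1/8)) powr \<alpha> / 4))) \<le> K * real k powr (3/4)"
    by (rule dyadic_error_bound[OF \<alpha>_pos, where C = C and d = "CARD('d)"]) (rule that)
  have int: "integrable M (\<lambda>\<omega>. lpp (paths_from 0 k) (\<lambda>v. X v \<omega>))" if "k \<ge> 1" for k
    using that by (intro integrable_lpp layered_family_paths_from)
  show ?thesis
  proof (rule dyadic_almost_subadditive_bound[of line_mean K])
    show "0 \<le> line_mean k" if "k \<ge> 1" for k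
      unfolding line_mean_def
    proof (rule integral_nonneg_AE)
      show "AE \<omega> in M. 0 \<le> lpp (paths_from 0 k) (\<lambda>v. X v \<omega>)"
        using AE_all_nonneg by eventually_elim (intro lpp_nonneg paths_from_nonempty that, auto)
    qed
    show "line_mean j \<le> line_mean k" if "1 \<le> j" "j \<le> k" for j k
      unfolding line_mean_def
    proof (rule integral_mono_AE)
      show "AE \<omega> in M. lpp (paths_from 0 j) (\<lambda>v. X v \<omega>) \<le> lpp (paths_from 0 k) (\<lambda>v. X v \<omega>)"
        using AE_all_nonneg by eventually_elim (intro lpp_paths_from_mono that, auto)
    qed (use int that in auto)
    show "line_mean (2 * k) \<le> 2 * line_mean k + K * real k powr (3/4)" if "k \<ge> 1" for k
      using C[OF that, of "real k powr (-(1/2))" "real k powr (1/8)"] K(2)[OF that] that by simp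
  qed (use K(1) that in auto)
qed

definition passage :: "nat \<Rightarrow> 'a \<Rightarrow> real" where
  "passage n \<omega> = lpp (directed_paths 0 (diag n)) (\<lambda>v. X v \<omega>)"

lemma integrable_passage [simp]: "integrable M (passage n)"
  unfolding passage_def by (rule integrable_lpp[OF layered_family_directed])

lemma measurable_passage [measurable]: "passage n \<in> borel_measurable M"
  using integrable_passage by (rule borel_measurable_integrable)

definition g :: real where
  "g = time_constant M X (\<chi> i. 1)"

text \<open>By concatenation and translation invariance, \<open>expectation (passage n) - expectation (X 0)\<close> is
  superadditive, and comparison with paths that have a free end point bounds it linearly. So the limit
  in the definition of the time constant exists; being a supremum, it bounds the mean for every \<open>n\<close>, up to
  the mean of one weight.\<close>

lemma time_constant_limit:
  shows "(\<lambda>n. expectation (passage n) / n) \<longlonglongrightarrow> g"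
    and "expectation (passage n) \<le> g * n + expectation (X 0)"
proof -
  define b where "b n = expectation (passage n) - expectation (X 0)" for n
  have X_mean: "expectation (X v) = expectation (X 0)" for v
  proof -
    have "expectation (X v) = (\<integral>x. x \<partial>mu \<alpha>)" for v
      unfolding distr_X[of v, symmetric] by (rule integral_distr[symmetric]) auto
    thus ?thesis by simp
  qed
  obtain C :: real where C: "C \<ge> 0" "\<And>n. n \<ge> 1 \<Longrightarrow> line_mean n \<le> C * n"
    by (rule line_mean_linear) (rule that)
  have super: "b m + b n \<le> b (m + n)" for m n
  proof -
    have "expectation (passage m) + expectation (\<lambda>\<omega>. lpp (directed_paths 0 (diag n)) (\<lambda>v. X (diag m + v) \<omega>))
        = expectation (\<lambda>\<omega>. passage m \<omega> + lpp (directed_paths 0 (diag n)) (\<lambda>v. X (diag m + v) \<omega>))"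
      using integrable_translate_directed by simp
    also have "\<dots> \<le> expectation (\<lambda>\<omega>. passage (m + n) \<omega> + X (diag m) \<omega>)"
      unfolding passage_def[abs_def]
      using integrable_translate_directed integrable_X integrable_lpp[OF layered_family_directed]
      by (intro integral_mono last_passage_superadditive Bochner_Integration.integrable_add)
    also have "\<dots> = expectation (passage (m + n)) + expectation (X 0)"
      using integrable_X X_mean by simp
    finally show ?thesis by (simp add: b_def expectation_translate_directed passage_def[abs_def])
  qed
  have X0: "expectation (X 0) \<ge> 0" using AE_nonneg by (rule integral_nonneg_AE)
  have bound: "b n \<le> (C * (CARD('d) + 1)) * n" if n: "n \<ge> 1" for n
  proof -
    have "expectation (passage n) \<le> line_mean (CARD('d) * n + 1)"
      unfolding line_mean_def passage_def
      by (intro integral_mono integrable_lpp layered_family_directed layered_family_paths_from last_passage_le_paths_from) simp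
    also have "\<dots> \<le> C * (CARD('d) * n + 1)" using C(2)[of "CARD('d) * n + 1"] by simp
    also have "\<dots> \<le> C * ((CARD('d) + 1) * n)" using C(1) n by (intro mult_left_mono) (auto simp: algebra_simps)
    finally show ?thesis using X0 by (simp add: b_def algebra_simps)
  qed
  obtain h where h: "(\<lambda>n. b n / n) \<longlonglongrightarrow> h" "\<And>n. b n \<le> h * n"
    by (rule superadditive_limit[of b, OF super bound]) (assumption, rule that)
  have lim: "(\<lambda>n. expectation (passage n) / n) \<longlonglongrightarrow> h"
  proof -
    have "(\<lambda>n. b n / n + expectation (X 0) / n) \<longlonglongrightarrow> h + 0"
      by (intro tendsto_add h lim_const_over_n)
    thus ?thesis by (simp add: b_def diff_divide_distrib)
  qed
  have "g = h" unfolding g_def time_constant_def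
    by (rule limI) (use lim in \<open>simp add: last_passage_eq_lpp passage_def[abs_def]\<close>)
  thus "(\<lambda>n. expectation (passage n) / n) \<longlonglongrightarrow> g" "expectation (passage n) \<le> g * n + expectation (X 0)"
    using lim h(2)[of n] by (auto simp: b_def)
qed

end

section \<open>Tail bounds for the passage time\<close>

text \<open>After division by their sum the terms lie in \<open>{0..1}\<close>, where \<open>x \<le> x powr \<alpha>\<close>.\<close>

lemma powr_sum_subadditive:
  fixes a :: "'v \<Rightarrow> real"
  assumes "\<And>v. v \<in> B \<Longrightarrow> 0 \<le> a v" "0 < \<alpha>" "\<alpha> \<le> 1"
  shows "(\<Sum>v\<in>B. a v) powr \<alpha> \<le> (\<Sum>v\<in>B. a v powr \<alpha>)"
proof (cases "finite B \<and> (\<Sum>v\<in>B. a v) \<noteq> 0")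
  case True
  define S where "S = (\<Sum>v\<in>B. a v)"
  have S: "S > 0" using True sum_nonneg[of B a] assms(1) by (auto simp: S_def order_less_le)
  have "a v / S \<le> a v powr \<alpha> / S powr \<alpha>" if v: "v \<in> B" for v
  proof -
    have "a v \<le> S" unfolding S_def using True v assms(1) by (intro member_le_sum) auto
    hence le1: "a v / S \<le> 1" "0 \<le> a v / S" using S assms(1)[OF v] by auto
    have "a v / S = (a v / S) powr 1" using S assms(1)[OF v] by simp
    also have "\<dots> \<le> (a v / S) powr \<alpha>"
      using le1 assms(3) by (intro powr_mono')
    also have "\<dots> = a v powr \<alpha> / S powr \<alpha>" using S assms(1)[OF v] by (intro powr_divide)
    finally show ?thesis .
  qed
  hence "(\<Sum>v\<in>B. a v / S) \<le> (\<Sum>v\<in>B. a v powr \<alpha> / S powr \<alpha>)" by (rule sum_mono)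
  hence "S / S \<le> (\<Sum>v\<in>B. a v powr \<alpha>) / S powr \<alpha>" by (simp add: sum_divide_distrib[symmetric] S_def)
  thus ?thesis using S by (simp add: S_def[symmetric] pos_le_divide_eq)
qed (auto intro!: sum_nonneg)

context lpp_field
begin

text \<open>With \<open>\<delta> = (1 - \<alpha>) / 4\<close>, weights clipped at \<open>n powr \<delta>\<close> give deviation probabilities of order
  \<open>exp (- c * n powr (1 - 2 * \<delta>))\<close>, and \<open>1 - 2 * \<delta> = (1 + \<alpha>) / 2\<close> exceeds the exponent \<open>\<alpha>\<close> of the speed. On the
  other hand \<open>exp (- c * threshold n powr \<alpha>)\<close> still beats the polynomial number of sites in the box.\<close>

definition threshold :: "nat \<Rightarrow> real" where
  "threshold n = real n powr ((1 - \<alpha>) / 4)"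

definition clipped :: "nat \<Rightarrow> 'a \<Rightarrow> real" where
  "clipped n \<omega> = lpp (directed_paths 0 (diag n)) (\<lambda>v. clip (threshold n) (X v \<omega>))"

lemma measurable_clipped [measurable]: "clipped n \<in> borel_measurable M"
  unfolding clipped_def[abs_def]
  by (rule layered_iid_field.clipped_measurable[OF layered_iid[OF layered_family_directed]])

lemma measurable_excess [measurable]: "excess B \<tau> \<in> borel_measurable M"
  unfolding excess_def[abs_def] by measurable

lemma threshold_nonneg: "threshold n \<ge> 0" by (simp add: threshold_def)

lemma directed_paths_in_box: "\<Union>(directed_paths 0 (diag n)) \<subseteq> (lattice_box n :: (nat ^ 'd) set)"
  using directed_path_in_box(1) by blast

lemma AE_passage_sandwich:
  "AE \<omega> in M. clipped n \<omega> \<le> passage n \<omega> \<and> passage n \<omega> \<le> clipped n \<omega> + excess (lattice_box n) (threshold n) \<omega>"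
  using AE_all_nonneg
proof eventually_elim
  case (elim \<omega>)
  thus ?case unfolding clipped_def passage_def
    using lpp_sandwich[OF layered_family_directed directed_paths_in_box finite_lattice_box threshold_nonneg elim] by blast
qed

text \<open>The constant \<open>K\<close> is arbitrary because the exponent in McDiarmid's inequality, which is of order
  \<open>n powr ((1 + \<alpha>) / 2)\<close>, outgrows \<open>n powr \<alpha>\<close>.\<close>

lemma clipped_concentration:
  fixes \<epsilon> :: real
  assumes "\<epsilon> > 0" "s = 1 \<or> s = - 1"
  shows "\<forall>\<^sub>F n in sequentially. prob {\<omega> \<in> space M. s * (clipped n \<omega> - expectation (clipped n)) \<ge> \<epsilon> * n}
    \<le> exp (- (K * real n powr \<alpha>))"
proof -
  have ev: "\<forall>\<^sub>F n in sequentially. K * real n powr \<alpha> \<le> 2 * (\<epsilon> * real n)\<^sup>2 / ((threshold n)\<^sup>2 * (real CARD('d) * n + 1))"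
  proof -
    \<comment> \<open>For \<open>n \<ge> 1\<close> the exponent of the deviation bound is at least \<open>c * n powr ((1 + \<alpha>) / 2)\<close>.\<close>
    define c where "c = 2 * \<epsilon>\<^sup>2 / (real CARD('d) + 1)"
    have c: "c > 0" using assms(1) by (simp add: c_def add_pos_pos)
    have "filterlim (\<lambda>n. c * real n powr ((1 - \<alpha>) / 2)) at_top sequentially"
      using c \<alpha>_less_1 by real_asymp
    hence "\<forall>\<^sub>F n in sequentially. K \<le> c * real n powr ((1 - \<alpha>) / 2)"
      unfolding filterlim_at_top by blast
    thus ?thesis using eventually_gt_at_top[of 0]
    proof eventually_elim
      case (elim n)
      define m where "m = real n"
      have m: "m \<ge> 1" using elim by (simp add: m_def)
      have th: "(threshold n)\<^sup>2 = m powr ((1 - \<alpha>) / 2)"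
        by (simp add: threshold_def m_def power2_eq_square powr_add[symmetric])
      have e: "m powr ((1 - \<alpha>) / 2) * m powr \<alpha> * m powr ((1 - \<alpha>) / 2) = m"
        using m by (simp add: powr_add[symmetric])
      have "real CARD('d) * m + 1 \<le> (real CARD('d) + 1) * m" using m by (simp add: distrib_right)
      hence "(threshold n)\<^sup>2 * (real CARD('d) * m + 1) \<le> m powr ((1 - \<alpha>) / 2) * ((real CARD('d) + 1) * m)"
        unfolding th by (intro mult_left_mono) auto
      hence "2 * (\<epsilon> * m)\<^sup>2 / (m powr ((1 - \<alpha>) / 2) * ((real CARD('d) + 1) * m))
          \<le> 2 * (\<epsilon> * m)\<^sup>2 / ((threshold n)\<^sup>2 * (real CARD('d) * m + 1))"
        using m th by (intro divide_left_mono mult_pos_pos add_nonneg_pos) auto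
      moreover have "2 * (\<epsilon> * m)\<^sup>2 / (m powr ((1 - \<alpha>) / 2) * ((real CARD('d) + 1) * m))
          = c * (m / m powr ((1 - \<alpha>) / 2))"
      proof -
        have "2 * (\<epsilon> * m)\<^sup>2 / (p * (q * m)) = 2 * \<epsilon>\<^sup>2 / q * (m / p)" if "p > 0" "q > 0" for p q
          using m that by (simp add: power2_eq_square field_simps)
        thus ?thesis unfolding c_def using m by (simp add: add_nonneg_pos)
      qed
      moreover have "m / m powr ((1 - \<alpha>) / 2) = m powr ((1 - \<alpha>) / 2) * m powr \<alpha>"
        using e m by (simp add: field_simps)
      moreover have "K * m powr \<alpha> \<le> c * m powr ((1 - \<alpha>) / 2) * m powr \<alpha>"
        using elim(1) unfolding m_def by (rule mult_right_mono) simp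
      ultimately show ?case unfolding m_def[symmetric] by (simp only: mult.assoc)
    qed
  qed
  show ?thesis using ev eventually_gt_at_top[of 0]
  proof eventually_elim
    case (elim n)
    have th: "threshold n > 0" using elim by (simp add: threshold_def)
    have "prob {\<omega> \<in> space M. s * (clipped n \<omega> - expectation (clipped n)) \<ge> \<epsilon> * n}
        \<le> exp (- (2 * (\<epsilon> * real n)\<^sup>2) / ((threshold n)\<^sup>2 * real (CARD('d) * n + 1)))"
      unfolding clipped_def[abs_def]
      by (rule layered_iid_field.lpp_clip_deviation[OF layered_iid[OF layered_family_directed] _ th assms(2) card_level_directed])
        (use assms elim in simp)
    also have "\<dots> \<le> exp (- (K * real n powr \<alpha>))" using elim(1) by (simp add: add.commute)
    finally show ?case .
  qed
qed

lemma expectation_clipped_le: "expectation (clipped n) \<le> g * n + expectation (X 0)"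
proof -
  have "expectation (clipped n) \<le> expectation (passage n)"
    unfolding clipped_def passage_def by (rule expectation_clip_le[OF layered_family_directed threshold_nonneg])
  thus ?thesis using time_constant_limit(2)[of n] by linarith
qed

lemma box_excess_negligible:
  fixes D c :: real
  assumes "c > 0" "\<epsilon> > 0" "D \<ge> 0"
  shows "\<forall>\<^sub>F n in sequentially. real (card (lattice_box n :: (nat ^ 'd) set)) * (D * exp (- (c * threshold n powr \<alpha>))) \<le> \<epsilon>"
proof -
  have "(\<lambda>n. D * ((real n + 1) powr CARD('d) * exp (- (c * (real n powr ((1 - \<alpha>) / 4)) powr \<alpha>)))) \<longlonglongrightarrow> D * 0"
    using assms \<alpha>_pos \<alpha>_less_1 by (intro tendsto_mult tendsto_const) real_asymp
  hence "\<forall>\<^sub>F n in sequentially. D * ((real n + 1) powr CARD('d) * exp (- (c * (real n powr ((1 - \<alpha>) / 4)) powr \<alpha>))) < \<epsilon>"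
    using assms by (intro order_tendstoD(2)) auto
  thus ?thesis
  proof eventually_elim
    case (elim n)
    have "real (card (lattice_box n :: (nat ^ 'd) set)) \<le> real ((n + 1) ^ CARD('d))"
      using card_lattice_box_le[where n = n and 'd = 'd] by (simp only: of_nat_le_iff)
    also have "\<dots> = (real n + 1) powr CARD('d)" by (simp add: powr_realpow add.commute)
    finally have "real (card (lattice_box n :: (nat ^ 'd) set)) * (D * exp (- (c * threshold n powr \<alpha>)))
        \<le> (real n + 1) powr CARD('d) * (D * exp (- (c * threshold n powr \<alpha>)))"
      using assms(3) by (intro mult_right_mono) auto
    thus ?case using elim by (simp add: threshold_def mult_ac)
  qed
qed

lemma expectation_clipped_ge:
  assumes "\<epsilon> > 0"
  shows "\<forall>\<^sub>F n in sequentially. expectation (clipped n) \<ge> (g - \<epsilon>) * n"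
proof -
  obtain C where C: "C > 0" "\<And>B \<tau>. 0 \<le> \<tau> \<Longrightarrow> integrable M (excess B \<tau>)"
    "\<And>B \<tau>. 0 \<le> \<tau> \<Longrightarrow> expectation (excess B \<tau>) \<le> card B * (C * exp (- (\<tau> powr \<alpha> / 4)))"
    by (rule expectation_excess) (rule that)
  have "\<forall>\<^sub>F n in sequentially. g - \<epsilon> / 2 < expectation (passage n) / n"
    by (rule order_tendstoD(1)[OF time_constant_limit(1)]) (use assms in simp)
  moreover have "\<forall>\<^sub>F n in sequentially.
      real (card (lattice_box n :: (nat ^ 'd) set)) * (C * exp (- (1/4 * threshold n powr \<alpha>))) \<le> \<epsilon> / 2"
    by (rule box_excess_negligible) (use assms C(1) in auto)
  ultimately show ?thesis using eventually_gt_at_top[of 0]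
  proof eventually_elim
    case (elim n)
    let ?B = "lattice_box n :: (nat ^ 'd) set"
    have int: "integrable M (clipped n)" unfolding clipped_def[abs_def]
      by (rule layered_iid_field.integrable_clipped[OF layered_iid[OF layered_family_directed] threshold_nonneg])
    have "expectation (passage n) \<le> expectation (\<lambda>\<omega>. clipped n \<omega> + excess ?B (threshold n) \<omega>)"
      using AE_passage_sandwich[of n] int C(2)[OF threshold_nonneg]
      by (intro integral_mono_AE) auto
    also have "\<dots> = expectation (clipped n) + expectation (excess ?B (threshold n))"
      using int C(2)[OF threshold_nonneg] by simp
    also have "\<dots> \<le> expectation (clipped n) + \<epsilon> / 2" using C(3)[OF threshold_nonneg[of n], of ?B] elim(2) by simp
    also have "\<dots> \<le> expectation (clipped n) + \<epsilon> / 2 * n" using elim(3) assms by simp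
    finally have "expectation (passage n) \<le> expectation (clipped n) + \<epsilon> / 2 * n" .
    moreover have "(g - \<epsilon> / 2) * n < expectation (passage n)" using elim(1,3) by (simp add: pos_less_divide_eq)
    ultimately show ?case by (simp add: algebra_simps)
  qed
qed

text \<open>The clipped passage time is a lower bound for the passage time, and clipping hardly changes the mean.\<close>

lemma passage_lower_tail:
  assumes "\<epsilon> > 0"
  shows "\<forall>\<^sub>F n in sequentially. prob {\<omega> \<in> space M. passage n \<omega> \<le> (g - \<epsilon>) * n} \<le> exp (- (K * real n powr \<alpha>))"
proof -
  have e: "\<epsilon> / 2 > 0" using assms by simp
  show ?thesis using clipped_concentration[OF e disjI2[OF refl], where K = K] expectation_clipped_ge[OF e]
  proof eventually_elim
    case (elim n)
    have "prob {\<omega> \<in> space M. passage n \<omega> \<le> (g - \<epsilon>) * n}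
        \<le> prob {\<omega> \<in> space M. - 1 * (clipped n \<omega> - expectation (clipped n)) \<ge> \<epsilon> / 2 * n}"
    proof (rule finite_measure_mono_AE)
      show "AE \<omega> in M. \<omega> \<in> {\<omega> \<in> space M. passage n \<omega> \<le> (g - \<epsilon>) * n}
          \<longrightarrow> \<omega> \<in> {\<omega> \<in> space M. - 1 * (clipped n \<omega> - expectation (clipped n)) \<ge> \<epsilon> / 2 * n}"
        using AE_passage_sandwich[of n]
      proof eventually_elim
        case (elim \<omega>)
        thus ?case using \<open>(g - \<epsilon> / 2) * n \<le> expectation (clipped n)\<close> by (auto simp: algebra_simps)
      qed
    qed measurable
    thus ?case using elim(1) by simp
  qed
qed

text \<open>The rate function originates here. By subadditivity of \<open>x powr \<alpha>\<close>, an excess of \<open>y * n\<close> forces the sum of the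
  \<open>\<alpha>\<close>-th powers of the large weights to be at least \<open>(y * n) powr \<alpha>\<close>, with equality for a single large weight.
  Exponential moments of order \<open>l < 1\<close> of that sum over the whole box are bounded uniformly in \<open>n\<close>, as each
  factor is \<open>1 + exp (- c * threshold n powr \<alpha>)\<close> up to constants.\<close>

lemma excess_tail:
  fixes l y :: real
  assumes "0 < l" "l < 1" "y > 0"
  shows "\<forall>\<^sub>F n in sequentially. prob {\<omega> \<in> space M. excess (lattice_box n) (threshold n) \<omega> \<ge> y * n}
    \<le> exp (1 - l * y powr \<alpha> * real n powr \<alpha>)"
proof -
  obtain D where D: "D > 0" "\<And>v \<tau>. 0 \<le> \<tau> \<Longrightarrow>
     integrable M (\<lambda>\<omega>. exp (l * (X v \<omega> powr \<alpha> * indicator {\<tau>..} (X v \<omega>)))) \<and>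
     expectation (\<lambda>\<omega>. exp (l * (X v \<omega> powr \<alpha> * indicator {\<tau>..} (X v \<omega>)))) \<le> 1 + D * exp (- ((1 - l) / 2 * \<tau> powr \<alpha>))"
    by (rule large_part_mgf[OF assms(1,2)]) (rule that)
  have "\<forall>\<^sub>F n in sequentially.
      real (card (lattice_box n :: (nat ^ 'd) set)) * (D * exp (- ((1 - l) / 2 * threshold n powr \<alpha>))) \<le> 1"
    by (rule box_excess_negligible) (use assms D(1) in auto)
  thus ?thesis
  proof eventually_elim
    case (elim n)
    let ?B = "lattice_box n :: (nat ^ 'd) set"
    define \<tau> where "\<tau> = threshold n"
    define Y where "Y v \<omega> = exp (l * (X v \<omega> powr \<alpha> * indicator {\<tau>..} (X v \<omega>)))" for v \<omega>
    define e where "e = D * exp (- ((1 - l) / 2 * \<tau> powr \<alpha>))"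
    have Y: "integrable M (Y v)" "expectation (Y v) \<le> 1 + e" for v
      unfolding Y_def e_def using D(2)[OF threshold_nonneg[of n], of v] by (auto simp: \<tau>_def)
    have B: "?B \<noteq> {}" using zero_in_lattice_box[of n] by blast
    have "indep_vars (\<lambda>_. borel) (\<lambda>v \<omega>. (\<lambda>x. exp (l * (x powr \<alpha> * indicator {\<tau>..} x))) (X v \<omega>)) ?B"
      by (rule indep_vars_compose2[OF indep_vars_subset[OF indep]]) auto
    hence ind: "indep_vars (\<lambda>_. borel) Y ?B" unfolding Y_def[abs_def] .
    have prod: "expectation (\<lambda>\<omega>. \<Prod>v\<in>?B. Y v \<omega>) = (\<Prod>v\<in>?B. expectation (Y v))"
      "integrable M (\<lambda>\<omega>. \<Prod>v\<in>?B. Y v \<omega>)"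
      by (rule indep_vars_lebesgue_integral[OF finite_lattice_box ind Y(1)],
          rule indep_vars_integrable[OF finite_lattice_box ind Y(1)])
    have "(\<Prod>v\<in>?B. expectation (Y v)) \<le> (\<Prod>v\<in>?B. exp e)"
    proof (rule prod_mono, intro conjI)
      fix v
      show "0 \<le> expectation (Y v)" unfolding Y_def by (intro Bochner_Integration.integral_nonneg) auto
      show "expectation (Y v) \<le> exp e" using Y(2)[of v] exp_ge_add_one_self[of e] by linarith
    qed
    also have "\<dots> = exp (card ?B * e)" by (simp add: exp_of_nat_mult)
    also have "\<dots> \<le> exp 1" using elim by (simp add: e_def \<tau>_def)
    finally have E: "expectation (\<lambda>\<omega>. \<Prod>v\<in>?B. Y v \<omega>) \<le> exp 1" using prod(1) by simp
    have "prob {\<omega> \<in> space M. excess ?B \<tau> \<omega> \<ge> y * n}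
        \<le> prob {\<omega> \<in> space M. (\<Prod>v\<in>?B. Y v \<omega>) \<ge> exp (l * (y * n) powr \<alpha>)}"
    proof (rule finite_measure_mono_AE)
      show "AE \<omega> in M. \<omega> \<in> {\<omega> \<in> space M. excess ?B \<tau> \<omega> \<ge> y * n}
          \<longrightarrow> \<omega> \<in> {\<omega> \<in> space M. (\<Prod>v\<in>?B. Y v \<omega>) \<ge> exp (l * (y * n) powr \<alpha>)}"
        using AE_all_nonneg
      proof eventually_elim
        case (elim \<omega>)
        have "exp (l * (y * n) powr \<alpha>) \<le> (\<Prod>v\<in>?B. Y v \<omega>)" if ex: "excess ?B \<tau> \<omega> \<ge> y * n"
        proof -
          have "(y * n) powr \<alpha> \<le> excess ?B \<tau> \<omega> powr \<alpha>"
            using ex assms(3) \<alpha>_pos by (intro powr_mono2) auto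
          also have "\<dots> \<le> (\<Sum>v\<in>?B. (X v \<omega> * indicator {\<tau>..} (X v \<omega>)) powr \<alpha>)"
            unfolding excess_def using elim \<alpha>_pos \<alpha>_less_1 by (intro powr_sum_subadditive) auto
          also have "\<dots> = (\<Sum>v\<in>?B. X v \<omega> powr \<alpha> * indicator {\<tau>..} (X v \<omega>))"
            by (intro sum.cong) (auto simp: indicator_def)
          finally have "l * (y * n) powr \<alpha> \<le> l * (\<Sum>v\<in>?B. X v \<omega> powr \<alpha> * indicator {\<tau>..} (X v \<omega>))"
            using assms(1) by simp
          thus ?thesis unfolding Y_def
            by (simp only: exp_sum[OF finite_lattice_box, symmetric] sum_distrib_left exp_le_cancel_iff)
        qed
        thus ?case by blast
      qed
      show "{\<omega> \<in> space M. (\<Prod>v\<in>?B. Y v \<omega>) \<ge> exp (l * (y * n) powr \<alpha>)} \<in> events"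
        unfolding Y_def by measurable
    qed
    also have "\<dots> \<le> expectation (\<lambda>\<omega>. \<Prod>v\<in>?B. Y v \<omega>) / exp (l * (y * n) powr \<alpha>)"
      by (rule integral_Markov_inequality_measure[where A = "{}"])
        (use prod(2) in \<open>auto intro!: prod_nonneg simp: Y_def\<close>)
    also have "\<dots> \<le> exp 1 / exp (l * (y * n) powr \<alpha>)" using E by (rule divide_right_mono) simp
    also have "\<dots> = exp (1 - l * y powr \<alpha> * real n powr \<alpha>)"
      using assms(3) by (simp add: exp_diff powr_mult mult.assoc)
    finally show ?case by (simp add: \<tau>_def)
  qed
qed

text \<open>A passage time above \<open>(g + y) * n\<close> requires a deviation of the clipped passage time, which is
  negligible, or an excess of nearly \<open>y * n\<close>.\<close>

lemma passage_upper_tail: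
  fixes y t :: real
  assumes "y > 0" "t < y powr \<alpha>"
  shows "\<forall>\<^sub>F n in sequentially. prob {\<omega> \<in> space M. passage n \<omega> \<ge> (g + y) * n} \<le> exp (- (t * real n powr \<alpha>))"
proof -
  \<comment> \<open>Room for two losses: \<open>t \<le> t0 < t2 < t1 < y powr \<alpha>\<close>. The excess has to reach \<open>z * n\<close>, where \<open>z < y\<close> has \<open>z powr \<alpha> = t1\<close>, and its tail bound is used with \<open>l < 1\<close> such that \<open>l * t1 = t2\<close>.\<close>
  define t0 where "t0 = max t 0"
  define t1 where "t1 = (t0 + y powr \<alpha>) / 2"
  define t2 where "t2 = (t0 + t1) / 2"
  define z where "z = t1 powr (1 / \<alpha>)"
  define l where "l = t2 / t1"
  have t: "0 \<le> t0" "t \<le> t0" "t0 < t2" "t2 < t1" "t1 < y powr \<alpha>"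
    using assms by (auto simp: t0_def t1_def t2_def)
  have l: "0 < l" "l < 1" using t by (auto simp: l_def)
  have z: "z > 0" "z powr \<alpha> = t1" using t \<alpha>_pos by (auto simp: z_def powr_powr)
  have zy: "z < y"
  proof (rule ccontr)
    assume "\<not> z < y"
    hence "y powr \<alpha> \<le> z powr \<alpha>" using assms \<alpha>_pos by (intro powr_mono2) auto
    thus False using t z by simp
  qed
  have lz: "l * z powr \<alpha> = t2" using t z by (simp add: l_def)
  define \<epsilon> where "\<epsilon> = (y - z) / 2"
  have \<epsilon>: "\<epsilon> > 0" using zy by (simp add: \<epsilon>_def)
  have ev: "\<forall>\<^sub>F n in sequentially. exp 1 + 1 \<le> exp ((t2 - t) * real n powr \<alpha>)"
  proof -
    have "t2 - t > 0" using t by simp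
    thus ?thesis using \<alpha>_pos by real_asymp
  qed
  have ev2: "\<forall>\<^sub>F n in sequentially. expectation (X 0) \<le> \<epsilon> * real n"
  proof -
    have "filterlim (\<lambda>n. \<epsilon> * real n) at_top sequentially" using \<epsilon> by real_asymp
    thus ?thesis unfolding filterlim_at_top by blast
  qed
  show ?thesis
    using clipped_concentration[OF \<epsilon> disjI1[OF refl], where K = t2] excess_tail[OF l z(1)] ev ev2
  proof eventually_elim
    case (elim n)
    let ?A = "{\<omega> \<in> space M. 1 * (clipped n \<omega> - expectation (clipped n)) \<ge> \<epsilon> * n}"
    let ?B = "{\<omega> \<in> space M. excess (lattice_box n) (threshold n) \<omega> \<ge> z * n}"
    have "prob {\<omega> \<in> space M. passage n \<omega> \<ge> (g + y) * n} \<le> prob (?A \<union> ?B)"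
    proof (rule finite_measure_mono_AE)
      show "AE \<omega> in M. \<omega> \<in> {\<omega> \<in> space M. passage n \<omega> \<ge> (g + y) * n} \<longrightarrow> \<omega> \<in> ?A \<union> ?B"
        using AE_passage_sandwich[of n]
      proof eventually_elim
        case (elim \<omega>)
        have "(2 * \<epsilon>) * n = (y - z) * n" by (simp add: \<epsilon>_def)
        hence "y * real n = 2 * (\<epsilon> * n) + z * n" by (simp add: algebra_simps)
        thus ?case using elim expectation_clipped_le[of n] \<open>expectation (X 0) \<le> \<epsilon> * real n\<close>
          by (auto simp: distrib_right)
      qed
    qed measurable
    also have "\<dots> \<le> prob ?A + prob ?B" by (rule measure_Un_le) measurable
    also have "\<dots> \<le> exp (- (t2 * real n powr \<alpha>)) + exp (1 - t2 * real n powr \<alpha>)"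
      using elim(1,2) unfolding lz by simp
    also have "\<dots> = (exp 1 + 1) * exp (- (t2 * real n powr \<alpha>))"
      by (simp add: algebra_simps exp_diff exp_minus field_simps)
    also have "\<dots> \<le> exp ((t2 - t) * real n powr \<alpha>) * exp (- (t2 * real n powr \<alpha>))"
      using elim(3) by (intro mult_right_mono) auto
    also have "\<dots> = exp (- (t * real n powr \<alpha>))" by (simp add: exp_add[symmetric] algebra_simps)
    finally show ?case .
  qed
qed

end

section \<open>A large weight at the origin\<close>

text \<open>Since all paths contain \<open>v\<close>, its weight is a common summand.\<close>

lemma lpp_extract_common:
  assumes "finite P" "P \<noteq> {}" "\<And>\<pi>. \<pi> \<in> P \<Longrightarrow> finite \<pi> \<and> v \<in> \<pi>"
  shows "lpp P x = x v + lpp ((\<lambda>\<pi>. \<pi> - {v}) ` P) x"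
proof (rule antisym)
  let ?Q = "(\<lambda>\<pi>. \<pi> - {v}) ` P"
  have split: "(\<Sum>u\<in>\<pi>. x u) = x v + (\<Sum>u\<in>\<pi> - {v}. x u)" if "\<pi> \<in> P" for \<pi>
    using assms(3)[OF that] by (simp add: sum.remove)
  show "lpp P x \<le> x v + lpp ?Q x"
  proof (rule lpp_least[OF assms(2)])
    fix \<pi> assume \<pi>: "\<pi> \<in> P"
    have "(\<Sum>u\<in>\<pi> - {v}. x u) \<le> lpp ?Q x" using assms(1) \<pi> by (intro lpp_upper) auto
    thus "(\<Sum>u\<in>\<pi>. x u) \<le> x v + lpp ?Q x" using split[OF \<pi>] by simp
  qed
  have "lpp ?Q x \<le> lpp P x - x v"
  proof (rule lpp_least)
    fix \<rho> assume "\<rho> \<in> ?Q"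
    then obtain \<pi> where \<pi>: "\<pi> \<in> P" "\<rho> = \<pi> - {v}" by auto
    thus "(\<Sum>u\<in>\<rho>. x u) \<le> lpp P x - x v" using split[OF \<pi>(1)] lpp_upper[OF assms(1) \<pi>(1), of x] by simp
  qed (use assms(2) in auto)
  thus "x v + lpp ?Q x \<le> lpp P x" by simp
qed

context lpp_field
begin

text \<open>All paths start at the origin, so \<open>rest n\<close> is the passage time without the weight of the origin.\<close>

definition rest :: "nat \<Rightarrow> 'a \<Rightarrow> real" where
  "rest n \<omega> = lpp ((\<lambda>\<pi>. \<pi> - {0}) ` directed_paths 0 (diag n)) (\<lambda>v. X v \<omega>)"

lemma passage_eq_origin_plus_rest: "passage n \<omega> = X 0 \<omega> + rest n \<omega>"
  unfolding passage_def rest_def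
proof (rule lpp_extract_common)
  fix \<pi> :: "(nat ^ 'd) set" assume \<pi>: "\<pi> \<in> directed_paths 0 (diag n)"
  show "finite \<pi> \<and> 0 \<in> \<pi>"
    using directed_path_in_box(1,4)[OF \<pi>] finite_subset finite_lattice_box by blast
qed simp_all

text \<open>The two variables are functions of the weights on disjoint sets of sites.\<close>

lemma indep_origin_rest: "indep_var borel (X 0) borel (rest n)"
proof -
  let ?P = "(\<lambda>\<pi>. \<pi> - {0}) ` directed_paths 0 (diag n) :: (nat ^ 'd) set set"
  let ?B = "\<Union>?P"
  have "indep_var (PiM {0} (\<lambda>_. borel)) (\<lambda>\<omega>. restrict (\<lambda>v. X v \<omega>) {0})
      (PiM ?B (\<lambda>_. borel)) (\<lambda>\<omega>. restrict (\<lambda>v. X v \<omega>) ?B)"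
    by (rule indep_var_restrict[OF indep]) auto
  moreover have "(\<lambda>x. x 0) \<in> PiM {0 :: nat ^ 'd} (\<lambda>_. borel :: real measure) \<rightarrow>\<^sub>M borel"
    by (rule measurable_component_singleton) simp
  moreover have "lpp ?P \<in> PiM ?B (\<lambda>_. borel) \<rightarrow>\<^sub>M borel"
    by (rule measurable_lpp[where x = "\<lambda>v \<omega>. \<omega> v"]) (auto intro!: measurable_component_singleton)
  ultimately have "indep_var borel ((\<lambda>x. x 0) \<circ> (\<lambda>\<omega>. restrict (\<lambda>v. X v \<omega>) {0}))
      borel (lpp ?P \<circ> (\<lambda>\<omega>. restrict (\<lambda>v. X v \<omega>) ?B))"
    by (rule indep_var_compose)
  moreover have "(\<lambda>x. x 0) \<circ> (\<lambda>\<omega>. restrict (\<lambda>v. X v \<omega>) {0}) = X 0" by auto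
  moreover have "lpp ?P \<circ> (\<lambda>\<omega>. restrict (\<lambda>v. X v \<omega>) ?B) = rest n"
    unfolding rest_def comp_def by (intro ext lpp_cong) auto
  ultimately show ?thesis by simp
qed

lemma measurable_rest [measurable]: "rest n \<in> borel_measurable M"
  using indep_var_rv2[OF indep_origin_rest] .

lemma origin_negligible:
  fixes \<epsilon> \<delta> :: real
  assumes "\<epsilon> > 0" "\<delta> > 0"
  shows "\<forall>\<^sub>F n in sequentially. prob {\<omega> \<in> space M. X 0 \<omega> \<ge> \<epsilon> * n} \<le> \<delta>"
proof -
  have "filterlim (\<lambda>n. \<delta> * \<epsilon> * real n) at_top sequentially" using assms by real_asymp
  hence "\<forall>\<^sub>F n in sequentially. expectation (X 0) \<le> \<delta> * \<epsilon> * real n" unfolding filterlim_at_top by blast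
  thus ?thesis using eventually_gt_at_top[of 0]
  proof eventually_elim
    case (elim n)
    have "prob {\<omega> \<in> space M. X 0 \<omega> \<ge> \<epsilon> * n} \<le> expectation (X 0) / (\<epsilon> * n)"
      by (rule integral_Markov_inequality_measure[where A = "{}"])
        (use integrable_X AE_nonneg elim assms in auto)
    also have "\<dots> \<le> \<delta>" using elim assms by (simp add: pos_divide_le_eq mult.assoc)
    finally show ?case .
  qed
qed

text \<open>The passage time is close to \<open>g * n\<close> by the two tail bounds, and the weight of the origin is small
  compared with \<open>n\<close>.\<close>

lemma rest_concentrates:
  fixes \<epsilon> :: real
  assumes "\<epsilon> > 0"
  shows "\<forall>\<^sub>F n in sequentially. prob {\<omega> \<in> space M. \<bar>rest n \<omega> - g * n\<bar> < \<epsilon> * n} \<ge> 1 / 2"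
proof -
  \<comment> \<open>The complement is covered by three events, each of probability at most \<open>1/6\<close> eventually.\<close>
  have small: "\<forall>\<^sub>F n in sequentially. exp (- (1 * real n powr \<alpha>)) \<le> 1 / 6"
    using \<alpha>_pos by real_asymp
  have e: "\<epsilon> / 2 > 0" and p: "\<epsilon> powr \<alpha> > 0" using assms by auto
  have "\<forall>\<^sub>F n in sequentially. exp (- (\<epsilon> powr \<alpha> / 2 * real n powr \<alpha>)) \<le> 1 / 6"
    using \<alpha>_pos p by real_asymp
  moreover have "\<epsilon> powr \<alpha> / 2 < \<epsilon> powr \<alpha>" using p by simp
  note passage_upper_tail[OF assms this]
  ultimately show ?thesis using passage_lower_tail[OF e, where K = 1]
    origin_negligible[OF e, of "1/6", simplified] small
  proof eventually_elim
    case (elim n)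
    let ?A1 = "{\<omega> \<in> space M. passage n \<omega> \<ge> (g + \<epsilon>) * n}"
    let ?A2 = "{\<omega> \<in> space M. passage n \<omega> \<le> (g - \<epsilon> / 2) * n}"
    let ?A3 = "{\<omega> \<in> space M. X 0 \<omega> \<ge> \<epsilon> / 2 * n}"
    let ?G = "{\<omega> \<in> space M. \<bar>rest n \<omega> - g * n\<bar> < \<epsilon> * n}"
    have "prob (space M - ?G) \<le> prob (?A1 \<union> (?A2 \<union> ?A3))"
    proof (rule finite_measure_mono_AE)
      show "AE \<omega> in M. \<omega> \<in> space M - ?G \<longrightarrow> \<omega> \<in> ?A1 \<union> (?A2 \<union> ?A3)"
        using AE_nonneg[of 0]
      proof eventually_elim
        case (elim \<omega>)
        have "\<epsilon> / 2 * n + \<epsilon> / 2 * n = \<epsilon> * n" by simp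
        thus ?case using elim passage_eq_origin_plus_rest[of n \<omega>]
          by (auto simp: distrib_right left_diff_distrib abs_real_def split: if_splits)
      qed
    qed measurable
    also have "\<dots> \<le> prob ?A1 + prob (?A2 \<union> ?A3)" by (rule measure_Un_le) measurable
    also have "prob (?A2 \<union> ?A3) \<le> prob ?A2 + prob ?A3" by (rule measure_Un_le) measurable
    also have "prob ?A1 + (prob ?A2 + prob ?A3) \<le> 1 / 2" using elim p by simp
    finally have "prob (space M - ?G) \<le> 1 / 2" by simp
    moreover have "prob (space M - ?G) = 1 - prob ?G" by (rule prob_compl) measurable
    ultimately show ?case by simp
  qed
qed

text \<open>The cheapest way to reach \<open>(g + a) * n\<close> is to give the origin a weight near \<open>a * n\<close>, at a cost of
  \<open>(a * n) powr \<alpha>\<close> in the exponent, while the rest of the passage time takes its typical value \<open>g * n\<close>.\<close>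

lemma passage_window:
  fixes a \<epsilon> \<eta> :: real
  assumes "a \<ge> 0" "\<epsilon> > 0" "\<eta> > 0"
  shows "\<forall>\<^sub>F n in sequentially. prob {\<omega> \<in> space M. \<bar>passage n \<omega> - (g + a) * n\<bar> < \<epsilon> * n}
    \<ge> exp (- ((a powr \<alpha> + \<eta>) * real n powr \<alpha>))"
proof -
  \<comment> \<open>Narrow enough that \<open>(a + \<delta>) powr \<alpha> \<le> a powr \<alpha> + \<delta> powr \<alpha> \<le> a powr \<alpha> + \<eta>\<close>.\<close>
  define \<delta> where "\<delta> = min (\<epsilon> / 2) (\<eta> powr (1 / \<alpha>))"
  have \<delta>: "\<delta> > 0" "\<delta> \<le> \<epsilon> / 2" using assms by (auto simp: \<delta>_def)
  have "\<delta> powr \<alpha> \<le> (\<eta> powr (1 / \<alpha>)) powr \<alpha>" using \<delta> \<alpha>_pos by (intro powr_mono2) (auto simp: \<delta>_def)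
  hence "\<delta> powr \<alpha> \<le> \<eta>" using assms \<alpha>_pos by (simp add: powr_powr)
  moreover have "(a + \<delta>) powr \<alpha> \<le> a powr \<alpha> + \<delta> powr \<alpha>"
    using powr_sum_subadditive[of "UNIV :: bool set" "\<lambda>b. if b then a else \<delta>" \<alpha>] assms \<delta> \<alpha>_pos \<alpha>_less_1
    by (simp add: UNIV_bool add.commute)
  ultimately have pw: "(a + \<delta>) powr \<alpha> \<le> a powr \<alpha> + \<eta>" by simp
  have e: "\<epsilon> / 2 > 0" using assms by simp
  have "filterlim (\<lambda>n. \<delta> * real n) at_top sequentially" using \<delta> by real_asymp
  hence "\<forall>\<^sub>F n in sequentially. 2 * Z_const \<alpha> \<le> \<delta> * real n" unfolding filterlim_at_top by blast
  with rest_concentrates[OF e] show ?thesis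
  proof eventually_elim
    case (elim n)
    let ?U = "{a * n..(a + \<delta>) * n}"
    let ?V = "{x. \<bar>x - g * n\<bar> < \<epsilon> / 2 * n}"
    have V: "?V \<in> sets borel" by measurable
    have "1 * exp (- ((a powr \<alpha> + \<eta>) * real n powr \<alpha>))
        \<le> (\<delta> * n / Z_const \<alpha> * (1 / 2)) * exp (- (((a + \<delta>) * n) powr \<alpha>))"
    proof (rule mult_mono)
      show "1 \<le> \<delta> * n / Z_const \<alpha> * (1 / 2)" using elim(2) Z_const_pos by (simp add: pos_le_divide_eq)
      have "((a + \<delta>) * n) powr \<alpha> \<le> (a powr \<alpha> + \<eta>) * real n powr \<alpha>"
        using pw assms \<delta> by (subst powr_mult) (auto intro: mult_right_mono)
      thus "exp (- ((a powr \<alpha> + \<eta>) * real n powr \<alpha>)) \<le> exp (- (((a + \<delta>) * n) powr \<alpha>))" by simp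
    qed (use \<delta> Z_const_pos in auto)
    also have "\<dots> = (((a + \<delta>) * n - a * n) * exp (- (((a + \<delta>) * n) powr \<alpha>)) / Z_const \<alpha>) * (1 / 2)"
      by (simp add: algebra_simps)
    also have "\<dots> \<le> prob {\<omega> \<in> space M. X 0 \<omega> \<in> ?U} * prob {\<omega> \<in> space M. \<bar>rest n \<omega> - g * n\<bar> < \<epsilon> / 2 * n}"
      using assms \<delta> elim(1) Z_const_pos
      by (intro mult_mono prob_window) (auto intro!: mult_nonneg_nonneg divide_nonneg_pos mult_right_mono)
    also have "\<dots> = prob (X 0 -` ?U \<inter> space M) * prob (rest n -` ?V \<inter> space M)"
      by (intro arg_cong2[where f = times] arg_cong[where f = prob]) auto
    also have "\<dots> = prob ((\<lambda>\<omega>. (X 0 \<omega>, rest n \<omega>)) -` (?U \<times> ?V) \<inter> space M)"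
      by (rule indep_varD[OF indep_origin_rest _ V, symmetric]) simp
    also have "\<dots> \<le> prob {\<omega> \<in> space M. \<bar>passage n \<omega> - (g + a) * n\<bar> < \<epsilon> * n}"
    proof (rule finite_measure_mono)
      have le: "\<delta> * n \<le> \<epsilon> / 2 * n" using \<delta> by (intro mult_right_mono) auto
      have eq: "\<epsilon> / 2 * n + \<epsilon> / 2 * n = \<epsilon> * n" by simp
      show "(\<lambda>\<omega>. (X 0 \<omega>, rest n \<omega>)) -` (?U \<times> ?V) \<inter> space M
          \<subseteq> {\<omega> \<in> space M. \<bar>passage n \<omega> - (g + a) * n\<bar> < \<epsilon> * n}"
      proof
        fix \<omega> assume "\<omega> \<in> (\<lambda>\<omega>. (X 0 \<omega>, rest n \<omega>)) -` (?U \<times> ?V) \<inter> space M"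
        hence *: "\<omega> \<in> space M" "a * n \<le> X 0 \<omega>" "X 0 \<omega> \<le> a * n + \<delta> * n" "\<bar>rest n \<omega> - g * n\<bar> < \<epsilon> / 2 * n"
          by (auto simp: distrib_right)
        have "\<bar>(X 0 \<omega> - a * n) + (rest n \<omega> - g * n)\<bar> < \<epsilon> * n" using *(2-4) le eq by linarith
        moreover have "passage n \<omega> - (g + a) * n = (X 0 \<omega> - a * n) + (rest n \<omega> - g * n)"
          unfolding passage_eq_origin_plus_rest by (simp add: algebra_simps)
        ultimately show "\<omega> \<in> {\<omega> \<in> space M. \<bar>passage n \<omega> - (g + a) * n\<bar> < \<epsilon> * n}" using *(1) by simp
      qed
    qed measurable
    finally show ?case by simp
  qed
qed

end

section \<open>The large deviation principle\<close>

text \<open>Testing all real \<open>t\<close> below \<open>I\<close> treats finite and infinite values of \<open>I\<close> alike.\<close>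

lemma limsup_log_prob_le:
  fixes p v :: "nat \<Rightarrow> real"
  assumes "filterlim v at_top sequentially" "\<And>n. p n \<ge> 0"
    and "\<And>t::real. ereal t < I \<Longrightarrow> \<forall>\<^sub>F n in sequentially. p n \<le> exp (- (t * v n))"
  shows "limsup (\<lambda>n. ereal (1 / v n) * log_prob (p n)) \<le> - I"
proof -
  let ?f = "\<lambda>n. ereal (1 / v n) * log_prob (p n)"
  have v: "\<forall>\<^sub>F n in sequentially. v n > 0" using assms(1) by (auto simp: filterlim_at_top_dense)
  have le: "limsup ?f \<le> - ereal t" if t: "ereal t < I" for t :: real
  proof (rule Limsup_bounded)
    show "\<forall>\<^sub>F n in sequentially. ?f n \<le> - ereal t"
      using v assms(3)[OF t]
    proof eventually_elim
      case (elim n)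
      show ?case
      proof (cases "p n = 0")
        case False
        hence p: "p n > 0" using assms(2)[of n] by simp
        have "ln (p n) \<le> ln (exp (- (t * v n)))" using elim(2) p by (subst ln_le_cancel_iff) auto
        hence "ln (p n) \<le> - (t * v n)" by simp
        hence "1 / v n * ln (p n) \<le> - t" using elim(1) by (simp add: field_simps)
        thus ?thesis using False by (simp add: log_prob_def)
      qed (use elim(1) in \<open>simp add: log_prob_def\<close>)
    qed
  qed
  show ?thesis
  proof (rule ccontr)
    assume "\<not> limsup ?f \<le> - I"
    hence "- limsup ?f < I" using ereal_uminus_less_reorder by (simp add: not_le)
    then obtain z where z: "- limsup ?f < ereal z" "ereal z < I" using ereal_dense2 by blast
    have "ereal z \<le> - limsup ?f" using le[OF z(2)] ereal_uminus_le_reorder by (metis ereal_uminus_uminus)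
    thus False using z(1) by simp
  qed
qed

lemma liminf_log_prob_ge:
  fixes p v :: "nat \<Rightarrow> real" and c :: real
  assumes "filterlim v at_top sequentially"
    and "\<And>\<eta>::real. \<eta> > 0 \<Longrightarrow> \<forall>\<^sub>F n in sequentially. exp (- ((c + \<eta>) * v n)) \<le> p n"
  shows "- ereal c \<le> liminf (\<lambda>n. ereal (1 / v n) * log_prob (p n))"
proof -
  let ?f = "\<lambda>n. ereal (1 / v n) * log_prob (p n)"
  have v: "\<forall>\<^sub>F n in sequentially. v n > 0" using assms(1) by (auto simp: filterlim_at_top_dense)
  have ge: "ereal (- (c + \<eta>)) \<le> liminf ?f" if \<eta>: "\<eta> > 0" for \<eta> :: real
  proof (rule Liminf_bounded)
    show "\<forall>\<^sub>F n in sequentially. ereal (- (c + \<eta>)) \<le> ?f n"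
      using v assms(2)[OF \<eta>]
    proof eventually_elim
      case (elim n)
      have p: "p n > 0" using elim(2) exp_gt_zero less_le_trans by blast
      have "- ((c + \<eta>) * v n) \<le> ln (p n)" using elim(2) p by (simp add: ln_ge_iff)
      hence "- (c + \<eta>) \<le> 1 / v n * ln (p n)" using elim(1) by (simp add: field_simps)
      thus ?case using p by (simp add: log_prob_def)
    qed
  qed
  show ?thesis
  proof (rule ccontr)
    assume "\<not> - ereal c \<le> liminf ?f"
    hence "liminf ?f < - ereal c" by (simp only: not_le)
    from ereal_dense2[OF this] obtain z where z: "liminf ?f < ereal z" "ereal z < - ereal c"
      by (elim exE conjE)
    have "ereal (- (c + (- c - z))) \<le> liminf ?f" by (rule ge) (use z(2) in simp)
    thus False using z(1) by simp
  qed
qed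

lemma rate_L_le_iff:
  assumes "\<alpha> > 0" "t \<ge> 0"
  shows "rate_L \<alpha> h x \<le> ereal t \<longleftrightarrow> x \<in> {h..h + t powr (1 / \<alpha>)}"
proof (cases "x \<ge> h")
  case True
  have "(x - h) powr \<alpha> \<le> t \<longleftrightarrow> x - h \<le> t powr (1 / \<alpha>)"
  proof
    assume "(x - h) powr \<alpha> \<le> t"
    hence "((x - h) powr \<alpha>) powr (1 / \<alpha>) \<le> t powr (1 / \<alpha>)" using assms by (intro powr_mono2) auto
    thus "x - h \<le> t powr (1 / \<alpha>)" using assms True by (simp add: powr_powr)
  next
    assume "x - h \<le> t powr (1 / \<alpha>)"
    hence "(x - h) powr \<alpha> \<le> (t powr (1 / \<alpha>)) powr \<alpha>" using assms True by (intro powr_mono2) auto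
    thus "(x - h) powr \<alpha> \<le> t" using assms by (simp add: powr_powr)
  qed
  thus ?thesis using True by (auto simp: rate_L_def)
qed (auto simp: rate_L_def)

lemma good_rate_function_rate_L:
  assumes "\<alpha> > 0"
  shows "good_rate_function (rate_L \<alpha> h)"
proof -
  have nonneg: "0 \<le> rate_L \<alpha> h x" for x by (simp add: rate_L_def)
  have level: "{x. rate_L \<alpha> h x \<le> ereal t} = {h..h + t powr (1 / \<alpha>)}" if "0 \<le> t" for t
    using rate_L_le_iff[OF assms that] by auto
  have "lower_semicontinuous (rate_L \<alpha> h)"
    unfolding lower_semicontinuous_def
  proof (intro allI impI)
    fix x :: real and t :: ereal assume t: "t < rate_L \<alpha> h x"
    show "\<forall>\<^sub>F y in nhds x. t < rate_L \<alpha> h y"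
    proof (cases "t < 0")
      case True
      thus ?thesis using nonneg by (intro always_eventually allI) (rule less_le_trans)
    next
      case False
      then obtain r where r: "t = ereal r" "0 \<le> r" using t by (cases t) auto
      have iff: "y \<in> - {h..h + r powr (1 / \<alpha>)} \<longleftrightarrow> t < rate_L \<alpha> h y" for y
        unfolding r(1) Compl_iff rate_L_le_iff[OF assms r(2), symmetric] not_le ..
      have "open (- {h..h + r powr (1 / \<alpha>)})" by (intro open_Compl) simp
      hence "\<forall>\<^sub>F y in nhds x. y \<in> - {h..h + r powr (1 / \<alpha>)}"
        by (rule eventually_nhds_in_open) (use t iff in blast)
      thus ?thesis unfolding iff .
    qed
  qed
  thus ?thesis using nonneg level by (auto simp: good_rate_function_def rate_function_def)
qed

context lpp_field
begin

text \<open>The level set \<open>{x. rate_L \<alpha> g x \<le> t}\<close> is a compact interval that does not meet the closure of \<open>B\<close>. So \<open>B\<close>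
  has a positive distance from it and is covered by one lower and one upper tail event, both of which
  have exponential rate larger than \<open>t\<close>.\<close>

lemma passage_LDP_upper:
  fixes B :: "real set" and t :: real
  assumes B: "B \<in> sets borel" and t: "ereal t < (INF x\<in>closure B. rate_L \<alpha> g x)"
  shows "\<forall>\<^sub>F n in sequentially. prob {\<omega> \<in> space M. passage n \<omega> / n \<in> B} \<le> exp (- (t * real n powr \<alpha>))"
proof (cases "t < 0")
  case True
  have "prob {\<omega> \<in> space M. passage n \<omega> / n \<in> B} \<le> exp (- (t * real n powr \<alpha>))" for n
  proof -
    have "0 \<le> - (t * real n powr \<alpha>)" using True by (simp add: mult_le_0_iff)
    hence "1 \<le> exp (- (t * real n powr \<alpha>))" by simp
    thus ?thesis by (rule order_trans[OF prob_le_1])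
  qed
  thus ?thesis by (intro always_eventually allI)
next
  case False
  hence t0: "t \<ge> 0" by simp
  define s where "s = t powr (1 / \<alpha>)"
  have s: "s \<ge> 0" "s powr \<alpha> = t" using t0 \<alpha>_pos by (auto simp: s_def powr_powr)
  have out: "x \<notin> {g..g + s}" if "x \<in> closure B" for x
  proof
    assume "x \<in> {g..g + s}"
    hence "rate_L \<alpha> g x \<le> ereal t" using rate_L_le_iff[OF \<alpha>_pos t0] by (simp add: s_def)
    moreover have "ereal t < rate_L \<alpha> g x" using t that by (auto simp: less_INF_D)
    ultimately show False by simp
  qed
  have op: "open (- closure B)" by (intro open_Compl closed_closure)
  have "g \<in> - closure B" "g + s \<in> - closure B" using out[of g] out[of "g + s"] s(1) by auto
  then obtain e1 e2 where e: "e1 > 0" "ball g e1 \<subseteq> - closure B" "e2 > 0" "ball (g + s) e2 \<subseteq> - closure B"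
    using op open_contains_ball by metis
  define \<epsilon> where "\<epsilon> = min e1 e2"
  have \<epsilon>: "\<epsilon> > 0" using e by (simp add: \<epsilon>_def)
  have far: "x \<le> g - \<epsilon> \<or> x \<ge> g + (s + \<epsilon>)" if x: "x \<in> B" for x
  proof -
    have xc: "x \<in> closure B" using x closure_subset by blast
    have "x \<notin> ball g \<epsilon>" "x \<notin> ball (g + s) \<epsilon>" using xc e by (auto simp: \<epsilon>_def)
    thus ?thesis using out[OF xc] by (auto simp: dist_real_def abs_real_def split: if_splits)
  qed
  define t' where "t' = (t + (s + \<epsilon>) powr \<alpha>) / 2"
  have "s powr \<alpha> < (s + \<epsilon>) powr \<alpha>" using s \<epsilon> \<alpha>_pos by (intro powr_less_mono2) auto
  hence t': "t < t'" "t' < (s + \<epsilon>) powr \<alpha>" using s by (auto simp: t'_def)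
  have "\<forall>\<^sub>F n in sequentially. 2 \<le> exp ((t' - t) * real n powr \<alpha>)"
  proof -
    have "t' - t > 0" using t' by simp
    thus ?thesis using \<alpha>_pos by real_asymp
  qed
  moreover have "s + \<epsilon> > 0" using s \<epsilon> by simp
  note passage_upper_tail[OF this t'(2)]
  ultimately show ?thesis using passage_lower_tail[OF \<epsilon>, where K = t'] eventually_gt_at_top[of 0]
  proof eventually_elim
    case (elim n)
    let ?A1 = "{\<omega> \<in> space M. passage n \<omega> \<ge> (g + (s + \<epsilon>)) * n}"
    let ?A2 = "{\<omega> \<in> space M. passage n \<omega> \<le> (g - \<epsilon>) * n}"
    have "prob {\<omega> \<in> space M. passage n \<omega> / n \<in> B} \<le> prob (?A1 \<union> ?A2)"
    proof (rule finite_measure_mono)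
      show "{\<omega> \<in> space M. passage n \<omega> / n \<in> B} \<subseteq> ?A1 \<union> ?A2"
      proof safe
        fix \<omega> assume w: "passage n \<omega> / n \<in> B" "\<not> passage n \<omega> \<le> (g - \<epsilon>) * n"
        have "\<not> passage n \<omega> / n \<le> g - \<epsilon>" using w(2) elim(4) by (simp add: pos_divide_le_eq)
        hence "g + (s + \<epsilon>) \<le> passage n \<omega> / n" using far[OF w(1)] by simp
        thus "(g + (s + \<epsilon>)) * n \<le> passage n \<omega>" using elim(4) by (simp add: pos_le_divide_eq)
      qed
    qed measurable
    also have "\<dots> \<le> prob ?A1 + prob ?A2" by (rule measure_Un_le) measurable
    also have "\<dots> \<le> 2 * exp (- (t' * real n powr \<alpha>))" using elim(2,3) by simp
    also have "\<dots> \<le> exp ((t' - t) * real n powr \<alpha>) * exp (- (t' * real n powr \<alpha>))"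
      using elim(1) by (intro mult_right_mono) auto
    also have "\<dots> = exp (- (t * real n powr \<alpha>))" by (simp add: exp_add[symmetric] algebra_simps)
    finally show ?case .
  qed
qed

lemma passage_LDP_lower:
  fixes B :: "real set" and \<eta> :: real
  assumes B: "B \<in> sets borel" and x: "x \<in> interior B" "x \<ge> g" and "\<eta> > 0"
  shows "\<forall>\<^sub>F n in sequentially. exp (- (((x - g) powr \<alpha> + \<eta>) * real n powr \<alpha>)) \<le> prob {\<omega> \<in> space M. passage n \<omega> / n \<in> B}"
proof -
  obtain \<epsilon> where \<epsilon>: "\<epsilon> > 0" "ball x \<epsilon> \<subseteq> B" using x(1) by (auto simp: mem_interior)
  have "x - g \<ge> 0" using x by simp
  \<comment> \<open>A window of half-width \<open>\<epsilon>\<close> around \<open>x = g + (x - g)\<close> lies in \<open>B\<close>.\<close>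
  from passage_window[OF this \<epsilon>(1) \<open>\<eta> > 0\<close>] eventually_gt_at_top[of 0]
  show ?thesis
  proof eventually_elim
    case (elim n)
    note elim(1)
    also have "prob {\<omega> \<in> space M. \<bar>passage n \<omega> - (g + (x - g)) * n\<bar> < \<epsilon> * n} \<le> prob {\<omega> \<in> space M. passage n \<omega> / n \<in> B}"
    proof (rule finite_measure_mono)
      show "{\<omega> \<in> space M. \<bar>passage n \<omega> - (g + (x - g)) * n\<bar> < \<epsilon> * n} \<subseteq> {\<omega> \<in> space M. passage n \<omega> / n \<in> B}"
      proof safe
        fix \<omega> assume w: "\<bar>passage n \<omega> - (g + (x - g)) * n\<bar> < \<epsilon> * n"
        have "passage n \<omega> / n - x = (passage n \<omega> - x * n) / n" using elim(2) by (simp add: field_simps)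
        hence "dist x (passage n \<omega> / n) = \<bar>passage n \<omega> - x * n\<bar> / n"
          by (subst dist_commute) (simp add: dist_real_def)
        also have "\<dots> < \<epsilon>" using w elim(2) by (simp add: pos_divide_less_eq)
        finally show "passage n \<omega> / n \<in> B" using \<epsilon>(2) by auto
      qed
      show "{\<omega> \<in> space M. passage n \<omega> / n \<in> B} \<in> events" using B by measurable
    qed
    finally show ?case .
  qed
qed

theorem passage_LDP: "LDP M (\<lambda>n \<omega>. passage n \<omega> / real n) (\<lambda>n. real n powr \<alpha>) (rate_L \<alpha> g)"
  unfolding LDP_def
proof (intro conjI ballI allI)
  show v: "filterlim (\<lambda>n. real n powr \<alpha>) at_top sequentially" using \<alpha>_pos by real_asymp
  show "rate_function (rate_L \<alpha> g)" using good_rate_function_rate_L[OF \<alpha>_pos] by (simp add: good_rate_function_def)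
  show "(\<lambda>\<omega>. passage n \<omega> / real n) \<in> borel_measurable M" for n by measurable
  fix B :: "real set" assume B: "B \<in> sets borel"
  let ?f = "\<lambda>n. ereal (1 / real n powr \<alpha>) * log_prob (prob {\<omega> \<in> space M. passage n \<omega> / real n \<in> B})"
  show "limsup ?f \<le> - (INF x\<in>closure B. rate_L \<alpha> g x)"
    by (rule limsup_log_prob_le[OF v]) (auto intro: passage_LDP_upper[OF B])
  have "- liminf ?f \<le> (INF x\<in>interior B. rate_L \<alpha> g x)"
  proof (rule INF_greatest)
    fix x assume x: "x \<in> interior B"
    show "- liminf ?f \<le> rate_L \<alpha> g x"
    proof (cases "x \<ge> g")
      case True
      have "- ereal ((x - g) powr \<alpha>) \<le> liminf ?f"
        by (rule liminf_log_prob_ge[OF v]) (rule passage_LDP_lower[OF B x True])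
      thus ?thesis using True by (simp add: rate_L_def ereal_uminus_le_reorder)
    qed (simp add: rate_L_def)
  qed
  thus "- (INF x\<in>interior B. rate_L \<alpha> g x) \<le> liminf ?f" by (simp add: ereal_uminus_le_reorder)
qed

end

theorem theorem2p11:
  fixes \<alpha> :: real
    and M :: "'a measure"
    and X :: "nat ^ 'd::finite \<Rightarrow> 'a \<Rightarrow> real"
  assumes "CARD('d) \<ge> 2"
    and "0 < \<alpha>" "\<alpha> < 1"
    and "prob_space M"
    and "prob_space.indep_vars M (\<lambda>_. borel) X UNIV"
    and "\<And>v. distr M borel (X v) = mu \<alpha>"
  shows "LDP M (\<lambda>n \<omega>. last_passage 0 (\<chi> i. n) (\<lambda>v. X v \<omega>) / real n) (\<lambda>n. real n powr \<alpha>)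
           (rate_L \<alpha> (time_constant M X (\<chi> i. 1)))
       \<and> good_rate_function (rate_L \<alpha> (time_constant M X (\<chi> i. 1)))"
proof -
  interpret lpp_field M X \<alpha>
    using assms by (intro lpp_field.intro weibull_field.intro iid_field.intro iid_field_axioms.intro weibull_field_axioms.intro)
  show ?thesis
    using passage_LDP good_rate_function_rate_L[OF \<alpha>_pos]
    by (simp add: passage_def g_def last_passage_eq_lpp)
qed

end
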